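(* Let $n\geq1$, $0<q\leq1$, and let $g,g_1,g_2,g_3,g_4\in\mathbb{C}$ be generic (so that all terms $\Delta_q(\lambda)$ and the constant $\mathcal{N}_{q,\Lambda}$ below are well defined) and satisfy $$\operatorname{Re}\bigl(1-2(n-j)g-g_1-g_2-g_3-g_4\bigr)>0\qquad (j=1,\ldots,n).$$ Then the series $\sum_{\lambda\in\Lambda}\Delta_q(\lambda)$ converges in absolute value and $$\sum_{\lambda\in\Lambda}\Delta_q(\lambda)=\mathcal{N}_{q,\Lambda},$$ where for $0<q<1$ $$\mathcal{N}_{q,\Lambda}=\prod_{1\leq j<k\leq n}\frac{(q^{1+\rho_j+\rho_k},q^{1+\rho_j-\rho_k},q^{1+g-\hat\rho_j-\hat\rho_k},q^{1+g-\hat\rho_j+\hat\rho_k};q)_\infty}{(q^{1-g+\rho_j+\rho_k},q^{1-g+\rho_j-\rho_k},q^{1-\hat\rho_j-\hat\rho_k},q^{1-\hat\rho_j+\hat\rho_k};q)_\infty}\prod_{j=1}^n\frac{(q^{1+2\rho_j};q)_\infty\prod_{r=1}^4(q^{1+\hat g_r-\hat\rho_j};q)_\infty}{(q^{1-2\hat\rho_j};q)_\infty\prod_{r=1}^4(q^{1-g_r+\rho_j};q)_\infty}$$ and for $q=1$ $$\mathcal{N}_{1,\Lambda}=\prod_{1\leq j<k\leq n}\frac{\Gamma(1-g+\rho_j+\rho_k)\Gamma(1-g+\rho_j-\rho_k)\Gamma(1-\hat\rho_j-\hat\rho_k)\Gamma(1-\hat\rho_j+\hat\rho_k)}{\Gamma(1+\rho_j+\rho_k)\Gamma(1+\rho_j-\rho_k)\Gamma(1+g-\hat\rho_j-\hat\rho_k)\Gamma(1+g-\hat\rho_j+\hat\rho_k)}\prod_{j=1}^n\frac{\Gamma(1-2\hat\rho_j)\prod_{r=1}^4\Gamma(1-g_r+\rho_j)}{\Gamma(1+2\rho_j)\prod_{r=1}^4\Gamma(1+\hat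 g_r-\hat\rho_j)}.$$
   Context: Notation: $(a;q)_m=\prod_{i=0}^{m-1}(1-aq^i)$ for integers $m\geq0$, $(a;q)_\infty=\prod_{k\geq0}(1-aq^k)$ for $|q|<1$, $(a)_m=a(a+1)\cdots(a+m-1)$, and $(a_1,\ldots,a_p;q)_m=\prod_i(a_i;q)_m$, similarly for $(a_1,\ldots,a_p)_m$; $\Gamma$ is the gamma function. Fix a permutation $(a,b,c,d)$ of $(1,2,3,4)$ and set $\hat g_a=\tfrac12(g_a+g_b+g_c+g_d)$, $\hat g_b=\tfrac12(g_a+g_b-g_c-g_d)$, $\hat g_c=\tfrac12(g_a-g_b+g_c-g_d)$, $\hat g_d=\tfrac12(g_a-g_b-g_c+g_d)$. Let $\rho_j=(n-j)g+g_a$ and $\hat\rho_j=(n-j)g+\hat g_a$ for $j=1,\ldots,n$. Let $\Lambda=\{\lambda\in\mathbb{Z}^n:\lambda_1\geq\lambda_2\geq\cdots\geq\lambda_n\geq0\}$. For $0<q<1$ and $\lambda\in\Lambda$: $$\Delta_q(\lambda)=q^{\sum_{j=1}^n(1-2\hat\rho_j)\lambda_j}\prod_{1\leq j<k\leq n}\frac{1-q^{\rho_j+\rho_k+\lambda_j+\lambda_k}}{1-q^{\rho_j+\rho_k}}\,\frac{1-q^{\rho_j-\rho_k+\lambda_j-\lambda_k}}{1-q^{\rho_j-\rho_k}}\,\frac{(q^{g+\rho_j+\rho_k};q)_{\lambda_j+\lambda_k}(q^{g+\rho_j-\rho_k};q)_{\lambda_j-\lambda_k}}{(q^{1-g+\rho_j+\rho_k};q)_{\lambda_j+\lambda_k}(q^{1-g+\rho_j-\rho_k};q)_{\lambda_j-\lambda_k}}\prod_{j=1}^n\frac{1-q^{2\rho_j+2\lambda_j}}{1-q^{2\rho_j}}\,\frac{\prod_{r=1}^4(q^{g_r+\rho_j};q)_{\lambda_j}}{\prod_{r=1}^4(q^{1-g_r+\rho_j};q)_{\lambda_j}}.$$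 For $q=1$: $$\Delta_1(\lambda)=\prod_{1\leq j<k\leq n}\Bigl(1+\frac{\lambda_j+\lambda_k}{\rho_j+\rho_k}\Bigr)\Bigl(1+\frac{\lambda_j-\lambda_k}{\rho_j-\rho_k}\Bigr)\frac{(g+\rho_j+\rho_k)_{\lambda_j+\lambda_k}(g+\rho_j-\rho_k)_{\lambda_j-\lambda_k}}{(1-g+\rho_j+\rho_k)_{\lambda_j+\lambda_k}(1-g+\rho_j-\rho_k)_{\lambda_j-\lambda_k}}\prod_{j=1}^n\Bigl(1+\frac{\lambda_j}{\rho_j}\Bigr)\frac{\prod_{r=1}^4(g_r+\rho_j)_{\lambda_j}}{\prod_{r=1}^4(1-g_r+\rho_j)_{\lambda_j}}.$$ *)

theory Defs
  imports "HOL-Analysis.Analysis"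
begin

definition qpoch :: "complex \<Rightarrow> complex \<Rightarrow> nat \<Rightarrow> complex" where
  "qpoch x q m = (\<Prod>i<m. 1 - x * q ^ i)"

definition qpoch_inf :: "complex \<Rightarrow> complex \<Rightarrow> complex" where
  "qpoch_inf x q = prodinf (\<lambda>k. 1 - x * q ^ k)"

text \<open>
  Throughout, \<open>gs r\<close> is the parameter \<open>g\<^sub>r\<close> for \<open>r \<in> {1,2,3,4}\<close> (other arguments are never used),
  and \<open>(a,b,c,d)\<close> is a permutation of \<open>(1,2,3,4)\<close>.
\<close>

definition ghat :: "(nat \<Rightarrow> complex) \<Rightarrow> nat \<Rightarrow> nat \<Rightarrow> nat \<Rightarrow> nat \<Rightarrow> nat \<Rightarrow> complex" where
  "ghat gs a b c d r =
     (if r = a then (gs a + gs b + gs c + gs d) / 2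
      else if r = b then (gs a + gs b - gs c - gs d) / 2
      else if r = c then (gs a - gs b + gs c - gs d) / 2
      else (gs a - gs b - gs c + gs d) / 2)"

definition rho :: "nat \<Rightarrow> complex \<Rightarrow> (nat \<Rightarrow> complex) \<Rightarrow> nat \<Rightarrow> nat \<Rightarrow> complex" where
  "rho n g gs a j = of_nat (n - j) * g + gs a"

definition rhohat ::
  "nat \<Rightarrow> complex \<Rightarrow> (nat \<Rightarrow> complex) \<Rightarrow> nat \<Rightarrow> nat \<Rightarrow> nat \<Rightarrow> nat \<Rightarrow> nat \<Rightarrow> complex" where
  "rhohat n g gs a b c d j = of_nat (n - j) * g + ghat gs a b c d a"

text \<open>
  The vectors in \<open>\<int>\<^sup>n\<close> with \<open>\<lambda>\<^sub>1 \<ge> \<dots> \<ge> \<lambda>\<^sub>n \<ge> 0\<close>, as extensional functions on \<open>{1..n}\<close>. As the entries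
  are nonnegative integers, they are taken in \<open>nat\<close>; the subtraction \<open>l j - l k\<close> below only
  occurs for \<open>j < k\<close>, so it is never truncated.
\<close>

definition Lam :: "nat \<Rightarrow> (nat \<Rightarrow> nat) set" where
  "Lam n = {l \<in> {1..n} \<rightarrow>\<^sub>E UNIV. \<forall>j\<in>{1..n}. \<forall>k\<in>{1..n}. j \<le> k \<longrightarrow> l k \<le> l j}"

definition Delta_q ::
  "nat \<Rightarrow> real \<Rightarrow> complex \<Rightarrow> (nat \<Rightarrow> complex) \<Rightarrow> nat \<Rightarrow> nat \<Rightarrow> nat \<Rightarrow> nat \<Rightarrow> (nat \<Rightarrow> nat) \<Rightarrow> complex"
where
  "Delta_q n q g gs a b c d l =
    (let p = complex_of_real q; \<rho> = rho n g gs a; \<rho>h = rhohat n g gs a b c d in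
      p powr (\<Sum>j=1..n. (1 - 2 * \<rho>h j) * of_nat (l j)) *
      (\<Prod>j=1..n. \<Prod>k\<in>{j<..n}.
          (1 - p powr (\<rho> j + \<rho> k + of_nat (l j + l k))) / (1 - p powr (\<rho> j + \<rho> k)) *
          ((1 - p powr (\<rho> j - \<rho> k + of_nat (l j - l k))) / (1 - p powr (\<rho> j - \<rho> k))) *
          ((qpoch (p powr (g + \<rho> j + \<rho> k)) p (l j + l k) *
            qpoch (p powr (g + \<rho> j - \<rho> k)) p (l j - l k)) /
           (qpoch (p powr (1 - g + \<rho> j + \<rho> k)) p (l j + l k) *
            qpoch (p powr (1 - g + \<rho> j - \<rho> k)) p (l j - l k)))) *
      (\<Prod>j=1..n.
          (1 - p powr (2 * \<rho> j + 2 * of_nat (l j))) / (1 - p powr (2 * \<rho> j)) *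
          ((\<Prod>r=1..4. qpoch (p powr (gs r + \<rho> j)) p (l j)) /
           (\<Prod>r=1..4. qpoch (p powr (1 - gs r + \<rho> j)) p (l j)))))"

definition Delta_1 ::
  "nat \<Rightarrow> complex \<Rightarrow> (nat \<Rightarrow> complex) \<Rightarrow> nat \<Rightarrow> (nat \<Rightarrow> nat) \<Rightarrow> complex"
where
  "Delta_1 n g gs a l =
    (let \<rho> = rho n g gs a in
      (\<Prod>j=1..n. \<Prod>k\<in>{j<..n}.
          (1 + of_nat (l j + l k) / (\<rho> j + \<rho> k)) *
          (1 + of_nat (l j - l k) / (\<rho> j - \<rho> k)) *
          ((pochhammer (g + \<rho> j + \<rho> k) (l j + l k) *
            pochhammer (g + \<rho> j - \<rho> k) (l j - l k)) /
           (pochhammer (1 - g + \<rho> j + \<rho> k) (l j + l k) *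
            pochhammer (1 - g + \<rho> j - \<rho> k) (l j - l k)))) *
      (\<Prod>j=1..n.
          (1 + of_nat (l j) / \<rho> j) *
          ((\<Prod>r=1..4. pochhammer (gs r + \<rho> j) (l j)) /
           (\<Prod>r=1..4. pochhammer (1 - gs r + \<rho> j) (l j)))))"

definition Delta ::
  "nat \<Rightarrow> real \<Rightarrow> complex \<Rightarrow> (nat \<Rightarrow> complex) \<Rightarrow> nat \<Rightarrow> nat \<Rightarrow> nat \<Rightarrow> nat \<Rightarrow> (nat \<Rightarrow> nat) \<Rightarrow> complex"
where
  "Delta n q g gs a b c d l =
    (if q = 1 then Delta_1 n g gs a l else Delta_q n q g gs a b c d l)"

definition N_q ::
  "nat \<Rightarrow> real \<Rightarrow> complex \<Rightarrow> (nat \<Rightarrow> complex) \<Rightarrow> nat \<Rightarrow> nat \<Rightarrow> nat \<Rightarrow> nat \<Rightarrow> complex"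
where
  "N_q n q g gs a b c d =
    (let p = complex_of_real q; \<rho> = rho n g gs a; \<rho>h = rhohat n g gs a b c d;
         gh = ghat gs a b c d in
      (\<Prod>j=1..n. \<Prod>k\<in>{j<..n}.
          (qpoch_inf (p powr (1 + \<rho> j + \<rho> k)) p *
           qpoch_inf (p powr (1 + \<rho> j - \<rho> k)) p *
           qpoch_inf (p powr (1 + g - \<rho>h j - \<rho>h k)) p *
           qpoch_inf (p powr (1 + g - \<rho>h j + \<rho>h k)) p) /
          (qpoch_inf (p powr (1 - g + \<rho> j + \<rho> k)) p *
           qpoch_inf (p powr (1 - g + \<rho> j - \<rho> k)) p *
           qpoch_inf (p powr (1 - \<rho>h j - \<rho>h k)) p *
           qpoch_inf (p powr (1 - \<rho>h j + \<rho>h k)) p)) *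
      (\<Prod>j=1..n.
          (qpoch_inf (p powr (1 + 2 * \<rho> j)) p *
           (\<Prod>r=1..4. qpoch_inf (p powr (1 + gh r - \<rho>h j)) p)) /
          (qpoch_inf (p powr (1 - 2 * \<rho>h j)) p *
           (\<Prod>r=1..4. qpoch_inf (p powr (1 - gs r + \<rho> j)) p))))"

text \<open>
  A \<open>Gamma\<close> factor in a denominator evaluated at a pole makes the quotient \<open>0\<close> here
  (\<open>Gamma z = 0\<close> at the poles, and \<open>x / 0 = 0\<close>), which is the value given by the entire
  function \<open>1 / \<Gamma>\<close>.
\<close>

definition N_1 ::
  "nat \<Rightarrow> complex \<Rightarrow> (nat \<Rightarrow> complex) \<Rightarrow> nat \<Rightarrow> nat \<Rightarrow> nat \<Rightarrow> nat \<Rightarrow> complex"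
where
  "N_1 n g gs a b c d =
    (let \<rho> = rho n g gs a; \<rho>h = rhohat n g gs a b c d; gh = ghat gs a b c d in
      (\<Prod>j=1..n. \<Prod>k\<in>{j<..n}.
          (Gamma (1 - g + \<rho> j + \<rho> k) * Gamma (1 - g + \<rho> j - \<rho> k) *
           Gamma (1 - \<rho>h j - \<rho>h k) * Gamma (1 - \<rho>h j + \<rho>h k)) /
          (Gamma (1 + \<rho> j + \<rho> k) * Gamma (1 + \<rho> j - \<rho> k) *
           Gamma (1 + g - \<rho>h j - \<rho>h k) * Gamma (1 + g - \<rho>h j + \<rho>h k))) *
      (\<Prod>j=1..n.
          (Gamma (1 - 2 * \<rho>h j) * (\<Prod>r=1..4. Gamma (1 - gs r + \<rho> j))) /
          (Gamma (1 + 2 * \<rho> j) * (\<Prod>r=1..4. Gamma (1 + gh r - \<rho>h j)))))"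

definition N_const ::
  "nat \<Rightarrow> real \<Rightarrow> complex \<Rightarrow> (nat \<Rightarrow> complex) \<Rightarrow> nat \<Rightarrow> nat \<Rightarrow> nat \<Rightarrow> nat \<Rightarrow> complex"
where
  "N_const n q g gs a b c d =
    (if q = 1 then N_1 n g gs a b c d else N_q n q g gs a b c d)"

text \<open>
  Genericity of the parameters: no denominator of any term \<open>Delta_q\<close> or of \<open>N_q\<close> vanishes.
\<close>

definition generic_q ::
  "nat \<Rightarrow> real \<Rightarrow> complex \<Rightarrow> (nat \<Rightarrow> complex) \<Rightarrow> nat \<Rightarrow> nat \<Rightarrow> nat \<Rightarrow> nat \<Rightarrow> bool"
where
  "generic_q n q g gs a b c d \<longleftrightarrow>
    (let p = complex_of_real q; \<rho> = rho n g gs a; \<rho>h = rhohat n g gs a b c d in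
      (\<forall>l\<in>Lam n.
        (\<forall>j\<in>{1..n}. \<forall>k\<in>{j<..n}.
          1 - p powr (\<rho> j + \<rho> k) \<noteq> 0 \<and>
          1 - p powr (\<rho> j - \<rho> k) \<noteq> 0 \<and>
          qpoch (p powr (1 - g + \<rho> j + \<rho> k)) p (l j + l k) \<noteq> 0 \<and>
          qpoch (p powr (1 - g + \<rho> j - \<rho> k)) p (l j - l k) \<noteq> 0) \<and>
        (\<forall>j\<in>{1..n}.
          1 - p powr (2 * \<rho> j) \<noteq> 0 \<and>
          (\<forall>r\<in>{1..4}. qpoch (p powr (1 - gs r + \<rho> j)) p (l j) \<noteq> 0))) \<and>
      (\<forall>j\<in>{1..n}. \<forall>k\<in>{j<..n}.
          qpoch_inf (p powr (1 - g + \<rho> j + \<rho> k)) p \<noteq> 0 \<and>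
          qpoch_inf (p powr (1 - g + \<rho> j - \<rho> k)) p \<noteq> 0 \<and>
          qpoch_inf (p powr (1 - \<rho>h j - \<rho>h k)) p \<noteq> 0 \<and>
          qpoch_inf (p powr (1 - \<rho>h j + \<rho>h k)) p \<noteq> 0) \<and>
      (\<forall>j\<in>{1..n}.
          qpoch_inf (p powr (1 - 2 * \<rho>h j)) p \<noteq> 0 \<and>
          (\<forall>r\<in>{1..4}. qpoch_inf (p powr (1 - gs r + \<rho> j)) p \<noteq> 0)))"

text \<open>
  For \<open>q = 1\<close>: no denominator of any term \<open>Delta_1\<close> vanishes, and no \<open>Gamma\<close> factor in a numerator
  of \<open>N_1\<close> has a pole.
\<close>

definition generic_1 ::
  "nat \<Rightarrow> complex \<Rightarrow> (nat \<Rightarrow> complex) \<Rightarrow> nat \<Rightarrow> nat \<Rightarrow> nat \<Rightarrow> nat \<Rightarrow> bool"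
where
  "generic_1 n g gs a b c d \<longleftrightarrow>
    (let \<rho> = rho n g gs a; \<rho>h = rhohat n g gs a b c d in
      (\<forall>l\<in>Lam n.
        (\<forall>j\<in>{1..n}. \<forall>k\<in>{j<..n}.
          \<rho> j + \<rho> k \<noteq> 0 \<and>
          \<rho> j - \<rho> k \<noteq> 0 \<and>
          pochhammer (1 - g + \<rho> j + \<rho> k) (l j + l k) \<noteq> 0 \<and>
          pochhammer (1 - g + \<rho> j - \<rho> k) (l j - l k) \<noteq> 0) \<and>
        (\<forall>j\<in>{1..n}.
          \<rho> j \<noteq> 0 \<and>
          (\<forall>r\<in>{1..4}. pochhammer (1 - gs r + \<rho> j) (l j) \<noteq> 0))) \<and>
      (\<forall>j\<in>{1..n}. \<forall>k\<in>{j<..n}.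
          1 - g + \<rho> j + \<rho> k \<notin> \<int>\<^sub>\<le>\<^sub>0 \<and>
          1 - g + \<rho> j - \<rho> k \<notin> \<int>\<^sub>\<le>\<^sub>0 \<and>
          1 - \<rho>h j - \<rho>h k \<notin> \<int>\<^sub>\<le>\<^sub>0 \<and>
          1 - \<rho>h j + \<rho>h k \<notin> \<int>\<^sub>\<le>\<^sub>0) \<and>
      (\<forall>j\<in>{1..n}.
          1 - 2 * \<rho>h j \<notin> \<int>\<^sub>\<le>\<^sub>0 \<and>
          (\<forall>r\<in>{1..4}. 1 - gs r + \<rho> j \<notin> \<int>\<^sub>\<le>\<^sub>0)))"

definition generic_params ::
  "nat \<Rightarrow> real \<Rightarrow> complex \<Rightarrow> (nat \<Rightarrow> complex) \<Rightarrow> nat \<Rightarrow> nat \<Rightarrow> nat \<Rightarrow> nat \<Rightarrow> bool"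
where
  "generic_params n q g gs a b c d \<longleftrightarrow>
    (if q = 1 then generic_1 n g gs a b c d else generic_q n q g gs a b c d)"

end

theory Submission
  imports Defs
begin

text \<open>
  Both cases are treated at once, with \<open>s x = q\<^bsup>-x/2\<^esup> - q\<^bsup>x/2\<^esup>\<close> for \<open>q < 1\<close> and \<open>s x = x\<close> for \<open>q = 1\<close>; then
  \<open>s (x + y) * s (x - y) = f x - f y\<close> for an even function \<open>f\<close>, and \<open>\<Delta>(\<lambda>)\<close> is a product of values of \<open>s\<close> at
  the points \<open>x\<^sub>j = \<rho>\<^sub>j + \<lambda>\<^sub>j\<close>. The weight \<open>\<Delta>\<close> is in detailed balance with the Koornwinder operator \<open>D\<close>, so
  \<open>\<Sum> \<Delta> D\<phi> = 0\<close>. Apply this to \<open>\<phi> = \<Prod>\<^sub>k (Y - f x\<^sub>k)\<close>, expanded in the Newton basis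
  \<open>\<Prod>\<^sub>i\<^sub><\<^sub>m (Y - f (g\<^sub>b + i g))\<close>: a dual Askey-Wilson operator in \<open>Y\<close> is bidiagonal in this basis, so the coefficients
  satisfy a two-term recurrence. Its end points are the series for \<open>g\<^sub>b\<close> and for \<open>g\<^sub>b + 1\<close>, which gives the
  ratio of these two. Iterating towards \<open>g\<^sub>b \<rightarrow> -\<infinity>\<close> shows that the series divided by its conjectured value
  does not depend on \<open>g\<^sub>b\<close>, and for \<open>g\<^sub>b = -g\<^sub>a - (n-1) g\<close> the series reduces to the term \<open>\<lambda> = 0\<close>.
  Parameters for which some auxiliary denominator vanishes are reached by continuity.
\<close>

section \<open>Sums over the dominant chamber and Newton interpolation\<close>

text \<open>The recurrence alone shows only that the series divided by the closed form is 1-periodic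
  in \<open>b\<close>. What excludes a periodic factor is that, as \<open>b\<close> moves to minus
  infinity, the series has the same limit from every starting point: each quotient of
  \<open>s\<close>-values containing \<open>b\<close> has a limit free of \<open>b\<close>. The
  price is that this limit is justified only under a convergence condition on \<open>a\<close>,
  \<open>c\<close>, \<open>d\<close> that gets no help from \<open>b\<close>. It is met by lowering
  \<open>c\<close> and \<open>d\<close> by a large integer; symmetry in \<open>b\<close>,
  \<open>c\<close>, \<open>d\<close> then lets the recurrence raise them again.

  Summation by parts on \<open>Lam\<close> has no boundary along the walls, since the coefficient of
  every forbidden step vanishes; the only boundary is the truncation of the largest part. Control of
  it and of the moments takes two powers of \<open>e\<close> per coordinate, which is what
  convergence at \<open>b + 1\<close> provides.

  The final continuity argument needs majorants uniform along sequences of parameters; this is why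
  the upper growth axioms speak of convergent sequences of arguments.\<close>

lemma infsum_tendsto_dominated:
  fixes f :: "nat \<Rightarrow> 'a \<Rightarrow> complex"
  assumes h: "h summable_on A"
    and bnd: "\<forall>\<^sub>F k in sequentially. \<forall>x\<in>A. norm (f k x) \<le> h x"
    and lim: "\<And>x. x \<in> A \<Longrightarrow> (\<lambda>k. f k x) \<longlonglongrightarrow> f0 x"
  shows "(\<lambda>x. norm (f0 x)) summable_on A"
    and "(\<lambda>k. infsum (f k) A) \<longlonglongrightarrow> infsum f0 A"
proof -
  have f0: "norm (f0 x) \<le> h x" if "x \<in> A" for x
  proof (rule tendsto_upperbound)
    show "(\<lambda>k. norm (f k x)) \<longlonglongrightarrow> norm (f0 x)"
      using lim[OF that] by (intro tendsto_norm)
    show "\<forall>\<^sub>F k in sequentially. norm (f k x) \<le> h x"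
      using bnd by eventually_elim (use that in auto)
  qed simp
  have hpos: "h x \<ge> 0" if "x \<in> A" for x
    using f0[OF that] norm_ge_zero order_trans by blast
  show sum0: "(\<lambda>x. norm (f0 x)) summable_on A"
    by (rule summable_on_comparison_test[OF h]) (use f0 in auto)
  show "(\<lambda>k. infsum (f k) A) \<longlonglongrightarrow> infsum f0 A"
  proof (rule tendstoI)
    fix e :: real assume "e > 0"
    \<comment> \<open>Outside \<open>F\<close> the majorant sums to at most \<open>e/4\<close>; the
      head of the difference and the two tails then cost less than three quarters of
      \<open>e\<close>.\<close>
    obtain F where F: "finite F" "F \<subseteq> A" "dist (sum h F) (infsum h A) \<le> e/4"
      using infsum_finite_approximation[OF h, of "e/4"] \<open>e > 0\<close> by auto
    have hA: "infsum h A = sum h F + infsum h (A - F)"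
    proof -
      have "h summable_on (A - F)" using h by (rule summable_on_subset_banach) auto
      moreover have "h summable_on F" using F(1) by (rule summable_on_finite)
      moreover have "F \<inter> (A - F) = {}" "F \<union> (A - F) = A" using F(2) by auto
      ultimately have "infsum h A = infsum h F + infsum h (A - F)"
        using infsum_Un_disjoint[of h F "A - F"] by simp
      thus ?thesis using F(1) by simp
    qed
    have tail: "infsum h (A - F) \<le> e/4"
      using F(3) hA by (simp add: dist_real_def)
    have "(\<lambda>k. \<Sum>x\<in>F. norm (f k x - f0 x)) \<longlonglongrightarrow> (\<Sum>x\<in>F. norm (f0 x - f0 x))"
      using F lim by (intro tendsto_sum tendsto_norm tendsto_diff tendsto_const) auto
    hence "(\<lambda>k. \<Sum>x\<in>F. norm (f k x - f0 x)) \<longlonglongrightarrow> 0" by simp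
    hence "\<forall>\<^sub>F k in sequentially. (\<Sum>x\<in>F. norm (f k x - f0 x)) < e/4"
      by (rule order_tendstoD(2)) (use \<open>e > 0\<close> in simp)
    with bnd show "\<forall>\<^sub>F k in sequentially. dist (infsum (f k) A) (infsum f0 A) < e"
    proof eventually_elim
      case (elim k)
      have sk: "(\<lambda>x. norm (f k x)) summable_on A"
        by (rule summable_on_comparison_test[OF h]) (use elim in auto)
      have split: "infsum u A = sum u F + infsum u (A - F)"
        if "(\<lambda>x. norm (u x)) summable_on A" for u :: "'a \<Rightarrow> complex"
      proof -
        have "u summable_on A" using that by (rule abs_summable_summable)
        hence "u summable_on (A - F)" by (rule summable_on_subset_banach) auto
        moreover have "u summable_on F" using F(1) by (rule summable_on_finite)
        moreover have "F \<inter> (A - F) = {}" "F \<union> (A - F) = A" using F(2) by auto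
        ultimately have "infsum u A = infsum u F + infsum u (A - F)"
          using infsum_Un_disjoint[of u F "A - F"] by simp
        thus ?thesis using F(1) by simp
      qed
      have tl: "norm (infsum u (A - F)) \<le> e/4" if "\<And>x. x \<in> A \<Longrightarrow> norm (u x) \<le> h x" for u :: "'a \<Rightarrow> complex"
      proof -
        have hF: "h summable_on (A - F)" using h by (rule summable_on_subset_banach) auto
        hence 1: "(h has_sum infsum h (A - F)) (A - F)" by (rule has_sum_infsum)
        have "(\<lambda>x. norm (u x)) summable_on (A - F)"
          by (rule summable_on_comparison_test[OF hF]) (use that in auto)
        hence 2: "(u has_sum infsum u (A - F)) (A - F)"
          by (rule has_sum_infsum[OF abs_summable_summable])
        have "norm (infsum u (A - F)) \<le> infsum h (A - F)"
          by (rule norm_infsum_le[OF 2 1]) (use that in auto)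
        with tail show ?thesis by simp
      qed
      have "norm (infsum (f k) A - infsum f0 A)
          = norm ((\<Sum>x\<in>F. f k x - f0 x) + (infsum (f k) (A - F) - infsum f0 (A - F)))"
        unfolding split[OF sk] split[OF sum0] by (simp add: sum_subtractf algebra_simps)
      also have "\<dots> \<le> (\<Sum>x\<in>F. norm (f k x - f0 x)) + (norm (infsum (f k) (A - F)) + norm (infsum f0 (A - F)))"
        by (intro order.trans[OF norm_triangle_ineq] add_mono sum_norm_le norm_triangle_ineq4) auto
      also have "\<dots> < e"
        using elim tl[of "f k"] tl[of f0] f0 \<open>e > 0\<close> by force
      finally show ?case by (simp add: dist_norm)
    qed
  qed
qed

lemma LamD: "l \<in> Lam n \<Longrightarrow> 1 \<le> j \<Longrightarrow> j \<le> k \<Longrightarrow> k \<le> n \<Longrightarrow> l k \<le> l j"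
  by (auto simp: Lam_def)

lemma finite_Lam_bounded: "finite {l \<in> Lam n. \<forall>j\<in>{1..n}. l j \<le> L}"
proof (rule finite_subset)
  show "{l \<in> Lam n. \<forall>j\<in>{1..n}. l j \<le> L} \<subseteq> {1..n} \<rightarrow>\<^sub>E {..L}"
    by (auto simp: Lam_def PiE_def Pi_def)
qed (intro finite_PiE; simp)

text \<open>The ordering of the parts is dropped: \<open>F\<close> lies in a finite box, over which
  the sum of products is a product of sums.\<close>

lemma sum_prod_Lam_le:
  fixes h :: "nat \<Rightarrow> nat \<Rightarrow> real"
  assumes h0: "\<And>j m. h j m \<ge> 0" and hs: "\<And>j. summable (h j)"
    and F: "finite F" "F \<subseteq> {1..n} \<rightarrow>\<^sub>E UNIV"
  shows "(\<Sum>l\<in>F. \<Prod>j\<in>{1..n}. h j (l j)) \<le> (\<Prod>j\<in>{1..n}. suminf (h j))"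
proof -
  define L where "L = Max (insert 0 ((\<lambda>(l,j). l j) ` (F \<times> {1..n})))"
  have L: "l j \<le> L" if "l \<in> F" "j \<in> {1..n}" for l j
    unfolding L_def using F that by (intro Max_ge) auto
  have "(\<Sum>l\<in>F. \<Prod>j\<in>{1..n}. h j (l j)) \<le> (\<Sum>l\<in>{1..n} \<rightarrow>\<^sub>E {..L}. \<Prod>j\<in>{1..n}. h j (l j))"
    using F L h0 by (intro sum_mono2 finite_PiE prod_nonneg) (auto simp: PiE_def Pi_def)
  also have "\<dots> = (\<Prod>j\<in>{1..n}. \<Sum>m\<le>L. h j m)"
    by (rule prod_sum_PiE[symmetric]) auto
  also have "\<dots> \<le> (\<Prod>j\<in>{1..n}. suminf (h j))"
    using h0 hs by (intro prod_mono conjI sum_nonneg sum_le_suminf) auto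
  finally show ?thesis .
qed

lemma summable_on_prod_Lam:
  fixes h :: "nat \<Rightarrow> nat \<Rightarrow> real"
  assumes h0: "\<And>j m. h j m \<ge> 0" and hs: "\<And>j. summable (h j)"
  shows "(\<lambda>l. \<Prod>j\<in>{1..n}. h j (l j)) summable_on Lam n"
proof (rule nonneg_bdd_above_summable_on)
  show "bdd_above (sum (\<lambda>l. \<Prod>j\<in>{1..n}. h j (l j)) ` {F. F \<subseteq> Lam n \<and> finite F})"
  proof (rule bdd_aboveI)
    fix x assume "x \<in> sum (\<lambda>l. \<Prod>j\<in>{1..n}. h j (l j)) ` {F. F \<subseteq> Lam n \<and> finite F}"
    then obtain F where "F \<subseteq> Lam n" "finite F" "x = (\<Sum>l\<in>F. \<Prod>j\<in>{1..n}. h j (l j))" by auto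
    thus "x \<le> (\<Prod>j\<in>{1..n}. suminf (h j))"
      using sum_prod_Lam_le[of h F n, OF h0 hs] unfolding Lam_def by blast
  qed
qed (use h0 in \<open>auto intro: prod_nonneg\<close>)

text \<open>Bounds the layer on which the boundary terms live. Replacing the first factor by one
  concentrated at \<open>L\<close> turns the constraint on \<open>l 1\<close> into an instance of
  the unconstrained bound.\<close>

lemma sum_prod_Lam_top_le:
  fixes h :: "nat \<Rightarrow> nat \<Rightarrow> real"
  assumes h0: "\<And>j m. h j m \<ge> 0" and hs: "\<And>j. summable (h j)" and n: "n \<ge> 1"
  shows "(\<Sum>l\<in>{l\<in>Lam n. l 1 = L}. \<Prod>j\<in>{1..n}. h j (l j)) \<le> h 1 L * (\<Prod>j\<in>{2..n}. suminf (h j))"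
proof -
  define h' where "h' = (\<lambda>j m. if j = (1::nat) then (if m = L then h 1 m else 0) else h j m)"
  have s1: "h' 1 sums h 1 L" 
    using sums_single[of L "h 1"] by (simp add: h'_def)
  have "{l\<in>Lam n. l 1 = L} \<subseteq> {l \<in> Lam n. \<forall>j\<in>{1..n}. l j \<le> L}"
    using LamD[of _ n 1] by auto
  hence fin: "finite {l\<in>Lam n. l 1 = L}" using finite_Lam_bounded finite_subset by blast
  have "(\<Sum>l\<in>{l\<in>Lam n. l 1 = L}. \<Prod>j\<in>{1..n}. h j (l j)) = (\<Sum>l\<in>{l\<in>Lam n. l 1 = L}. \<Prod>j\<in>{1..n}. h' j (l j))"
    by (intro sum.cong prod.cong) (auto simp: h'_def)
  also have "\<dots> \<le> (\<Prod>j\<in>{1..n}. suminf (h' j))"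
  proof (rule sum_prod_Lam_le)
    show "summable (h' j)" for j
      using s1 hs[of j] by (cases "j = 1") (auto simp: sums_iff h'_def)
  qed (use h0 fin in \<open>auto simp: h'_def Lam_def\<close>)
  also have "(\<Prod>j\<in>{1..n}. suminf (h' j)) = (\<Prod>j\<in>insert 1 {2..n}. suminf (h' j))"
    using n by (intro prod.cong) auto
  also have "\<dots> = suminf (h' 1) * (\<Prod>j\<in>{2..n}. suminf (h' j))"
    by (subst prod.insert) auto
  also have "\<dots> = h 1 L * (\<Prod>j\<in>{2..n}. suminf (h j))"
    using s1 by (auto simp: sums_iff h'_def)
  finally show ?thesis .
qed

text \<open>Changing one coordinate affects exactly the pairs containing it; this collapses the
  resulting double product, whichever place \<open>j\<close> takes in the pair.\<close>

lemma prod_pairs_single: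
  fixes u :: "nat \<Rightarrow> 'a::comm_monoid_mult"
  assumes "j \<in> {1..n}"
  shows "(\<Prod>i=1..n. \<Prod>k\<in>{i<..n}. if i = j then u k else if k = j then u i else 1) = prod u ({1..n} - {j})"
proof -
  have "(\<Prod>i=1..n. \<Prod>k\<in>{i<..n}. if i = j then u k else if k = j then u i else 1)
      = (\<Prod>i=1..n. if i = j then prod u {j<..n} else if i < j then u i else 1)"
  proof (intro prod.cong refl)
    fix i assume i: "i \<in> {1..n}"
    show "(\<Prod>k\<in>{i<..n}. if i = j then u k else if k = j then u i else 1)
       = (if i = j then prod u {j<..n} else if i < j then u i else 1)"
      using assms by (auto simp: prod.delta')
  qed
  also have "\<dots> = prod u {j<..n} * (\<Prod>i\<in>{1..n}-{j}. if i < j then u i else 1)"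
    using assms by (subst prod.remove[of _ j]) auto
  also have "(\<Prod>i\<in>{1..n}-{j}. if i < j then u i else 1) = prod u {1..<j}"
    using assms by (intro prod.mono_neutral_cong_right) auto
  also have "prod u {j<..n} * prod u {1..<j} = prod u ({1..<j} \<union> {j<..n})"
    by (subst prod.union_disjoint) (auto simp: mult.commute)
  also have "{1..<j} \<union> {j<..n} = {1..n} - {j}" using assms by auto
  finally show ?thesis .
qed

section \<open>Newton interpolation and Lagrange interpolation\<close>

fun newton_coeff :: "(nat \<Rightarrow> 'a::comm_ring_1) \<Rightarrow> (nat \<Rightarrow> 'a) \<Rightarrow> nat \<Rightarrow> nat \<Rightarrow> 'a" where
  "newton_coeff b X 0 m = (if m = 0 then 1 else 0)"
| "newton_coeff b X (Suc k) m =
     (if m = 0 then 0 else newton_coeff b X k (m - 1)) + (b m - X (Suc k)) * newton_coeff b X k m"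

definition newton_poly :: "(nat \<Rightarrow> 'a::comm_ring_1) \<Rightarrow> nat \<Rightarrow> 'a poly" where
  "newton_poly b m = (\<Prod>i<m. [:- b i, 1:])"

lemma newton_poly_Suc: "newton_poly b (Suc m) = newton_poly b m * [:- b m, 1:]"
  by (simp add: newton_poly_def)

lemma newton_coeff_gt: "m > k \<Longrightarrow> newton_coeff b X k m = 0"
  by (induction k arbitrary: m) auto

lemma newton_coeff_same: "newton_coeff b X k k = 1"
  by (induction k) (auto simp: newton_coeff_gt)

text \<open>At \<open>Y = b 0\<close> only the constant basis element survives, so this is the value
  of the polynomial there. This coefficient and the leading one, which is 1, become the two ends of
  the recurrence.\<close>

lemma newton_coeff_0: "newton_coeff b X k 0 = (\<Prod>i=1..k. b 0 - X i)"
  by (induction k) (auto simp: mult.commute)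

text \<open>One more linear factor is absorbed by \<open>Y - X = (Y - b m) + (b m - X)\<close>: the
  first part moves to the next basis element, the second stays. This is the recursion of
  \<open>newton_coeff\<close>.\<close>

lemma newton_expansion:
  "(\<Prod>i=1..k. [:- X i, 1:]) = (\<Sum>m\<le>k. smult (newton_coeff b X k m) (newton_poly b m))"
proof (induction k)
  case (Suc k)
  have "(\<Prod>i=1..Suc k. [:- X i, 1:]) = (\<Sum>m\<le>k. smult (newton_coeff b X k m) (newton_poly b m * [:- X (Suc k), 1:]))"
    proof -
    have "(\<Prod>i=1..Suc k. [:- X i, 1:]) = (\<Prod>i=1..k. [:- X i, 1:]) * [:- X (Suc k), 1:]"
      by (subst prod.nat_ivl_Suc') (auto simp: mult.commute simp del: mult_pCons_left mult_pCons_right)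
    also have "\<dots> = (\<Sum>m\<le>k. smult (newton_coeff b X k m) (newton_poly b m) * [:- X (Suc k), 1:])"
      by (simp only: Suc.IH sum_distrib_right)
    finally show ?thesis by (simp only: mult_smult_left)
  qed
  also have "\<dots> = (\<Sum>m\<le>k. smult (newton_coeff b X k m) (newton_poly b (Suc m))) +
       (\<Sum>m\<le>k. smult ((b m - X (Suc k)) * newton_coeff b X k m) (newton_poly b m))"
  proof -
    have "newton_poly b m * [:- X (Suc k), 1:] = newton_poly b (Suc m) + smult (b m - X (Suc k)) (newton_poly b m)" for m
    proof -
      have "[:- X (Suc k), 1:] = [:- b m, 1:] + [:b m - X (Suc k):]" by simp
      thus ?thesis by (simp only: newton_poly_Suc distrib_left) simp
    qed
    thus ?thesis by (simp add: sum.distrib[symmetric] smult_add_right mult.commute)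
  qed
  also have "(\<Sum>m\<le>k. smult (newton_coeff b X k m) (newton_poly b (Suc m))) =
     (\<Sum>m\<le>Suc k. smult (if m = 0 then 0 else newton_coeff b X k (m-1)) (newton_poly b m))"
    by (subst sum.atMost_Suc_shift) simp
  also have "(\<Sum>m\<le>k. smult ((b m - X (Suc k)) * newton_coeff b X k m) (newton_poly b m)) =
      (\<Sum>m\<le>Suc k. smult ((b m - X (Suc k)) * newton_coeff b X k m) (newton_poly b m))"
    by (simp add: newton_coeff_gt)
  finally show ?case by (simp only: newton_coeff.simps smult_add_left sum.distrib)
qed (simp add: newton_poly_def)

lemma norm_newton_coeff_le:
  fixes b X :: "nat \<Rightarrow> complex"
  assumes "\<And>m. m \<le> k \<Longrightarrow> norm (b m) \<le> B" "B \<ge> 0" 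
  shows "norm (newton_coeff b X k m) \<le> (\<Prod>i=1..k. 1 + B + norm (X i))"
  using assms
proof (induction k arbitrary: m)
  case (Suc k)
  have IH: "norm (newton_coeff b X k m) \<le> (\<Prod>i=1..k. 1 + B + norm (X i))" for m
    using Suc by auto
  have P: "(\<Prod>i=1..k. 1 + B + norm (X i)) \<ge> 0" using Suc.prems by (intro prod_nonneg) auto
  have "norm ((b m - X (Suc k)) * newton_coeff b X k m) \<le> (B + norm (X (Suc k))) * (\<Prod>i=1..k. 1 + B + norm (X i))"
  \<comment> \<open>\<open>B\<close> controls the nodes only up to \<open>Suc k\<close>; beyond that
    the coefficient itself is zero.\<close>
  proof (cases "m \<le> Suc k")
    case True
    thus ?thesis unfolding norm_mult using Suc.prems IH[of m]
      by (intro mult_mono order.trans[OF norm_triangle_ineq4] add_mono) auto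
  next
    case False
    thus ?thesis using P Suc.prems by (simp add: newton_coeff_gt)
  qed
  moreover have "norm (if m = 0 then 0 else newton_coeff b X k (m - 1)) \<le> (\<Prod>i=1..k. 1 + B + norm (X i))"
    using IH[of "m-1"] P by auto
  ultimately have "norm (newton_coeff b X (Suc k) m) \<le> (\<Prod>i=1..k. 1 + B + norm (X i)) + (B + norm (X (Suc k))) * (\<Prod>i=1..k. 1 + B + norm (X i))"
    unfolding newton_coeff.simps by (intro order.trans[OF norm_triangle_ineq] add_mono)
  thus ?case by (simp add: algebra_simps)
qed auto

lemma degree_newton_poly: "degree (newton_poly b m :: 'a::idom poly) = m"
  unfolding newton_poly_def by (subst degree_prod_eq_sum_degree) auto

lemma lead_newton_poly: "coeff (newton_poly b m :: 'a::idom poly) m = 1"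
proof -
  have "lead_coeff (newton_poly b m) = 1"
    unfolding newton_poly_def lead_coeff_prod by simp
  thus ?thesis by (simp add: degree_newton_poly)
qed

lemma newton_poly_independent:
  fixes b :: "nat \<Rightarrow> 'a::idom"
  assumes "(\<Sum>m\<le>N. smult (a m) (newton_poly b m)) = 0" "m \<le> N"
  shows "a m = 0"
  using assms
proof (induction N)
  case 0
  thus ?case by (simp add: newton_poly_def)
next
  case (Suc N)
  have "coeff (\<Sum>m\<le>N. smult (a m) (newton_poly b m)) (Suc N) = 0"
    by (simp add: coeff_sum coeff_eq_0 degree_newton_poly)
  hence "coeff (\<Sum>m\<le>Suc N. smult (a m) (newton_poly b m)) (Suc N) = a (Suc N)"
    using lead_newton_poly[of b "Suc N"] by simp
  hence "a (Suc N) = 0" unfolding Suc.prems(1) by simp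
  thus ?case using Suc by (cases "m = Suc N") auto
qed

lemma lagrange_interpolation:
  fixes p :: "'a::field poly" and X :: "'b \<Rightarrow> 'a"
  assumes fin: "finite J" and inj: "inj_on X J" and deg: "degree p < card J"
  shows "poly p y = (\<Sum>j\<in>J. poly p (X j) * (\<Prod>k\<in>J-{j}. (y - X k) / (X j - X k)))"
proof -
  define r where "r = (\<Sum>j\<in>J. smult (poly p (X j)) (\<Prod>k\<in>J-{j}. smult (1 / (X j - X k)) [:- X k, 1:]))"
  have pr: "poly r y = (\<Sum>j\<in>J. poly p (X j) * (\<Prod>k\<in>J-{j}. (y - X k) / (X j - X k)))" for y
    unfolding r_def poly_sum by (intro sum.cong refl) (simp add: poly_prod diff_divide_distrib)
  have "degree r \<le> card J - 1" unfolding r_def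
  proof (intro degree_sum_le fin order.trans[OF degree_smult_le])
    fix j assume j: "j \<in> J"
    have "degree (\<Prod>k\<in>J-{j}. smult (1 / (X j - X k)) [:- X k, 1:]) \<le> (\<Sum>k\<in>J-{j}. degree (smult (1 / (X j - X k)) [:- X k, 1:]))"
      using degree_prod_sum_le fin by (metis (no_types, lifting) comp_apply finite_Diff sum.cong)
    also have "\<dots> \<le> (\<Sum>k\<in>J-{j}. 1)"
      by (intro sum_mono) (auto intro: order.trans[OF degree_smult_le])
    also have "\<dots> = card J - 1" using j fin by simp
    finally show "degree (\<Prod>k\<in>J-{j}. smult (1 / (X j - X k)) [:- X k, 1:]) \<le> card J - 1" .
  qed
  hence "degree r < card J" using deg by linarith
  moreover have "poly p (X i) = poly r (X i)" if i: "i \<in> J" for i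
  proof -
    have "poly r (X i) = (\<Sum>j\<in>J. if j = i then poly p (X i) else 0)"
      unfolding pr
    proof (intro sum.cong refl)
      fix j assume j: "j \<in> J"
      show "poly p (X j) * (\<Prod>k\<in>J-{j}. (X i - X k) / (X j - X k)) = (if j = i then poly p (X i) else 0)"
      proof (cases "j = i")
        case True
        have "(\<Prod>k\<in>J-{i}. (X i - X k) / (X i - X k)) = 1"
          using inj i by (intro prod.neutral) (auto simp: inj_on_def)
        thus ?thesis using True by simp
      next
        case False
        have "(\<Prod>k\<in>J-{j}. (X i - X k) / (X j - X k)) = 0"
          using False i fin by (intro prod_zero) auto
        thus ?thesis using False by simp
      qed
    qed
    thus ?thesis using i fin by simp
  qed
  ultimately have "p = r" using deg inj card_image[OF inj]
    by (intro poly_eqI_degree[of "X ` J"]) auto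
  hence "poly p y = poly r y" by simp
  thus ?thesis by (simp only: pr)
qed

section \<open>The kernel identity\<close>

text \<open>\<open>s_quad\<close>: the left side divided by \<open>s (2 * z)\<close> is affine in
  \<open>f z\<close>; the right side records its slope and its value at \<open>z = h4\<close>, where
  the second product vanishes. \<open>h4\<close> is singled out because it will carry a node of the
  Newton basis. \<open>Re_eq_0_if_s\<close> puts all zeros of \<open>s\<close> on the imaginary
  axis, so a nonzero real part excludes a zero.\<close>

locale sfun =
  fixes s f :: "complex \<Rightarrow> complex"
  assumes s_minus: "s (- x) = - s x"
    and s_mult_s: "s (x + y) * s (x - y) = f x - f y"
    and s_quad: "s (h1 + z) * s (h2 + z) * s (h3 + z) * s (h4 + z)
        - s (h1 - z) * s (h2 - z) * s (h3 - z) * s (h4 - z)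
      = s (2 * z) * (s (h1 + h2 + h3 + h4) * (f z - f h4) + s (h1 + h4) * s (h2 + h4) * s (h3 + h4))"
    and Re_eq_0_if_s: "s x = 0 \<Longrightarrow> Re x = 0"
begin

lemma s_0 [simp]: "s 0 = 0"
  using s_minus[of 0] by simp

lemma f_minus [simp]: "f (- x) = f x"
  using s_mult_s[of "-x" x] by simp

lemma f_minus_commute: "f (x - y) = f (y - x)"
  using f_minus[of "x - y"] by simp

lemma s_minus_commute: "s (x - y) = - s (y - x)"
  using s_minus[of "y - x"] by simp

text \<open>The shifted factorial built from \<open>s\<close>: \<open>pochhammer\<close> in the
  rational case, otherwise the \<open>q\<close>-shifted factorial times a power of \<open>q\<close>.
  The powers left over in quotients produce the exponential prefactor of
  \<open>Delta_q\<close>.\<close>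

definition sp :: "complex \<Rightarrow> nat \<Rightarrow> complex" where
  "sp x m = (\<Prod>i<m. s (x + of_nat i))"

lemma sp_0 [simp]: "sp x 0 = 1" and sp_Suc: "sp x (Suc m) = sp x m * s (x + of_nat m)"
  by (auto simp: sp_def)

lemma sp_eq_0_iff: "sp x m = 0 \<longleftrightarrow> (\<exists>i<m. s (x + of_nat i) = 0)"
  by (auto simp: sp_def)

definition pair_factor :: "complex \<Rightarrow> complex \<Rightarrow> nat \<Rightarrow> complex" where
  "pair_factor g x m = s (x + of_nat m) / s x * (sp (g + x) m / sp (1 - g + x) m)"

definition single_factor :: "complex \<Rightarrow> complex \<Rightarrow> nat \<Rightarrow> complex" where
  "single_factor v x m = sp (v + x) m / sp (1 - v + x) m"

text \<open>\<open>rh\<close> and \<open>pt\<close> are \<open>\<rho>\<^sub>j\<close> and the lattice point \<open>x\<^sub>j = \<rho>\<^sub>j + \<lambda>\<^sub>j\<close>.\<close>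
definition rh :: "nat \<Rightarrow> complex \<Rightarrow> complex \<Rightarrow> nat \<Rightarrow> complex" where
  "rh n g a j = of_nat (n - j) * g + a"

definition weight ::
  "nat \<Rightarrow> complex \<Rightarrow> complex \<Rightarrow> complex \<Rightarrow> complex \<Rightarrow> complex \<Rightarrow> (nat \<Rightarrow> nat) \<Rightarrow> complex" where
  "weight n g a b c d l =
     (\<Prod>j=1..n. \<Prod>k\<in>{j<..n}. pair_factor g (rh n g a j + rh n g a k) (l j + l k) *
                         pair_factor g (rh n g a j - rh n g a k) (l j - l k)) *
     (\<Prod>j=1..n. s (2 * rh n g a j + 2 * of_nat (l j)) / s (2 * rh n g a j) *
        (single_factor a (rh n g a j) (l j) * single_factor b (rh n g a j) (l j) *
         single_factor c (rh n g a j) (l j) * single_factor d (rh n g a j) (l j)))"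

definition pt :: "nat \<Rightarrow> complex \<Rightarrow> complex \<Rightarrow> (nat \<Rightarrow> nat) \<Rightarrow> nat \<Rightarrow> complex" where
  "pt n g a l j = rh n g a j + of_nat (l j)"

text \<open>Makes the coefficients of the Koornwinder operator well defined at all lattice points.\<close>
definition strongly_generic :: "complex \<Rightarrow> complex \<Rightarrow> bool" where
  "strongly_generic g a \<longleftrightarrow>
     (\<forall>w N::nat. s (2 * a + (of_nat w - 1) * g + of_nat N) \<noteq> 0) \<and>
     (\<forall>w N::nat. w \<ge> 1 \<longrightarrow> s (of_nat w * g + of_nat N) \<noteq> 0)"

text \<open>With \<open>w = n - j\<close> the argument is \<open>1 - v + rh n g a j + i\<close>, so
  this is what makes the denominators of \<open>single_factor v\<close> nonzero.\<close>

definition regular :: "nat \<Rightarrow> complex \<Rightarrow> complex \<Rightarrow> complex \<Rightarrow> bool" where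
  "regular n g a v \<longleftrightarrow> (\<forall>w<n. \<forall>i::nat. s (1 - v + a + of_nat w * g + of_nat i) \<noteq> 0)"

definition num4 :: "complex \<Rightarrow> complex \<Rightarrow> complex \<Rightarrow> complex \<Rightarrow> complex \<Rightarrow> complex" where
  "num4 a b c d x = s (a + x) * s (b + x) * s (c + x) * s (d + x)"

text \<open>
  \<open>hop\<close> at \<open>x\<^sub>j\<close> and at \<open>- x\<^sub>j\<close> gives the coefficient of the step \<open>x\<^sub>j \<mapsto> x\<^sub>j \<plusminus> 1\<close> in the Koornwinder operator, without
  the factor \<open>1 / s (\<plusminus> 2 x\<^sub>j + 1)\<close>, which the difference \<open>f (x\<^sub>j \<plusminus> 1) - f x\<^sub>j\<close> cancels.
\<close>
definition hop ::
  "nat \<Rightarrow> complex \<Rightarrow> complex \<Rightarrow> complex \<Rightarrow> complex \<Rightarrow> complex \<Rightarrow> (nat \<Rightarrow> complex) \<Rightarrow> nat \<Rightarrow> complex \<Rightarrow> complex" where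
  "hop n g a b c d X j x = num4 a b c d x / s (2 * x) * (\<Prod>k\<in>{1..n}-{j}. (f (x + g) - X k) / (f x - X k))"

text \<open>Together with \<open>F_coeff\<close> the matrix of the dual Askey-Wilson operator in the
  Newton basis: eigenvalues on the diagonal, \<open>F_coeff\<close> one degree lower. The factor
  \<open>s (of_nat m * g)\<close> makes \<open>F_coeff\<close> vanish at \<open>m = 0\<close>, where
  the index \<open>m - 1\<close> is truncated.\<close>

definition E_coeff :: "complex \<Rightarrow> complex \<Rightarrow> nat \<Rightarrow> complex" where
  "E_coeff g \<sigma> m = s (of_nat m * g) * s (\<sigma> + (of_nat m - 1) * g) / s g"

definition F_coeff :: "complex \<Rightarrow> complex \<Rightarrow> complex \<Rightarrow> complex \<Rightarrow> complex \<Rightarrow> nat \<Rightarrow> complex" where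
  "F_coeff g a b c d m = s (of_nat m * g) / s g *
     (s (a + b + (of_nat m - 1) * g) * s (c + b + (of_nat m - 1) * g) * s (d + b + (of_nat m - 1) * g))"

definition node :: "complex \<Rightarrow> complex \<Rightarrow> nat \<Rightarrow> complex" where
  "node g b i = f (b + of_nat i * g)"

lemma poly_newton_node:
  "poly (newton_poly (node g b) m) (f z) = (\<Prod>i<m. s (z + b + of_nat i * g)) * (\<Prod>i<m. s (z - b - of_nat i * g))"
  unfolding newton_poly_def poly_prod prod.distrib[symmetric]
  by (intro prod.cong refl) (simp add: node_def s_mult_s[symmetric] algebra_simps)

lemma s_four_term:
  "s (z + b + (of_nat m + 1) * g) * s (z - b + g) - s (b + z) * s (z - b - of_nat m * g)
     = s (2 * z + g) * s ((of_nat m + 1) * g)"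
proof -
  \<comment> \<open>Midpoints: with the common \<open>B\<close> both products become differences of
    values of \<open>f\<close>, and \<open>f B\<close> cancels.\<close>
  define A where "A = z + (of_nat m + 2) * g / 2"
  define A' where "A' = z - of_nat m * g / 2"
  define B where "B = b + of_nat m * g / 2"
  have "s (A + B) * s (A - B) - s (A' + B) * s (A' - B) = s (A + A') * s (A - A')"
    by (simp add: s_mult_s)
  moreover have "A + B = z + b + (of_nat m + 1) * g" "A - B = z - b + g" "A' + B = b + z"
    "A' - B = z - b - of_nat m * g" "A + A' = 2 * z + g" "A - A' = (of_nat m + 1) * g"
    by (auto simp: A_def A'_def B_def field_simps)
  ultimately show ?thesis by simp
qed

text \<open>The factors of a Newton polynomial are spaced by \<open>g\<close>, so after the shift to
  \<open>z + g\<close> all but the outermost ones reappear; \<open>s (b + z)\<close>, a factor of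
  \<open>num4\<close>, completes the first product. The difference of the remaining outer factors is
  \<open>s_four_term\<close>.\<close>

lemma newton_node_shift:
  "s (b + z) * (poly (newton_poly (node g b) (Suc m)) (f (z + g)) - poly (newton_poly (node g b) (Suc m)) (f z))
   = s (2 * z + g) * s ((of_nat m + 1) * g) * s (b + of_nat m * g + z) * poly (newton_poly (node g b) m) (f z)"
proof -
  define U where "U = (\<Prod>i<m. s (z + b + of_nat i * g))"
  define V where "V = (\<Prod>i<m. s (z - b - of_nat i * g))"
  have "s (b + z) * (\<Prod>i<Suc m. s (z + g + b + of_nat i * g)) = (\<Prod>i<Suc (Suc m). s (z + b + of_nat i * g))"
    by (subst (2) prod.lessThan_Suc_shift) (simp add: algebra_simps)
  also have "\<dots> = U * s (z + b + of_nat m * g) * s (z + b + (of_nat m + 1) * g)"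
    by (simp add: U_def algebra_simps)
  finally have 1: "s (b + z) * (\<Prod>i<Suc m. s (z + g + b + of_nat i * g)) =
      U * s (z + b + of_nat m * g) * s (z + b + (of_nat m + 1) * g)" .
  have 2: "(\<Prod>i<Suc m. s (z + g - b - of_nat i * g)) = s (z - b + g) * V"
    by (subst prod.lessThan_Suc_shift) (simp add: V_def algebra_simps)
  have "s (b + z) * poly (newton_poly (node g b) (Suc m)) (f (z + g)) =
     U * s (z + b + of_nat m * g) * s (z + b + (of_nat m + 1) * g) * (s (z - b + g) * V)"
    unfolding poly_newton_node mult.assoc[symmetric] 1[symmetric] 2[symmetric] by (simp add: mult_ac)
  moreover have "poly (newton_poly (node g b) (Suc m)) (f z) =
     U * s (z + b + of_nat m * g) * (V * s (z - b - of_nat m * g))"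
    unfolding poly_newton_node by (simp add: U_def V_def)
  moreover have "poly (newton_poly (node g b) m) (f z) = U * V"
    unfolding poly_newton_node by (simp add: U_def V_def)
  ultimately have "s (b + z) * (poly (newton_poly (node g b) (Suc m)) (f (z + g)) - poly (newton_poly (node g b) (Suc m)) (f z))
    = U * V * s (z + b + of_nat m * g) * (s (z + b + (of_nat m + 1) * g) * s (z - b + g) - s (b + z) * s (z - b - of_nat m * g))"
    by (simp add: algebra_simps)
  thus ?thesis unfolding s_four_term \<open>poly (newton_poly (node g b) m) (f z) = U * V\<close>
    by (simp add: ac_simps)
qed

text \<open>Both shifts produce the same Newton polynomial of one degree less. The bracket left over
  is \<open>s_quad\<close> with \<open>h4\<close> the last node \<open>b + k g\<close>; its slope
  and its value give the diagonal and the off-diagonal entry.\<close>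

lemma askey_wilson_newton:
  assumes nz: "s (2 * z) \<noteq> 0" "s (2 * z + g) \<noteq> 0" "s (g - 2 * z) \<noteq> 0" "s g \<noteq> 0"
  shows "E_coeff g (a + b + c + d) m * poly (newton_poly (node g b) m) (f z)
       + F_coeff g a b c d m * poly (newton_poly (node g b) (m - 1)) (f z)
    = num4 a b c d z / (s (2 * z) * s (2 * z + g) * s g) *
        (poly (newton_poly (node g b) m) (f (z + g)) - poly (newton_poly (node g b) m) (f z))
    - num4 a b c d (- z) / (s (2 * z) * s (g - 2 * z) * s g) *
        (poly (newton_poly (node g b) m) (f (z - g)) - poly (newton_poly (node g b) m) (f z))"
proof (cases m)
  case 0
  thus ?thesis by (simp add: newton_poly_def E_coeff_def F_coeff_def)
next
  case (Suc k)
  define P where "P = (\<lambda>m. newton_poly (node g b) m)"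
  have p: "num4 a b c d z * (poly (P (Suc k)) (f (z + g)) - poly (P (Suc k)) (f z))
    = s (2 * z + g) * s ((of_nat k + 1) * g) * poly (P k) (f z) *
        (s (a + z) * s (c + z) * s (d + z) * s (b + of_nat k * g + z))"
    using newton_node_shift[of b z g k] unfolding num4_def P_def by (simp add: ac_simps)
  have m: "num4 a b c d (-z) * (poly (P (Suc k)) (f (z - g)) - poly (P (Suc k)) (f z))
    = s (g - 2 * z) * s ((of_nat k + 1) * g) * poly (P k) (f z) *
        (s (a - z) * s (c - z) * s (d - z) * s (b + of_nat k * g - z))"
  proof -
    have "s (b - z) * (poly (P (Suc k)) (f (z - g)) - poly (P (Suc k)) (f z))
      = s (g - 2 * z) * s ((of_nat k + 1) * g) * s (b + of_nat k * g - z) * poly (P k) (f z)"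
      using newton_node_shift[of b "-z" g k] f_minus_commute[of z g] by (simp add: P_def)
    thus ?thesis unfolding num4_def by simp
  qed
  have "num4 a b c d z / (s (2 * z) * s (2 * z + g) * s g) * (poly (P (Suc k)) (f (z + g)) - poly (P (Suc k)) (f z))
    - num4 a b c d (- z) / (s (2 * z) * s (g - 2 * z) * s g) * (poly (P (Suc k)) (f (z - g)) - poly (P (Suc k)) (f z))
    = (s ((of_nat k + 1) * g) * poly (P k) (f z) * (s (a + z) * s (c + z) * s (d + z) * s (b + of_nat k * g + z))) / (s (2 * z) * s g)
    - (s ((of_nat k + 1) * g) * poly (P k) (f z) * (s (a - z) * s (c - z) * s (d - z) * s (b + of_nat k * g - z))) / (s (2 * z) * s g)"
    unfolding times_divide_eq_left p m using nz by (simp add: mult.assoc)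
  also have "\<dots> = s ((of_nat k + 1) * g) * poly (P k) (f z) / (s (2 * z) * s g) *
      (s (a + z) * s (c + z) * s (d + z) * s (b + of_nat k * g + z) - s (a - z) * s (c - z) * s (d - z) * s (b + of_nat k * g - z))"
    by (simp add: right_diff_distrib diff_divide_distrib)
  also have "\<dots> = s ((of_nat k + 1) * g) * poly (P k) (f z) / s g *
      (s (a + c + d + (b + of_nat k * g)) * (f z - f (b + of_nat k * g)) +
       s (a + (b + of_nat k * g)) * s (c + (b + of_nat k * g)) * s (d + (b + of_nat k * g)))"
    unfolding s_quad using nz by simp
  also have "\<dots> = E_coeff g (a + b + c + d) m * poly (P (Suc k)) (f z) + F_coeff g a b c d m * poly (P k) (f z)"
  proof -
    have "poly (P (Suc k)) (f z) = poly (P k) (f z) * (f z - f (b + of_nat k * g))"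
      by (simp add: P_def newton_poly_Suc node_def algebra_simps)
    moreover have "a + c + d + (b + of_nat k * g) = a + b + c + d + of_nat k * g" 
      "a + (b + of_nat k * g) = a + b + of_nat k * g"  "c + (b + of_nat k * g) = c + b + of_nat k * g"
      "d + (b + of_nat k * g) = d + b + of_nat k * g" by (auto simp: algebra_simps)
    ultimately show ?thesis
      by (simp add: E_coeff_def F_coeff_def Suc add_divide_distrib distrib_left add.commute[of "of_nat k" 1] ac_simps)
  qed
  finally show ?thesis by (simp add: P_def Suc)
qed

text \<open>\<open>R\<close> is the dual operator minus its top eigenvalue, applied to the product
  \<open>Q\<close> of all \<open>Y - X k\<close>. Subtracting \<open>E n\<close> lowers the degree
  below \<open>n\<close>, so \<open>R\<close> is determined by its values at the \<open>n\<close>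
  points \<open>X j\<close>. There \<open>Q\<close> vanishes and only its two shifted values
  survive; these are the two hops.\<close>

lemma kernel_identity:
  fixes x :: "nat \<Rightarrow> complex" and a b c d :: complex
  assumes inj: "inj_on (\<lambda>j. f (x j)) {1..n}" and n: "n \<ge> 1"
    and nz: "\<And>j. j \<in> {1..n} \<Longrightarrow> s (2 * x j) \<noteq> 0 \<and> s (2 * x j + g) \<noteq> 0 \<and> s (g - 2 * x j) \<noteq> 0"
    and g: "s g \<noteq> 0"
  defines "X \<equiv> (\<lambda>j. f (x j))"
  defines "\<sigma> \<equiv> a + b + c + d"
  shows "(\<Sum>j=1..n. (hop n g a b c d X j (x j) + hop n g a b c d X j (- x j)) * (\<Prod>k\<in>{1..n}-{j}. Y - X k))
    = (\<Sum>m\<le>n. newton_coeff (node g b) X n m *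
         ((E_coeff g \<sigma> m - E_coeff g \<sigma> n) * poly (newton_poly (node g b) m) Y
           + F_coeff g a b c d m * poly (newton_poly (node g b) (m - 1)) Y))"
proof -
  define P where "P = (\<lambda>m. newton_poly (node g b) m)"
  define C where "C = newton_coeff (node g b) X n"
  define E where "E = E_coeff g \<sigma>"
  define F where "F = F_coeff g a b c d"
  define Q where "Q = (\<Prod>k=1..n. [:- X k, 1:])"
  have Q: "Q = (\<Sum>m\<le>n. smult (C m) (P m))" unfolding Q_def C_def P_def by (rule newton_expansion)
  have pQ: "poly Q y = (\<Prod>k=1..n. y - X k)" for y by (simp add: Q_def poly_prod)
  define R where "R = (\<Sum>m\<le>n. smult (C m) (smult (E m - E n) (P m) + smult (F m) (P (m - 1))))"
  have F0: "F 0 = 0" by (simp add: F_def F_coeff_def)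
  have "degree R \<le> n - 1" unfolding R_def
  proof (rule degree_sum_le)
    fix m assume m: "m \<in> {..n}"
    have "degree (smult (E m - E n) (P m)) \<le> n - 1"
      using m by (cases "m = n") (auto intro: order.trans[OF degree_smult_le] simp: P_def degree_newton_poly)
    moreover have "degree (smult (F m) (P (m - 1))) \<le> n - 1"
      using m by (intro order.trans[OF degree_smult_le]) (auto simp: P_def degree_newton_poly)
    ultimately show "degree (smult (C m) (smult (E m - E n) (P m) + smult (F m) (P (m - 1)))) \<le> n - 1"
      by (rule order.trans[OF degree_smult_le degree_add_le])
  qed simp
  hence deg: "degree R < card {1..n}" using n by simp
  have lag: "poly R Y = (\<Sum>j=1..n. poly R (X j) * (\<Prod>k\<in>{1..n}-{j}. (Y - X k) / (X j - X k)))"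
    unfolding X_def by (rule lagrange_interpolation[OF _ inj deg]) simp
  have val: "poly R (X j) = num4 a b c d (x j) / s (2 * x j) * (\<Prod>k\<in>{1..n}-{j}. f (x j + g) - X k)
       - num4 a b c d (- x j) / s (2 * x j) * (\<Prod>k\<in>{1..n}-{j}. f (x j - g) - X k)"
    if j: "j \<in> {1..n}" for j
  proof -
    note nzj = nz[OF j]
    define u where "u = num4 a b c d (x j) / (s (2 * x j) * s (2 * x j + g) * s g)"
    define v where "v = num4 a b c d (- x j) / (s (2 * x j) * s (g - 2 * x j) * s g)"
    have Q0: "poly Q (X j) = 0" unfolding pQ using j by (intro prod_zero) auto
    have key: "E m * poly (P m) (X j) + F m * poly (P (m-1)) (X j) =
        u * (poly (P m) (f (x j + g)) - poly (P m) (X j))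
         - v * (poly (P m) (f (x j - g)) - poly (P m) (X j))" for m
      unfolding u_def v_def P_def E_def F_def X_def \<sigma>_def
      by (rule askey_wilson_newton) (use nzj g in auto)
    have "poly R (X j) = (\<Sum>m\<le>n. C m * (E m * poly (P m) (X j) + F m * poly (P (m-1)) (X j))) - E n * poly Q (X j)"
      unfolding R_def Q poly_sum sum_distrib_left sum_subtractf[symmetric]
      by (intro sum.cong refl) (simp add: algebra_simps)
    also have "\<dots> = (\<Sum>m\<le>n. C m * (u * (poly (P m) (f (x j + g)) - poly (P m) (X j))
         - v * (poly (P m) (f (x j - g)) - poly (P m) (X j))))"
      unfolding key by (simp only: Q0 mult_zero_right diff_zero)
    also have "\<dots> = u * (poly Q (f (x j + g)) - poly Q (X j)) - v * (poly Q (f (x j - g)) - poly Q (X j))"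
      unfolding Q poly_sum sum_subtractf[symmetric] sum_distrib_left
      by (intro sum.cong refl) (simp add: algebra_simps)
    also have "poly Q (f (x j + g)) = s (2 * x j + g) * s g * (\<Prod>k\<in>{1..n}-{j}. f (x j + g) - X k)"
    proof -
      have "poly Q (f (x j + g)) = (f (x j + g) - X j) * (\<Prod>k\<in>{1..n}-{j}. f (x j + g) - X k)"
        unfolding pQ using j by (subst prod.remove[of _ j]) auto
      also have "f (x j + g) - X j = s (2 * x j + g) * s g"
        by (simp add: X_def s_mult_s[symmetric] algebra_simps)
      finally show ?thesis .
    qed
    also have "poly Q (f (x j - g)) = s (g - 2 * x j) * s g * (\<Prod>k\<in>{1..n}-{j}. f (x j - g) - X k)"
    proof -
      have "poly Q (f (x j - g)) = (f (x j - g) - X j) * (\<Prod>k\<in>{1..n}-{j}. f (x j - g) - X k)"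
        unfolding pQ using j by (subst prod.remove[of _ j]) auto
      also have "f (x j - g) - X j = f (g - x j) - f (- x j)"
        by (simp add: X_def f_minus_commute[of "x j" g])
      also have "\<dots> = s (g - 2 * x j) * s g"
        unfolding s_mult_s[symmetric] by (simp add: algebra_simps)
      finally show ?thesis .
    qed
    finally show ?thesis using nzj g Q0 unfolding u_def v_def by simp
  qed
  have "poly R Y = (\<Sum>j=1..n. (hop n g a b c d X j (x j) + hop n g a b c d X j (- x j)) * (\<Prod>k\<in>{1..n}-{j}. Y - X k))"
    unfolding lag
  proof (intro sum.cong refl)
    fix j assume j: "j \<in> {1..n}"
    have h1: "hop n g a b c d X j (x j) = num4 a b c d (x j) / s (2 * x j) * (\<Prod>k\<in>{1..n}-{j}. f (x j + g) - X k) / (\<Prod>k\<in>{1..n}-{j}. X j - X k)"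
      by (simp add: hop_def X_def prod_dividef)
    have h2: "hop n g a b c d X j (- x j) = - (num4 a b c d (- x j) / s (2 * x j) * (\<Prod>k\<in>{1..n}-{j}. f (x j - g) - X k) / (\<Prod>k\<in>{1..n}-{j}. X j - X k))"
      using s_minus[of "2 * x j"] f_minus_commute[of "x j" g] by (simp add: hop_def X_def prod_dividef)
    show "poly R (X j) * (\<Prod>k\<in>{1..n}-{j}. (Y - X k) / (X j - X k)) = (hop n g a b c d X j (x j) + hop n g a b c d X j (- x j)) * (\<Prod>k\<in>{1..n}-{j}. Y - X k)"
      unfolding h1 h2 val[OF j] prod_dividef by (simp add: field_simps diff_divide_distrib)
  qed
  also have "poly R Y = (\<Sum>m\<le>n. C m * ((E m - E n) * poly (P m) Y + F m * poly (P (m - 1)) Y))"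
    unfolding R_def by (simp add: poly_sum)
  finally show ?thesis unfolding C_def E_def F_def P_def ..
qed

text \<open>Completing the square: with \<open>B = (\<sigma> - g) / 2\<close> the eigenvalue times
  \<open>s g\<close> is \<open>f (m g + B) - f B\<close>, so differences of eigenvalues factor
  again.\<close>

lemma E_coeff_diff:
  assumes "s g \<noteq> 0" "m \<le> n"
  shows "(E_coeff g \<sigma> n - E_coeff g \<sigma> m) * s g = s (of_nat (n - m) * g) * s (\<sigma> + (of_nat (n + m) - 1) * g)"
proof -
  define B where "B = (\<sigma> - g) / 2"
  define A where "A = (\<lambda>k::nat. of_nat k * g + B)"
  have *: "s (of_nat k * g) * s (\<sigma> + (of_nat k - 1) * g) = f (A k) - f B" for k
  proof -
    have "A k - B = of_nat k * g" "A k + B = \<sigma> + (of_nat k - 1) * g"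
      by (auto simp: A_def B_def field_simps)
    thus ?thesis using s_mult_s[of "A k" B] by (simp add: mult.commute)
  qed
  have "(E_coeff g \<sigma> n - E_coeff g \<sigma> m) * s g = f (A n) - f (A m)"
    unfolding E_coeff_def * using assms by (simp add: field_simps)
  also have "\<dots> = s (A n + A m) * s (A n - A m)" by (simp add: s_mult_s)
  also have "A n - A m = of_nat (n - m) * g" using assms by (simp add: A_def of_nat_diff algebra_simps)
  also have "A n + A m = \<sigma> + (of_nat (n + m) - 1) * g" by (simp add: A_def B_def field_simps)
  finally show ?thesis by (simp add: mult.commute)
qed

end

section \<open>Detailed balance\<close>

lemma Lam_upI:
  assumes "l \<in> Lam n" "j \<in> {1..n}" "j = 1 \<or> l j < l (j - 1)"
  shows "l(j := Suc (l j)) \<in> Lam n"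
proof -
  have "(l(j := Suc (l j))) k \<le> (l(j := Suc (l j))) i" if "1 \<le> i" "i \<le> k" "k \<le> n" for i k
  proof (cases "k = j \<and> i \<noteq> j")
    case True
    hence "j \<noteq> 1" "i \<le> j - 1" using that by auto
    hence "l (j - 1) \<le> l i" using LamD[of l n i "j - 1"] assms(1,2) that by auto
    thus ?thesis using True assms(3) \<open>j \<noteq> 1\<close> by auto
  qed (use LamD[OF assms(1) that] in auto)
  thus ?thesis using assms(1,2) by (auto simp: Lam_def PiE_def extensional_def)
qed

lemma Lam_downI:
  assumes "l \<in> Lam n" "j \<in> {1..n}" "j = n \<or> l (j + 1) < l j"
  shows "l(j := l j - 1) \<in> Lam n"
proof -
  have "(l(j := l j - 1)) k \<le> (l(j := l j - 1)) i" if "1 \<le> i" "i \<le> k" "k \<le> n" for i k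
  proof (cases "i = j \<and> k \<noteq> j")
    case True
    hence "j \<noteq> n" "j + 1 \<le> k" using that by auto
    hence "l k \<le> l (j + 1)" using LamD[of l n "j + 1" k] assms(1,2) that by auto
    thus ?thesis using True assms(3) \<open>j \<noteq> n\<close> by auto
  qed (use LamD[OF assms(1) that] in auto)
  thus ?thesis using assms(1,2) by (auto simp: Lam_def PiE_def extensional_def)
qed

context sfun
begin

lemma sp_Suc_shift: "sp x (Suc m) = s x * sp (x + 1) m"
  unfolding sp_def by (subst prod.lessThan_Suc_shift) (simp add: add_ac)

lemma s_of_nat_Suc: "s (of_nat N + 1) \<noteq> 0"
  using Re_eq_0_if_s[of "of_nat N + 1"] by auto

lemma strongly_generic_sum:
  assumes "strongly_generic g a"
  shows "s (2 * a + (of_nat w - 1) * g + of_nat N) \<noteq> 0"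
  using assms unfolding strongly_generic_def by blast

lemma strongly_generic_diff:
  assumes "strongly_generic g a" "w \<ge> 1"
  shows "s (of_nat w * g + of_nat N) \<noteq> 0"
  using assms unfolding strongly_generic_def by blast

lemma strongly_generic_diff1:
  assumes "strongly_generic g a"
  shows "s (of_nat w * g + of_nat N + 1) \<noteq> 0"
  using strongly_generic_diff[OF assms, of w "Suc N"] s_of_nat_Suc[of N]
  by (cases "w = 0") (auto simp: algebra_simps)

lemma regularD: "regular n g a v \<Longrightarrow> j \<in> {1..n} \<Longrightarrow> s (1 - v + rh n g a j + of_nat i) \<noteq> 0"
  unfolding regular_def rh_def
  by (drule spec[of _ "n - j"]) (auto simp: algebra_simps)

lemma rh_diff: "j \<le> k \<Longrightarrow> k \<le> n \<Longrightarrow> rh n g a j - rh n g a k = of_nat (k - j) * g"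
  by (simp add: rh_def of_nat_diff algebra_simps)

lemma pt_diff:
  assumes "l \<in> Lam n" "1 \<le> j" "j \<le> k" "k \<le> n"
  shows "pt n g a l j - pt n g a l k = rh n g a j - rh n g a k + of_nat (l j - l k)"
  using LamD[OF assms] by (simp add: pt_def of_nat_diff)

lemma pair_factor_Suc:
  assumes "y = x + of_nat m" "s y \<noteq> 0"
  shows "pair_factor g x (Suc m) = pair_factor g x m * (s (y + 1) * s (g + y) / (s y * s (1 - g + y)))"
  using assms by (simp add: pair_factor_def sp_Suc add_ac)

lemma single_factor_Suc:
  "single_factor v x (Suc m) = single_factor v x m * (s (v + x + of_nat m) / s (1 - v + x + of_nat m))"
  by (simp add: single_factor_def sp_Suc)

lemma num4_reflect: "num4 a b c d (- (x + 1)) = num4 (1 - a) (1 - b) (1 - c) (1 - d) x"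
proof -
  have "s (v + - (x + 1)) = - s (1 - v + x)" for v
    using s_minus[of "1 - v + x"] by (simp add: algebra_simps)
  thus ?thesis by (simp add: num4_def)
qed

text \<open>A step up is blocked when the previous row has the same length; then its point is
  \<open>x_j + g\<close>, and the corresponding numerator in the product is zero. Hence the operator
  never leaves the chamber.\<close>

lemma hop_up_eq_0:
  assumes l: "l \<in> Lam n" and j: "j \<in> {1..n}" and l': "l(j := Suc (l j)) \<notin> Lam n"
  shows "hop n g a b c d (\<lambda>k. f (pt n g a l k)) j (pt n g a l j) = 0"
proof -
  from Lam_upI[OF l j] l' have j1: "j \<noteq> 1" "\<not> l j < l (j - 1)" by auto
  hence "l (j - 1) = l j" using LamD[OF l, of "j - 1" j] j by force
  hence "pt n g a l (j - 1) = pt n g a l j + g"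
    using j j1 by (simp add: pt_def rh_def of_nat_diff algebra_simps)
  hence "(\<Prod>k\<in>{1..n}-{j}. (f (pt n g a l j + g) - f (pt n g a l k)) / (f (pt n g a l j) - f (pt n g a l k))) = 0"
    using j j1 by (intro prod_zero bexI[of _ "j - 1"]) auto
  thus ?thesis by (simp add: hop_def)
qed

text \<open>Dually, a blocked step down has the next point equal to \<open>x_j - g\<close>. In the
  last row the obstacle is \<open>l n = 0\<close>, where the point is \<open>a\<close> itself and
  the factor \<open>s (a - x_n)\<close> of \<open>num4\<close> vanishes.\<close>

lemma hop_down_eq_0:
  assumes l: "l \<in> Lam n" and j: "j \<in> {1..n}" and l': "l j = 0 \<or> l(j := l j - 1) \<notin> Lam n"
  shows "hop n g a b c d (\<lambda>k. f (pt n g a l k)) j (- pt n g a l j) = 0"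
proof (cases "j = n")
  case True
  hence "l n = 0" using l' Lam_downI[OF l j] by auto
  hence "num4 a b c d (- pt n g a l j) = 0" using True by (simp add: num4_def pt_def rh_def)
  thus ?thesis by (simp add: hop_def)
next
  case False
  have "l (j + 1) = l j" using l' Lam_downI[OF l j] LamD[OF l, of j "j + 1"] j False by force
  hence "pt n g a l (j + 1) = pt n g a l j - g"
    using j False by (simp add: pt_def rh_def of_nat_diff algebra_simps)
  moreover have "f (- pt n g a l j + g) = f (pt n g a l j - g)"
    using f_minus[of "pt n g a l j - g"] by simp
  ultimately have "(\<Prod>k\<in>{1..n}-{j}. (f (- pt n g a l j + g) - f (pt n g a l k)) / (f (- pt n g a l j) - f (pt n g a l k))) = 0"
    using j False by (intro prod_zero bexI[of _ "j + 1"]) auto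
  thus ?thesis by (simp add: hop_def)
qed

text \<open>Quotients of shifted factorials at \<open>b\<close> and \<open>b + 1\<close> telescope
  to one factor each, so raising \<open>b\<close> by 1 multiplies the weight by all
  \<open>f b - f x_k\<close>, up to a constant. This is the Newton coefficient of index 0.
  Regularity at \<open>b + 1\<close> includes \<open>s (\<rho>_k - b)\<close> being nonzero, by
  which the proof divides.\<close>

lemma weight_shift:
  fixes b c d :: complex
  assumes reg: "regular n g a (b + 1)" and l: "l \<in> Lam n"
  shows "weight n g a b c d l * (\<Prod>k=1..n. f b - f (pt n g a l k)) =
     weight n g a (b + 1) c d l * (\<Prod>k=1..n. s (b + rh n g a k) * s (b - rh n g a k))"
proof -
  have key: "single_factor b (rh n g a k) (l k) * (f b - f (pt n g a l k)) =
     single_factor (b + 1) (rh n g a k) (l k) * (s (b + rh n g a k) * s (b - rh n g a k))"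
    if k: "k \<in> {1..n}" for k
  proof -
    define r where "r = rh n g a k"
    define m where "m = l k"
    have nz: "s (r - b + of_nat i) \<noteq> 0" for i
      using regularD[OF reg k, of i] by (simp add: r_def)
    have s1: "sp (b + r) m * s (b + r + of_nat m) = s (b + r) * sp (b + 1 + r) m"
      using sp_Suc_shift[of "b + r" m] by (simp add: sp_Suc add_ac)
    have s2: "sp (r - b) m * s (r - b + of_nat m) = s (r - b) * sp (1 - b + r) m"
      using sp_Suc_shift[of "r - b" m] by (simp add: sp_Suc algebra_simps)
    have z2: "sp (r - b) m \<noteq> 0" using nz by (simp add: sp_eq_0_iff)
    have "sp (1 - b + r) m \<noteq> 0"
      using nz[of "Suc _"] by (simp add: sp_eq_0_iff algebra_simps)
    have "f b - f (r + of_nat m) = s (b + r + of_nat m) * s (b - (r + of_nat m))"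
      by (simp add: s_mult_s[symmetric] add_ac)
    also have "s (b - (r + of_nat m)) = - s (r - b + of_nat m)"
      using s_minus[of "r - b + of_nat m"] by (simp add: algebra_simps)
    finally have "single_factor b r m * (f b - f (r + of_nat m)) =
       - (sp (b + r) m * s (b + r + of_nat m)) * s (r - b + of_nat m) / sp (1 - b + r) m"
      by (simp add: single_factor_def)
    also have "\<dots> = - (s (b + r) * sp (b + 1 + r) m) * (s (r - b) / sp (r - b) m)"
    proof -
      have q: "s (r - b + of_nat m) / sp (1 - b + r) m = s (r - b) / sp (r - b) m"
        using s2 z2 \<open>sp (1 - b + r) m \<noteq> 0\<close> by (simp add: field_simps)
      show ?thesis unfolding s1 times_divide_eq_right[symmetric] q ..
    qed
    also have "\<dots> = single_factor (b + 1) r m * (s (b + r) * s (b - r))"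
      using s_minus_commute[of b r] by (simp add: single_factor_def algebra_simps)
    finally show ?thesis by (simp add: r_def m_def pt_def)
  qed
  have regroup: "t * (A * B * C * D) * F = t * (A * C * D) * (B * F)" for t A B C D F :: complex
    by (simp add: mult_ac)
  have "(\<Prod>k=1..n. s (2 * rh n g a k + 2 * of_nat (l k)) / s (2 * rh n g a k) *
        (single_factor a (rh n g a k) (l k) * single_factor b (rh n g a k) (l k) *
         single_factor c (rh n g a k) (l k) * single_factor d (rh n g a k) (l k))) * (\<Prod>k=1..n. f b - f (pt n g a l k))
    = (\<Prod>k=1..n. s (2 * rh n g a k + 2 * of_nat (l k)) / s (2 * rh n g a k) *
        (single_factor a (rh n g a k) (l k) * single_factor (b + 1) (rh n g a k) (l k) *
         single_factor c (rh n g a k) (l k) * single_factor d (rh n g a k) (l k))) * (\<Prod>k=1..n. s (b + rh n g a k) * s (b - rh n g a k))"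
    unfolding prod.distrib[symmetric]
  proof (intro prod.cong refl)
    fix k assume k: "k \<in> {1..n}"
    show "s (2 * rh n g a k + 2 * of_nat (l k)) / s (2 * rh n g a k) *
        (single_factor a (rh n g a k) (l k) * single_factor b (rh n g a k) (l k) *
         single_factor c (rh n g a k) (l k) * single_factor d (rh n g a k) (l k)) * (f b - f (pt n g a l k))
      = s (2 * rh n g a k + 2 * of_nat (l k)) / s (2 * rh n g a k) *
        (single_factor a (rh n g a k) (l k) * single_factor (b + 1) (rh n g a k) (l k) *
         single_factor c (rh n g a k) (l k) * single_factor d (rh n g a k) (l k)) * (s (b + rh n g a k) * s (b - rh n g a k))"
      unfolding regroup key[OF k] ..
  qed
  thus ?thesis unfolding weight_def by (simp add: mult.assoc)
qed

context
  fixes n :: nat and g a :: complex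
  assumes sg: "strongly_generic g a"
begin

lemma rh_sum_nz: "s (rh n g a j + rh n g a k + of_nat N) \<noteq> 0"
  using strongly_generic_sum[OF sg, of "(n - j) + (n - k) + 1" N] by (simp add: rh_def algebra_simps)

lemma rh_sum_nz1: "s (1 - g + rh n g a j + rh n g a k + of_nat N) \<noteq> 0"
  using strongly_generic_sum[OF sg, of "(n - j) + (n - k)" "Suc N"] by (simp add: rh_def algebra_simps)

lemma rh_diff_nz: "j < k \<Longrightarrow> k \<le> n \<Longrightarrow> s (rh n g a j - rh n g a k + of_nat N) \<noteq> 0"
  using strongly_generic_diff[OF sg, of "k - j" N] by (simp add: rh_diff)

text \<open>Subtracting \<open>g\<close> turns the gap \<open>k - j\<close> into
  \<open>k - j - 1\<close>, possibly 0; the summand 1 then keeps the argument off the zeros.\<close>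

lemma rh_diff_nz1: "j < k \<Longrightarrow> k \<le> n \<Longrightarrow> s (1 - g + rh n g a j - rh n g a k + of_nat N) \<noteq> 0"
proof -
  assume *: "j < k" "k \<le> n"
  have "1 - g + rh n g a j - rh n g a k + of_nat N = 1 - g + (rh n g a j - rh n g a k) + of_nat N" by simp
  also have "\<dots> = of_nat (k - j - 1) * g + of_nat N + 1"
    using * by (subst rh_diff) (auto simp: of_nat_diff algebra_simps)
  finally have eq: "1 - g + rh n g a j - rh n g a k + of_nat N = of_nat (k - j - 1) * g + of_nat N + 1" .
  show "s (1 - g + rh n g a j - rh n g a k + of_nat N) \<noteq> 0"
    unfolding eq by (rule strongly_generic_diff1[OF sg])
qed

lemma rh_diff_nz2: "j < k \<Longrightarrow> k \<le> n \<Longrightarrow> s (g + rh n g a j - rh n g a k + of_nat N) \<noteq> 0"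
proof -
  assume *: "j < k" "k \<le> n"
  have "g + rh n g a j - rh n g a k + of_nat N = g + (rh n g a j - rh n g a k) + of_nat N" by simp
  also have "\<dots> = of_nat (k - j + 1) * g + of_nat N"
    using * by (subst rh_diff) (auto simp: of_nat_diff algebra_simps)
  finally have eq: "g + rh n g a j - rh n g a k + of_nat N = of_nat (k - j + 1) * g + of_nat N" .
  show "s (g + rh n g a j - rh n g a k + of_nat N) \<noteq> 0"
    unfolding eq by (rule strongly_generic_diff[OF sg]) simp
qed

lemma rh_double_nz: "s (2 * rh n g a j + of_nat N) \<noteq> 0"
  using rh_sum_nz[of j j N] by simp

lemma regular_self: "regular n g a a"
  using strongly_generic_diff1[OF sg] by (simp add: regular_def algebra_simps)

lemma pt_double_nz: "s (2 * pt n g a l j) \<noteq> 0"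
  using rh_double_nz[of j "2 * l j"] by (simp add: pt_def algebra_simps)

lemma pt_double_g_nz: "s (2 * pt n g a l j + g) \<noteq> 0"
  using strongly_generic_sum[OF sg, of "(n - j) + (n - j) + 2" "2 * l j"]
  by (simp add: pt_def rh_def algebra_simps)

lemma pt_g_double_nz: "s (g - 2 * pt n g a l j) \<noteq> 0"
  using strongly_generic_sum[OF sg, of "(n - j) + (n - j)" "2 * l j"] s_minus_commute[of g "2 * pt n g a l j"]
  by (simp add: pt_def rh_def algebra_simps)

lemma pt_sum_nz: "s (pt n g a l j + pt n g a l k) \<noteq> 0"
  using rh_sum_nz[of j k "l j + l k"] by (simp add: pt_def algebra_simps)

lemma pt_diff_nz:
  assumes "l \<in> Lam n" "1 \<le> j" "j < k" "k \<le> n"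
  shows "s (pt n g a l j - pt n g a l k) \<noteq> 0"
  using pt_diff[of l n j k] rh_diff_nz[of j k "l j - l k"] assms by simp

lemma inj_on_f_pt:
  assumes "l \<in> Lam n"
  shows "inj_on (\<lambda>j. f (pt n g a l j)) {1..n}"
proof (rule linorder_inj_onI')
  fix j k assume "j \<in> {1..n}" "k \<in> {1..n}" "j < k"
  thus "f (pt n g a l j) \<noteq> f (pt n g a l k)"
    using pt_diff_nz[of l j k] pt_sum_nz[of l j k] assms s_mult_s[of "pt n g a l j" "pt n g a l k"] by auto
qed

text \<open>Only the pairs containing \<open>j\<close> and the single factor of \<open>j\<close>
  change. Each such pair contributes the factor \<open>u\<close>, where the sum and the difference
  of the two points combine through \<open>s_mult_s\<close>.\<close>

lemma weight_up:
  fixes b c d :: complex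
  assumes l: "l \<in> Lam n" and j: "j \<in> {1..n}"
  defines "l' \<equiv> l(j := Suc (l j))" and "x \<equiv> pt n g a l j" and "X \<equiv> (\<lambda>k. f (pt n g a l k))"
  assumes l': "l' \<in> Lam n"
  shows "weight n g a b c d l' = weight n g a b c d l *
     (\<Prod>k\<in>{1..n}-{j}. (f (x + g) - X k) * (f (x + 1) - X k) / ((f x - X k) * (f (x + 1 - g) - X k))) *
     (s (2 * x + 2) / s (2 * x) * (num4 a b c d x / num4 (1 - a) (1 - b) (1 - c) (1 - d) x))"
proof -
  define r where "r = rh n g a"
  define y where "y = pt n g a l"
  have yr: "y i = r i + of_nat (l i)" for i by (simp add: y_def r_def pt_def)
  have xy: "x = y j" by (simp add: x_def y_def)
  define u where "u = (\<lambda>k. (f (x + g) - X k) * (f (x + 1) - X k) / ((f x - X k) * (f (x + 1 - g) - X k)))"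
  have u_eq: "u k = (s (x + y k + 1) * s (g + (x + y k)) / (s (x + y k) * s (1 - g + (x + y k)))) *
      (s (x - y k + 1) * s (g + (x - y k)) / (s (x - y k) * s (1 - g + (x - y k))))" for k
    unfolding u_def X_def y_def[symmetric] s_mult_s[symmetric] by (simp add: algebra_simps)
  define v where "v = s (2 * x + 2) / s (2 * x) * (num4 a b c d x / num4 (1 - a) (1 - b) (1 - c) (1 - d) x)"
  have l'j: "l' j = Suc (l j)" and l'k: "k \<noteq> j \<Longrightarrow> l' k = l k" for k by (auto simp: l'_def)
  have pair: "pair_factor g (r i + r k) (l' i + l' k) * pair_factor g (r i - r k) (l' i - l' k)
     = pair_factor g (r i + r k) (l i + l k) * pair_factor g (r i - r k) (l i - l k) *
       (if i = j then u k else if k = j then u i else 1)"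
    if ik: "i \<in> {1..n}" "k \<in> {i<..n}" for i k
  proof -
    have sum: "y i + y k = r i + r k + of_nat (l i + l k)" by (simp add: yr)
    have dif: "y i - y k = r i - r k + of_nat (l i - l k)"
      using pt_diff[of l n i k] ik l by (simp add: y_def r_def)
    note nz = rh_sum_nz[of i k, folded r_def] rh_diff_nz[of i k, folded r_def]
    consider "i = j" | "k = j" "i \<noteq> j" | "i \<noteq> j" "k \<noteq> j" by blast
    thus ?thesis
    proof cases
      case 1
      have "l k \<le> l i" using LamD[OF l, of i k] ik by auto
      hence d: "Suc (l i) - l k = Suc (l i - l k)" by simp
      have "pair_factor g (r i + r k) (Suc (l i + l k)) * pair_factor g (r i - r k) (Suc (l i - l k))
       = pair_factor g (r i + r k) (l i + l k) * pair_factor g (r i - r k) (l i - l k) * u k"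
      proof -
        have p1: "pair_factor g (r i + r k) (Suc (l i + l k)) = pair_factor g (r i + r k) (l i + l k) *
          (s (y i + y k + 1) * s (g + (y i + y k)) / (s (y i + y k) * s (1 - g + (y i + y k))))"
          by (rule pair_factor_Suc[OF sum]) (simp only: sum nz(1) not_False_eq_True)
        have p2: "pair_factor g (r i - r k) (Suc (l i - l k)) = pair_factor g (r i - r k) (l i - l k) *
          (s (y i - y k + 1) * s (g + (y i - y k)) / (s (y i - y k) * s (1 - g + (y i - y k))))"
          by (rule pair_factor_Suc[OF dif], unfold dif, rule nz(2)) (use ik in auto)
        show ?thesis unfolding p1 p2 u_eq using 1 by (simp add: xy mult_ac)
      qed
      thus ?thesis using 1 ik l'j l'k[of k] d by simp
    next
      \<comment> \<open>Here \<open>j\<close> has the smaller coordinate: \<open>l i - l j\<close>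
        drops by one, so \<open>pair_factor_Suc\<close> is read backwards, from \<open>m\<close> at
        \<open>l'\<close> to \<open>Suc m\<close> at \<open>l\<close>. Oddness of \<open>s\<close>
        brings the result into the shape \<open>u i\<close>.\<close>
      case 2
      hence ij: "i < j" using ik by auto
      have "l' j \<le> l' i" using LamD[OF l', of i j] ik 2 by auto
      hence "l i \<ge> Suc (l j)" using 2 l'j l'k by simp
      then obtain m where m: "l i - l j = Suc m" "l i - Suc (l j) = m" 
        by (metis Suc_diff_Suc Suc_le_lessD)
      have dm: "y i - y j = r i - r j + of_nat (Suc m)" using dif 2 m by simp
      define z where "z = r i - r j + of_nat m"
      have p1: "pair_factor g (r i + r j) (Suc (l i + l j)) = pair_factor g (r i + r j) (l i + l j) *
          (s (y i + y j + 1) * s (g + (y i + y j)) / (s (y i + y j) * s (1 - g + (y i + y j))))"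
        using sum 2 by (intro pair_factor_Suc) (use nz(1)[of "l i + l j"] in auto)
      have nz2: "s z \<noteq> 0" "s (z + 1) \<noteq> 0" "s (g + z) \<noteq> 0" "s (1 - g + z) \<noteq> 0"
        using rh_diff_nz[of i j m] rh_diff_nz[of i j "Suc m"] rh_diff_nz2[of i j m] rh_diff_nz1[of i j m] ij ik 2
        by (auto simp: r_def z_def algebra_simps)
      have p2: "pair_factor g (r i - r j) (Suc m) = pair_factor g (r i - r j) m *
         (s (z + 1) * s (g + z) / (s z * s (1 - g + z)))"
        using nz2 by (intro pair_factor_Suc) (auto simp: z_def)
      have ui: "u i = (s (y i + y j + 1) * s (g + (y i + y j)) / (s (y i + y j) * s (1 - g + (y i + y j)))) *
          (s z * s (1 - g + z) / (s (z + 1) * s (g + z)))"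
      proof -
        have xz: "x - y i = - (z + 1)" using dm by (simp add: xy z_def algebra_simps)
        have "s (x - y i + 1) = - s z" "s (g + (x - y i)) = - s (1 - g + z)"
          "s (x - y i) = - s (z + 1)" "s (1 - g + (x - y i)) = - s (g + z)"
          unfolding xz s_minus[symmetric] by (auto simp: algebra_simps)
        thus ?thesis unfolding u_eq by (simp add: xy add.commute[of "y j"])
      qed
      have "pair_factor g (r i + r j) (Suc (l i + l j)) * pair_factor g (r i - r j) m =
         pair_factor g (r i + r j) (l i + l j) * pair_factor g (r i - r j) (Suc m) * u i"
        unfolding p1 p2 ui using nz2 by simp
      thus ?thesis using 2 l'j l'k[of i] m by simp
    next
      case 3
      thus ?thesis using l'k by simp
    qed
  qed
  have single: "s (2 * r i + 2 * of_nat (l' i)) / s (2 * r i) *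
        (single_factor a (r i) (l' i) * single_factor b (r i) (l' i) *
         single_factor c (r i) (l' i) * single_factor d (r i) (l' i)) =
     s (2 * r i + 2 * of_nat (l i)) / s (2 * r i) *
        (single_factor a (r i) (l i) * single_factor b (r i) (l i) *
         single_factor c (r i) (l i) * single_factor d (r i) (l i)) * (if i = j then v else 1)" for i
  proof (cases "i = j")
    case True
    have "s (2 * r i + 2 * of_nat (l i)) \<noteq> 0"
      using pt_double_nz[of l i] by (simp add: pt_def r_def)
    thus ?thesis using True
      by (simp add: l'j single_factor_Suc v_def num4_def xy yr algebra_simps)
  qed (simp add: l'k)
  have "weight n g a b c d l' = weight n g a b c d l *
      (\<Prod>i=1..n. \<Prod>k\<in>{i<..n}. if i = j then u k else if k = j then u i else 1) *
      (\<Prod>i=1..n. if i = j then v else 1)"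
  proof -
    have "(\<Prod>i=1..n. \<Prod>k\<in>{i<..n}. pair_factor g (r i + r k) (l' i + l' k) * pair_factor g (r i - r k) (l' i - l' k))
      = (\<Prod>i=1..n. \<Prod>k\<in>{i<..n}. pair_factor g (r i + r k) (l i + l k) * pair_factor g (r i - r k) (l i - l k)) *
        (\<Prod>i=1..n. \<Prod>k\<in>{i<..n}. if i = j then u k else if k = j then u i else 1)"
      unfolding prod.distrib[symmetric] by (intro prod.cong refl pair)
    thus ?thesis unfolding weight_def r_def[symmetric] single prod.distrib by (simp add: mult_ac)
  qed
  also have "(\<Prod>i=1..n. if i = j then v else 1) = v" using j by simp
  also have "(\<Prod>i=1..n. \<Prod>k\<in>{i<..n}. if i = j then u k else if k = j then u i else 1) = prod u ({1..n} - {j})"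
    by (rule prod_pairs_single[OF j])
  finally show ?thesis unfolding u_def v_def .
qed

text \<open>Of the four differences in each factor of \<open>weight_up\<close>, two form the upward
  hop at \<open>l\<close>; the other two cancel the downward hop at \<open>l'\<close>, which is
  taken at \<open>- (x + 1)\<close>. The sign comes from
  \<open>s (- 2 (x + 1)) = - s (2 x + 2)\<close>.\<close>

lemma detailed_balance:
  fixes b c d :: complex
  assumes reg: "regular n g a b" "regular n g a c" "regular n g a d"
    and l: "l \<in> Lam n" and j: "j \<in> {1..n}"
  defines "l' \<equiv> l(j := Suc (l j))"
  assumes l': "l' \<in> Lam n"
  shows "weight n g a b c d l' * hop n g a b c d (\<lambda>k. f (pt n g a l' k)) j (- pt n g a l' j)
       = - (weight n g a b c d l * hop n g a b c d (\<lambda>k. f (pt n g a l k)) j (pt n g a l j))"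
proof -
  define x where "x = pt n g a l j"
  define X where "X = (\<lambda>k. f (pt n g a l k))"
  have x': "pt n g a l' j = x + 1" by (simp add: x_def l'_def pt_def)
  have X': "f (pt n g a l' k) = X k" if "k \<noteq> j" for k
    using that by (simp add: X_def pt_def l'_def)
  have nz1: "s (2 * x + 2) \<noteq> 0" using pt_double_nz[of l' j] x' by (simp add: algebra_simps)
  have nz2: "num4 (1 - a) (1 - b) (1 - c) (1 - d) x \<noteq> 0"
    using regularD[OF reg(1) j, of "l j"] regularD[OF reg(2) j, of "l j"] regularD[OF reg(3) j, of "l j"]
      regularD[OF regular_self j, of "l j"] by (simp add: num4_def x_def pt_def add.assoc)
  \<comment> \<open>These differences occur in the weight ratio and in the hop at \<open>l'\<close>.
    For \<open>k < j\<close>, membership of \<open>l'\<close> in \<open>Lam n\<close> leaves a gap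
    of at least 1 between \<open>l k\<close> and \<open>l j\<close>, which the second claim
    needs.\<close>
  have nz3: "f (x + 1) - X k \<noteq> 0" "f (x + 1 - g) - X k \<noteq> 0" if k: "k \<in> {1..n} - {j}" for k
  proof -
    show "f (x + 1) - X k \<noteq> 0"
      using inj_onD[OF inj_on_f_pt[OF l'], of j k] j k x' X'[of k] by auto
    define y where "y = pt n g a l k"
    have "s (x + 1 - g + y) \<noteq> 0"
      using rh_sum_nz1[of j k "l j + l k"] by (simp add: x_def y_def pt_def algebra_simps)
    moreover have "s (x + 1 - g - y) \<noteq> 0"
    proof (cases "j < k")
      case True
      hence "x - y = rh n g a j - rh n g a k + of_nat (l j - l k)"
        unfolding x_def y_def using k j by (intro pt_diff[OF l]) auto
      hence eq: "x + 1 - g - y = 1 - g + rh n g a j - rh n g a k + of_nat (l j - l k)"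
        by (simp add: algebra_simps)
      show ?thesis unfolding eq using rh_diff_nz1[of j k "l j - l k"] True k by auto
    next
      case False
      hence kj: "k < j" using k by auto
      have "l' j \<le> l' k" using LamD[OF l', of k j] kj j k by auto
      hence "l k \<ge> Suc (l j)" using kj by (simp add: l'_def)
      hence "s (y - x - 1 + g) \<noteq> 0"
        using rh_diff_nz2[of k j "l k - Suc (l j)"] kj j by (simp add: x_def y_def pt_def of_nat_diff algebra_simps)
      thus ?thesis using s_minus[of "y - x - 1 + g"] by (simp add: algebra_simps)
    qed
    ultimately show "f (x + 1 - g) - X k \<noteq> 0"
      unfolding X_def y_def[symmetric] s_mult_s[symmetric] by simp
  qed
  have f1: "f (- (x + 1) + g) = f (x + 1 - g)"
    using f_minus[of "x + 1 - g"] by (simp add: algebra_simps)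
  have f2: "f (- (x + 1)) = f (x + 1)" by (rule f_minus)
  have s2: "s (2 * - (x + 1)) = - s (2 * x + 2)"
    using s_minus[of "2 * x + 2"] by (simp add: algebra_simps)
  have h': "hop n g a b c d (\<lambda>k. f (pt n g a l' k)) j (- pt n g a l' j) =
     - (num4 (1 - a) (1 - b) (1 - c) (1 - d) x / s (2 * x + 2) * (\<Prod>k\<in>{1..n}-{j}. (f (x + 1 - g) - X k) / (f (x + 1) - X k)))"
    unfolding hop_def x' f1 f2 s2 num4_reflect using X' by simp
  define u where "u = (\<lambda>k. (f (x + g) - X k) * (f (x + 1) - X k) / ((f x - X k) * (f (x + 1 - g) - X k)))"
  have w: "weight n g a b c d l' = weight n g a b c d l * prod u ({1..n}-{j}) *
     (s (2 * x + 2) / s (2 * x) * (num4 a b c d x / num4 (1 - a) (1 - b) (1 - c) (1 - d) x))"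
    unfolding u_def x_def X_def l'_def by (rule weight_up[OF l j l'[unfolded l'_def]])
  have "prod u ({1..n}-{j}) * (\<Prod>k\<in>{1..n}-{j}. (f (x + 1 - g) - X k) / (f (x + 1) - X k)) =
      (\<Prod>k\<in>{1..n}-{j}. (f (x + g) - X k) / (f x - X k))"
    unfolding prod.distrib[symmetric] u_def using nz3 by (intro prod.cong refl) simp
  hence "weight n g a b c d l' * hop n g a b c d (\<lambda>k. f (pt n g a l' k)) j (- pt n g a l' j)
    = - (weight n g a b c d l * (num4 a b c d x / s (2 * x) * (\<Prod>k\<in>{1..n}-{j}. (f (x + g) - X k) / (f x - X k))))"
    unfolding w h' using nz1 nz2 by (simp add: mult_ac)
  thus ?thesis by (simp add: hop_def x_def X_def)
qed

text \<open>Summation by parts. The step up from \<open>l\<close> in row \<open>j\<close> cancels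
  the step down from its image, and steps out of the chamber have coefficient 0. The cut-off
  restricts only the first row, so just the steps with \<open>j = 1\<close> from the layer
  \<open>l 1 = L\<close> remain. The product over \<open>k\<close> other than \<open>j\<close> does
  not see the step.\<close>

lemma truncated_sum:
  fixes b c d Y :: complex
  assumes reg: "regular n g a b" "regular n g a c" "regular n g a d" and n: "n \<ge> 1"
  defines "X \<equiv> (\<lambda>l k. f (pt n g a l k))"
  shows "(\<Sum>l\<in>{l\<in>Lam n. l 1 \<le> L}. weight n g a b c d l *
      (\<Sum>j=1..n. (hop n g a b c d (X l) j (pt n g a l j) + hop n g a b c d (X l) j (- pt n g a l j)) *
         (\<Prod>k\<in>{1..n}-{j}. Y - X l k)))
    = (\<Sum>l\<in>{l\<in>Lam n. l 1 = L}. weight n g a b c d l * hop n g a b c d (X l) 1 (pt n g a l 1) *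
         (\<Prod>k\<in>{1..n}-{1}. Y - X l k))"
proof -
  define B where "B = {l\<in>Lam n. l 1 \<le> L}"
  define up where "up = (\<lambda>j l. weight n g a b c d l * hop n g a b c d (X l) j (pt n g a l j) * (\<Prod>k\<in>{1..n}-{j}. Y - X l k))"
  define dn where "dn = (\<lambda>j l. weight n g a b c d l * hop n g a b c d (X l) j (- pt n g a l j) * (\<Prod>k\<in>{1..n}-{j}. Y - X l k))"
  have fin: "finite B"
  proof (rule finite_subset[OF _ finite_Lam_bounded])
    show "B \<subseteq> {l \<in> Lam n. \<forall>j\<in>{1..n}. l j \<le> L}"
      unfolding B_def by (auto intro: order_trans[OF LamD[of _ n 1]])
  qed
  have step: "(\<Sum>l\<in>B. up j l) + (\<Sum>l\<in>B. dn j l) = (if j = 1 then \<Sum>l\<in>{l\<in>Lam n. l 1 = L}. up 1 l else 0)"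
    if j: "j \<in> {1..n}" for j
  proof -
    \<comment> \<open>The configurations whose step up in row \<open>j\<close> stays in the box;
      reindexing the downward sum by them turns it into minus the upward sum.\<close>
    define B1 where "B1 = {l \<in> B. l(j := Suc (l j)) \<in> B}"
    have "(\<Sum>l\<in>B. dn j l) = (\<Sum>l\<in>{l\<in>B. l j \<noteq> 0 \<and> l(j := l j - 1) \<in> Lam n}. dn j l)"
      using fin hop_down_eq_0[OF _ j] by (intro sum.mono_neutral_right) (auto simp: dn_def X_def B_def)
    also have "\<dots> = (\<Sum>l\<in>B1. dn j (l(j := Suc (l j))))"
    proof (rule sum.reindex_bij_witness[of _ "\<lambda>l. l(j := Suc (l j))" "\<lambda>l. l(j := l j - 1)"])
      fix l assume "l \<in> {l\<in>B. l j \<noteq> 0 \<and> l(j := l j - 1) \<in> Lam n}"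
      thus "l(j := l j - 1) \<in> B1" by (auto simp: B1_def B_def)
    qed (auto simp: B1_def B_def)
    also have "\<dots> = (\<Sum>l\<in>B1. - up j l)"
    proof (intro sum.cong refl)
      fix l assume l: "l \<in> B1"
      have "(\<Prod>k\<in>{1..n}-{j}. Y - X (l(j := Suc (l j))) k) = (\<Prod>k\<in>{1..n}-{j}. Y - X l k)"
        by (intro prod.cong refl) (auto simp: X_def pt_def)
      thus "dn j (l(j := Suc (l j))) = - up j l"
        using detailed_balance[OF reg, of l j] l j unfolding dn_def up_def B1_def B_def X_def by simp
    qed
    finally have "(\<Sum>l\<in>B. up j l) + (\<Sum>l\<in>B. dn j l) = (\<Sum>l\<in>B. up j l) - (\<Sum>l\<in>B1. up j l)"
      by (simp add: sum_negf)
    also have "\<dots> = (\<Sum>l\<in>B-B1. up j l)"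
      using fin by (subst sum_diff) (auto simp: B1_def)
    also have "\<dots> = (if j = 1 then \<Sum>l\<in>{l\<in>Lam n. l 1 = L}. up 1 l else 0)"
    proof (cases "j = 1")
      case True
      have "B - B1 = {l\<in>Lam n. l 1 = L}"
      proof (intro equalityI subsetI)
        fix l assume l: "l \<in> B - B1"
        hence "l(1 := Suc (l 1)) \<in> Lam n" using Lam_upI[of l n 1] n by (auto simp: B_def)
        with l show "l \<in> {l \<in> Lam n. l 1 = L}" by (auto simp: B_def B1_def True)
      qed (auto simp: B_def B1_def True)
      thus ?thesis using True by simp
    next
      case False
      have "up j l = 0" if "l \<in> B - B1" for l
        using that False hop_up_eq_0[of l n j] j by (auto simp: B_def B1_def up_def X_def)
      thus ?thesis using False by simp
    qed
    finally show ?thesis .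
  qed
  have "(\<Sum>l\<in>B. weight n g a b c d l *
      (\<Sum>j=1..n. (hop n g a b c d (X l) j (pt n g a l j) + hop n g a b c d (X l) j (- pt n g a l j)) *
         (\<Prod>k\<in>{1..n}-{j}. Y - X l k))) = (\<Sum>l\<in>B. \<Sum>j=1..n. up j l + dn j l)"
    unfolding sum_distrib_left up_def dn_def by (intro sum.cong refl) (simp add: algebra_simps)
  also have "\<dots> = (\<Sum>j=1..n. (\<Sum>l\<in>B. up j l) + (\<Sum>l\<in>B. dn j l))"
    by (subst sum.swap) (simp add: sum.distrib)
  also have "\<dots> = (\<Sum>j=1..n. if j = 1 then \<Sum>l\<in>{l\<in>Lam n. l 1 = L}. up 1 l else 0)"
    by (intro sum.cong refl step)
  also have "\<dots> = (\<Sum>l\<in>{l\<in>Lam n. l 1 = L}. up 1 l)" using n by simp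
  finally show ?thesis unfolding B_def up_def .
qed

end

end

section \<open>Growth of the weights\<close>

text \<open>
  \<open>e m\<close> is the order of growth of \<open>s (x + m)\<close>: \<open>q\<^bsup>-m/2\<^esup>\<close> or \<open>1 + m\<close>. As \<open>s (2 x + 2 m)\<close> grows like \<open>e m\<^sup>2\<close> in
  the first case but like \<open>e m\<close> in the second, it is compared with \<open>e m\<^sup>2 / \<omega> m\<close>, where \<open>\<omega>\<close> is \<open>1\<close> or \<open>e\<close>.
\<close>
locale sfun_growth = sfun +
  fixes e \<omega> :: "nat \<Rightarrow> real"
  assumes e_ge_1: "e m \<ge> 1"
    and e_mult_le: "k \<le> m \<Longrightarrow> e (m + k) * e (m - k) \<le> e m ^ 2"
    and \<omega>_pos: "\<omega> m > 0"
    and continuous_s: "continuous_on UNIV s"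
    and s_upper: "(\<alpha> \<longlongrightarrow> \<alpha>0) sequentially \<Longrightarrow>
        \<exists>C. \<forall>\<^sub>F k in sequentially. \<forall>m. norm (s (\<alpha> k + of_nat m)) \<le> C * e m"
    and s2_upper: "(\<alpha> \<longlongrightarrow> \<alpha>0) sequentially \<Longrightarrow>
        \<exists>C. \<forall>\<^sub>F k in sequentially. \<forall>m. norm (s (\<alpha> k + 2 * of_nat m)) \<le> C * (e m ^ 2 / \<omega> m)"
    and s_lower: "(\<And>m::nat. s (\<alpha>0 + of_nat m) \<noteq> 0) \<Longrightarrow> \<exists>C>0. \<forall>m. e m \<le> C * norm (s (\<alpha>0 + of_nat m))"
    and s2_lower: "(\<And>m::nat. s (\<alpha>0 + 2 * of_nat m) \<noteq> 0) \<Longrightarrow>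
        \<exists>C>0. \<forall>m. e m ^ 2 / \<omega> m \<le> C * norm (s (\<alpha>0 + 2 * of_nat m))"
    and s_ratio: "(\<alpha> \<longlongrightarrow> \<alpha>0) sequentially \<Longrightarrow> (\<beta> \<longlongrightarrow> \<beta>0) sequentially \<Longrightarrow> Re (\<alpha>0 - \<beta>0) < c \<Longrightarrow>
        \<exists>i0. \<forall>\<^sub>F k in sequentially. \<forall>i\<ge>i0. norm (s (\<alpha> k + of_nat i)) \<le> norm (s (\<beta> k + of_nat i)) * (e (Suc i) / e i) powr c"
    and s_far_ratio: "\<exists>i0. \<forall>\<^sub>F M in sequentially. \<forall>i\<ge>i0.
        norm (s (x - u - of_nat M + of_nat i)) \<le> norm (s (1 + x + u + of_nat M + of_nat i))"
    and s_far_limit: "\<exists>L. \<forall>u. (\<lambda>M. s (x - u - of_nat M) / s (1 + x + u + of_nat M)) \<longlonglongrightarrow> L"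
    and summable_e: "\<eta> < 0 \<Longrightarrow> summable (\<lambda>m. e m powr \<eta> / \<omega> m)"
    and e_powr_tendsto_0: "\<eta> < 0 \<Longrightarrow> (\<lambda>m. e m powr \<eta>) \<longlonglongrightarrow> 0"
begin

lemma e_pos: "e m > 0" using e_ge_1[of m] by linarith

lemma tendsto_s: "(h \<longlongrightarrow> L) F \<Longrightarrow> ((\<lambda>x. s (h x)) \<longlongrightarrow> s L) F"
  by (rule continuous_on_tendsto_compose[OF continuous_s]) auto

lemma s_upper_const: "\<exists>C\<ge>0. \<forall>m. norm (s (\<alpha> + of_nat m)) \<le> C * e m"
proof -
  obtain C where C: "\<And>m. norm (s (\<alpha> + of_nat m)) \<le> C * e m"
    using s_upper[OF tendsto_const[of \<alpha>]] by (auto simp: eventually_sequentially)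
  moreover have "C \<ge> 0" using C[of 0] e_pos[of 0] norm_ge_zero[of "s (\<alpha> + of_nat 0)"]
    by (metis order_trans zero_le_mult_iff not_less)
  ultimately show ?thesis by blast
qed

lemma f_upper: "\<exists>C\<ge>0. \<forall>m. B + norm (f (\<alpha> + of_nat m)) \<le> C * e m ^ 2"
proof -
  obtain C where C: "C \<ge> 0" "\<And>m. norm (s (\<alpha> + of_nat m)) \<le> C * e m" using s_upper_const by blast
  have "B + norm (f (\<alpha> + of_nat m)) \<le> (\<bar>B\<bar> + norm (f 0) + C\<^sup>2) * e m ^ 2" for m
  proof -
    define z where "z = \<alpha> + of_nat m"
    have "f z = f 0 + s z * s z" using s_mult_s[of z 0] by simp
    hence "norm (f z) \<le> norm (f 0) + norm (s z) ^ 2"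
      by (metis norm_triangle_ineq norm_mult power2_eq_square)
    also have "norm (s z) ^ 2 \<le> (C * e m)\<^sup>2"
      using C(2)[of m] unfolding z_def by (intro power_mono) auto
    finally have "B + norm (f z) \<le> \<bar>B\<bar> + norm (f 0) + C\<^sup>2 * e m ^ 2"
      by (simp add: power_mult_distrib)
    moreover have "(\<bar>B\<bar> + norm (f 0)) * 1 \<le> (\<bar>B\<bar> + norm (f 0)) * e m ^ 2"
      using e_ge_1[of m] by (intro mult_left_mono) (auto simp: one_le_power)
    ultimately show ?thesis by (simp add: z_def algebra_simps)
  qed
  thus ?thesis by (intro exI[of _ "\<bar>B\<bar> + norm (f 0) + C\<^sup>2"]) auto
qed

text \<open>From \<open>i0\<close> on the factors are bounded by quotients that telescope to
  \<open>(e m / e i0) powr c\<close>; the finitely many earlier ones are bounded through their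
  limits. The constant serves all \<open>m\<close> and all late \<open>k\<close>.\<close>

lemma prod_ratio_bound:
  fixes r :: "nat \<Rightarrow> nat \<Rightarrow> complex"
  assumes far: "\<forall>\<^sub>F k in sequentially. \<forall>i\<ge>i0. norm (r k i) \<le> (e (Suc i) / e i) powr c"
    and lim: "\<And>i. \<exists>L. (\<lambda>k. r k i) \<longlonglongrightarrow> L"
  shows "\<exists>C\<ge>0. \<forall>\<^sub>F k in sequentially. \<forall>m. norm (\<Prod>i<m. r k i) \<le> C * e m powr c"
proof -
  obtain L where L: "\<And>i. (\<lambda>k. r k i) \<longlonglongrightarrow> L i" using lim by metis
  define R where "R = (\<lambda>i. norm (L i) + 1)"
  \<comment> \<open>Absorbs \<open>e i1 powr (- c)\<close> for every \<open>i1\<close> up to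
    \<open>i0\<close>, whatever the sign of \<open>c\<close>: a sum of nonnegative terms dominates
    each of them.\<close>
  define K where "K = (\<Sum>m\<le>i0. e m powr (- c))"
  define C where "C = (\<Prod>i<i0. R i) * K"
  have K: "e m powr (- c) \<le> K" if "m \<le> i0" for m
    unfolding K_def using that by (intro member_le_sum) auto
  have R1: "R i \<ge> 1" for i by (simp add: R_def)
  have R0: "(\<Prod>i<i0. R i) \<ge> 0" using R1 by (intro prod_nonneg) (auto intro: order.trans[OF _ R1])
  have "\<forall>\<^sub>F k in sequentially. \<forall>i\<in>{..<i0}. norm (r k i) < R i"
    using L by (intro eventually_ball_finite ballI order_tendstoD(2)[OF tendsto_norm[OF L]]) (auto simp: R_def)
  with far have "\<forall>\<^sub>F k in sequentially. \<forall>m. norm (\<Prod>i<m. r k i) \<le> C * e m powr c"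
  proof eventually_elim
    case (elim k)
    have small: "norm (\<Prod>i<m. r k i) \<le> (\<Prod>i<i0. R i)" if "m \<le> i0" for m
    proof -
      have "norm (\<Prod>i<m. r k i) \<le> (\<Prod>i<m. R i)"
        unfolding prod_norm[symmetric] using elim that by (intro prod_mono) (auto intro: less_imp_le)
      also have "\<dots> \<le> (\<Prod>i<i0. R i)"
        using that R1 by (intro prod_mono2) (auto intro: order.trans[OF _ R1])
      finally show ?thesis .
    qed
    have C1: "(\<Prod>i<i0. R i) * (e m / e i1) powr c \<le> C * e m powr c" if "i1 \<le> i0" for m i1
    proof -
      have "(e m / e i1) powr c = e i1 powr (- c) * e m powr c"
        using e_pos[of m] e_pos[of i1] by (simp add: powr_divide powr_minus field_simps)
      also have "\<dots> \<le> K * e m powr c" using K[OF that] by (intro mult_right_mono) auto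
      finally show ?thesis unfolding C_def using R0 by (metis mult.assoc mult_left_mono)
    qed
    show ?case
    proof
      fix m
      show "norm (\<Prod>i<m. r k i) \<le> C * e m powr c"
      proof (cases "m \<le> i0")
        case True
        have "(e m / e m) powr c = 1" using e_pos[of m] by simp
        thus ?thesis using small[OF True] C1[OF True, of m] by simp
      next
        case False
        hence "i0 \<le> m" by simp
        hence "norm (\<Prod>i<m. r k i) \<le> (\<Prod>i<i0. R i) * (e m / e i0) powr c"
        proof (induction m rule: dec_induct)
          case base
          thus ?case using small[of i0] e_pos[of i0] by simp
        next
          case (step j)
          have "norm (\<Prod>i<Suc j. r k i) = norm (\<Prod>i<j. r k i) * norm (r k j)" by (simp add: norm_mult)
          also have "\<dots> \<le> ((\<Prod>i<i0. R i) * (e j / e i0) powr c) * (e (Suc j) / e j) powr c"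
            using step elim R0 by (intro mult_mono) auto
          also have "\<dots> = (\<Prod>i<i0. R i) * ((e j / e i0) * (e (Suc j) / e j)) powr c"
            using e_pos by (subst powr_mult) (auto simp: less_imp_le)
          also have "(e j / e i0) * (e (Suc j) / e j) = e (Suc j) / e i0"
            using e_pos[of j] by simp
          finally show ?case .
        qed
        thus ?thesis using C1[of i0 m] by simp
      qed
    qed
  qed
  moreover have "C \<ge> 0" unfolding C_def K_def using R0 by (intro mult_nonneg_nonneg sum_nonneg) auto
  ultimately show ?thesis by blast
qed

lemma sp_ratio: "sp x m / sp y m = (\<Prod>i<m. s (x + of_nat i) / s (y + of_nat i))"
  by (simp add: sp_def prod_dividef)

lemma sp_ratio_bound:
  assumes "\<alpha> \<longlonglongrightarrow> \<alpha>0" "\<beta> \<longlonglongrightarrow> \<beta>0" "\<And>i::nat. s (\<beta>0 + of_nat i) \<noteq> 0" "Re (\<alpha>0 - \<beta>0) < c"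
  shows "\<exists>C\<ge>0. \<forall>\<^sub>F k in sequentially. \<forall>m. norm (sp (\<alpha> k) m / sp (\<beta> k) m) \<le> C * e m powr c"
proof -
  obtain i0 where i0: "\<forall>\<^sub>F k in sequentially. \<forall>i\<ge>i0. norm (s (\<alpha> k + of_nat i)) \<le> norm (s (\<beta> k + of_nat i)) * (e (Suc i) / e i) powr c"
    using s_ratio[OF assms(1,2,4)] by blast
  show ?thesis unfolding sp_ratio
  proof (rule prod_ratio_bound[where ?i0.0 = i0])
    show "\<forall>\<^sub>F k in sequentially. \<forall>i\<ge>i0. norm (s (\<alpha> k + of_nat i) / s (\<beta> k + of_nat i)) \<le> (e (Suc i) / e i) powr c"
      using i0
    proof eventually_elim
      case (elim k)
      show ?case
      proof (intro allI impI)
        fix i assume "i \<ge> i0"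
        thus "norm (s (\<alpha> k + of_nat i) / s (\<beta> k + of_nat i)) \<le> (e (Suc i) / e i) powr c"
          using elim by (cases "s (\<beta> k + of_nat i) = 0") (auto simp: norm_divide divide_le_eq mult.commute)
      qed
    qed
    show "\<exists>L. (\<lambda>k. s (\<alpha> k + of_nat i) / s (\<beta> k + of_nat i)) \<longlonglongrightarrow> L" for i
      using assms by (intro exI[of _ "s (\<alpha>0 + of_nat i) / s (\<beta>0 + of_nat i)"] tendsto_divide tendsto_s tendsto_add tendsto_const) auto
  qed
qed

text \<open>As \<open>M\<close> grows, each factor from a fixed index on is at most 1 in norm, so
  the exponent is 0. It is written as \<open>powr 0\<close> to fit
  \<open>prod_ratio_bound\<close>.\<close>

lemma sp_far_bound:
  "\<exists>C\<ge>0. \<forall>\<^sub>F M in sequentially. \<forall>m. norm (sp (x - u - of_nat M) m / sp (1 + x + u + of_nat M) m) \<le> C * e m powr 0"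
proof -
  obtain i0 where i0: "\<forall>\<^sub>F M in sequentially. \<forall>i\<ge>i0. norm (s (x - u - of_nat M + of_nat i)) \<le> norm (s (1 + x + u + of_nat M + of_nat i))"
    using s_far_ratio by blast
  show ?thesis unfolding sp_ratio
  proof (rule prod_ratio_bound[where ?i0.0 = i0])
    show "\<forall>\<^sub>F M in sequentially. \<forall>i\<ge>i0. norm (s (x - u - of_nat M + of_nat i) / s (1 + x + u + of_nat M + of_nat i)) \<le> (e (Suc i) / e i) powr 0"
      using i0
    proof eventually_elim
      case (elim M)
      show ?case
      proof (intro allI impI)
        fix i assume "i \<ge> i0"
        moreover have "(e (Suc i) / e i) powr 0 = 1" using e_pos[of i] e_pos[of "Suc i"] by simp
        ultimately show "norm (s (x - u - of_nat M + of_nat i) / s (1 + x + u + of_nat M + of_nat i)) \<le> (e (Suc i) / e i) powr 0"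
          using elim by (cases "s (1 + x + u + of_nat M + of_nat i) = 0") (auto simp: norm_divide divide_le_eq)
      qed
    qed
    show "\<exists>L. (\<lambda>M. s (x - u - of_nat M + of_nat i) / s (1 + x + u + of_nat M + of_nat i)) \<longlonglongrightarrow> L" for i
    proof -
      obtain L where "\<And>u. (\<lambda>M. s (x + of_nat i - u - of_nat M) / s (1 + (x + of_nat i) + u + of_nat M)) \<longlonglongrightarrow> L"
        using s_far_limit[of "x + of_nat i"] by blast
      from this[of u] show ?thesis by (intro exI[of _ L]) (simp add: algebra_simps)
    qed
  qed
qed

text \<open>The quotient of shifted factorials has exponent \<open>2 Re g - 1\<close>, and the
  factor \<open>s (x + m)\<close> raises it by one. Uniformity along the sequence is paid for by the
  strict inequality.\<close>

lemma pair_factor_bound: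
  assumes "g \<longlonglongrightarrow> g0" "x \<longlonglongrightarrow> x0" "s x0 \<noteq> 0" "\<And>i::nat. s (1 - g0 + x0 + of_nat i) \<noteq> 0" "2 * Re g0 < \<gamma>"
  shows "\<exists>C\<ge>0. \<forall>\<^sub>F k in sequentially. \<forall>m. norm (pair_factor (g k) (x k) m) \<le> C * e m powr \<gamma>"
proof -
  have "\<exists>C\<ge>0. \<forall>\<^sub>F k in sequentially. \<forall>m. norm (sp (g k + x k) m / sp (1 - g k + x k) m) \<le> C * e m powr (\<gamma> - 1)"
    using assms by (intro sp_ratio_bound[where ?\<alpha>0.0 = "g0 + x0" and ?\<beta>0.0 = "1 - g0 + x0"] tendsto_intros) auto
  then obtain C where C: "C \<ge> 0" "\<forall>\<^sub>F k in sequentially. \<forall>m. norm (sp (g k + x k) m / sp (1 - g k + x k) m) \<le> C * e m powr (\<gamma> - 1)"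
    by blast
  obtain D where D: "\<forall>\<^sub>F k in sequentially. \<forall>m. norm (s (x k + of_nat m)) \<le> D * e m"
    using s_upper[OF assms(2)] by blast
  define \<nu> where "\<nu> = norm (s x0) / 2"
  have \<nu>: "\<nu> > 0" "\<nu> < norm (s x0)" using assms(3) by (auto simp: \<nu>_def)
  have "\<forall>\<^sub>F k in sequentially. \<nu> < norm (s (x k))"
    using \<nu> by (intro order_tendstoD(1)[OF tendsto_norm[OF tendsto_s[OF assms(2)]]]) auto
  with C(2) D have "\<forall>\<^sub>F k in sequentially. \<forall>m. norm (pair_factor (g k) (x k) m) \<le> (\<bar>D\<bar> / \<nu> * C) * e m powr \<gamma>"
  proof eventually_elim
    case (elim k)
    show ?case
    proof
      fix m
      have "norm (s (x k + of_nat m) / s (x k)) \<le> (\<bar>D\<bar> * e m) / \<nu>"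
        unfolding norm_divide using elim \<nu> e_pos[of m]
        by (intro frac_le) (auto intro: order.trans[OF spec[OF elim(2)]] mult_right_mono)
      hence "norm (pair_factor (g k) (x k) m) \<le> (\<bar>D\<bar> * e m / \<nu>) * (C * e m powr (\<gamma> - 1))"
        unfolding pair_factor_def norm_mult using elim \<nu> e_pos[of m] by (intro mult_mono) (auto intro: divide_nonneg_nonneg)
      also have "e m powr \<gamma> = e m * e m powr (\<gamma> - 1)"
        using e_pos[of m] by (simp add: powr_diff)
      hence "(\<bar>D\<bar> * e m / \<nu>) * (C * e m powr (\<gamma> - 1)) = (\<bar>D\<bar> / \<nu> * C) * e m powr \<gamma>"
        by simp
      finally show "norm (pair_factor (g k) (x k) m) \<le> (\<bar>D\<bar> / \<nu> * C) * e m powr \<gamma>" .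
    qed
  qed
  thus ?thesis using \<nu> C by (intro exI[of _ "\<bar>D\<bar> / \<nu> * C"]) auto
qed

lemma single_factor_bound:
  assumes "v \<longlonglongrightarrow> v0" "x \<longlonglongrightarrow> x0" "\<And>i::nat. s (1 - v0 + x0 + of_nat i) \<noteq> 0" "2 * Re v0 - 1 < c"
  shows "\<exists>C\<ge>0. \<forall>\<^sub>F k in sequentially. \<forall>m. norm (single_factor (v k) (x k) m) \<le> C * e m powr c"
  unfolding single_factor_def
  using assms by (intro sp_ratio_bound[where ?\<alpha>0.0 = "v0 + x0" and ?\<beta>0.0 = "1 - v0 + x0"] tendsto_intros) auto

lemma double_factor_bound:
  assumes "x \<longlonglongrightarrow> x0" "s (2 * x0) \<noteq> 0"
  shows "\<exists>C\<ge>0. \<forall>\<^sub>F k in sequentially. \<forall>m. norm (s (2 * x k + 2 * of_nat m) / s (2 * x k)) \<le> C * (e m powr 2 / \<omega> m)"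
proof -
  have lim: "(\<lambda>k. 2 * x k) \<longlonglongrightarrow> 2 * x0" using assms by (intro tendsto_intros)
  obtain D where D: "\<forall>\<^sub>F k in sequentially. \<forall>m. norm (s (2 * x k + 2 * of_nat m)) \<le> D * (e m ^ 2 / \<omega> m)"
    using s2_upper[OF lim] by blast
  define \<nu> where "\<nu> = norm (s (2 * x0)) / 2"
  have \<nu>: "\<nu> > 0" "\<nu> < norm (s (2 * x0))" using assms(2) by (auto simp: \<nu>_def)
  have "\<forall>\<^sub>F k in sequentially. \<nu> < norm (s (2 * x k))"
    using \<nu> by (intro order_tendstoD(1)[OF tendsto_norm[OF tendsto_s[OF lim]]]) auto
  with D have "\<forall>\<^sub>F k in sequentially. \<forall>m. norm (s (2 * x k + 2 * of_nat m) / s (2 * x k)) \<le> (\<bar>D\<bar> / \<nu>) * (e m powr 2 / \<omega> m)"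
  proof eventually_elim
    case (elim k)
    show ?case
    proof
      fix m
      have p: "e m powr 2 = e m ^ 2" using e_pos[of m] by (simp add: powr_numeral)
      have "D * (e m ^ 2 / \<omega> m) \<le> \<bar>D\<bar> * (e m ^ 2 / \<omega> m)"
        using \<omega>_pos[of m] by (intro mult_right_mono) auto
      hence "norm (s (2 * x k + 2 * of_nat m) / s (2 * x k)) \<le> (\<bar>D\<bar> * (e m ^ 2 / \<omega> m)) / \<nu>"
        unfolding norm_divide using elim \<nu> \<omega>_pos[of m] by (intro frac_le) (auto intro: order.trans less_imp_le)
      thus "norm (s (2 * x k + 2 * of_nat m) / s (2 * x k)) \<le> (\<bar>D\<bar> / \<nu>) * (e m powr 2 / \<omega> m)"
        by (simp add: p mult.commute)
    qed
  qed
  thus ?thesis using \<nu> by (intro exI[of _ "\<bar>D\<bar> / \<nu>"]) auto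
qed

text \<open>Both factors of a pair are charged to its larger coordinate by \<open>e_mult_le\<close>.
  This requires a nonnegative exponent, hence the positive part of \<open>Re g\<close> later
  on.\<close>

lemma pairs_e_bound:
  assumes l: "l \<in> Lam n" and \<gamma>: "\<gamma> \<ge> 0" and n: "n \<ge> 1"
  shows "(\<Prod>j=1..n. \<Prod>k\<in>{j<..n}. e (l j + l k) powr \<gamma> * e (l j - l k) powr \<gamma>)
    \<le> (\<Prod>j=1..n. e (l j) powr (2 * \<gamma> * real (n - 1)))"
proof (intro prod_mono conjI prod_nonneg)
  fix j assume j: "j \<in> {1..n}"
  have "(\<Prod>k\<in>{j<..n}. e (l j + l k) powr \<gamma> * e (l j - l k) powr \<gamma>) \<le> (\<Prod>k\<in>{j<..n}. e (l j) powr (2 * \<gamma>))"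
  proof (intro prod_mono conjI)
    fix k assume k: "k \<in> {j<..n}"
    hence "l k \<le> l j" using LamD[OF l, of j k] j by auto
    have "e (l j + l k) powr \<gamma> * e (l j - l k) powr \<gamma> = (e (l j + l k) * e (l j - l k)) powr \<gamma>"
      using e_pos by (subst powr_mult) (auto simp: less_imp_le)
    also have "\<dots> \<le> (e (l j) ^ 2) powr \<gamma>"
      using \<open>l k \<le> l j\<close> e_pos \<gamma> by (intro powr_mono2 e_mult_le) (auto simp: less_imp_le)
    also have "\<dots> = e (l j) powr (2 * \<gamma>)"
      using e_pos[of "l j"] by (simp add: powr_powr[symmetric] powr_numeral)
    finally show "e (l j + l k) powr \<gamma> * e (l j - l k) powr \<gamma> \<le> e (l j) powr (2 * \<gamma>)" .
  qed auto
  also have "\<dots> = e (l j) powr (2 * \<gamma> * real (n - j))"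
    using e_pos[of "l j"] by (simp add: powr_power mult.commute)
  also have "\<dots> \<le> e (l j) powr (2 * \<gamma> * real (n - 1))"
    using \<gamma> e_ge_1[of "l j"] j by (intro powr_mono mult_left_mono) auto
  finally show "(\<Prod>k\<in>{j<..n}. e (l j + l k) powr \<gamma> * e (l j - l k) powr \<gamma>) \<le> e (l j) powr (2 * \<gamma> * real (n - 1))" .
qed auto

text \<open>Covers only the denominators of \<open>weight\<close> that come from pairs or from
  \<open>s (2 * rh n g a j)\<close>. Unlike \<open>strongly_generic\<close> it follows from the
  genericity in the theorem, so the final limit can be taken under it.\<close>

definition admissible :: "nat \<Rightarrow> complex \<Rightarrow> complex \<Rightarrow> bool" where
  "admissible n g a \<longleftrightarrow>
     (\<forall>j\<in>{1..n}. s (2 * rh n g a j) \<noteq> 0 \<and>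
       (\<forall>k\<in>{j<..n}. s (rh n g a j + rh n g a k) \<noteq> 0 \<and> s (rh n g a j - rh n g a k) \<noteq> 0 \<and>
          (\<forall>i::nat. s (1 - g + (rh n g a j + rh n g a k) + of_nat i) \<noteq> 0 \<and>
                    s (1 - g + (rh n g a j - rh n g a k) + of_nat i) \<noteq> 0)))"

lemma tendsto_rh: "g \<longlonglongrightarrow> g0 \<Longrightarrow> a \<longlonglongrightarrow> a0 \<Longrightarrow> (\<lambda>k. rh n (g k) (a k) j) \<longlonglongrightarrow> rh n g0 a0 j"
  unfolding rh_def by (intro tendsto_intros)

text \<open>\<open>\<kappa>0\<close> is the growth exponent of the factor with \<open>b\<close>:
  \<open>2 Re b - 1\<close> for fixed \<open>b\<close>, and 0 along \<open>b - M\<close>.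
  \<open>\<tau>\<close> reserves extra decay per coordinate, to pay for multiplication by values of
  \<open>f\<close>.\<close>

lemma weight_dominated:
  fixes g a b :: "nat \<Rightarrow> complex" and c d g0 a0 :: complex and \<kappa>0 \<tau> :: real
  assumes n: "n \<ge> 1" and g: "g \<longlonglongrightarrow> g0" and a: "a \<longlonglongrightarrow> a0"
    and adm: "admissible n g0 a0"
    and reg: "regular n g0 a0 a0" "regular n g0 a0 c" "regular n g0 a0 d"
    and b: "\<And>\<kappa> j. \<kappa> > \<kappa>0 \<Longrightarrow> j \<in> {1..n} \<Longrightarrow>
       \<exists>C\<ge>0. \<forall>\<^sub>F k in sequentially. \<forall>m. norm (single_factor (b k) (rh n (g k) (a k) j) m) \<le> C * e m powr \<kappa>"
    and conv: "\<And>j. j \<in> {1..n} \<Longrightarrow> 4 * real (n - j) * Re g0 + 2 * Re (a0 + c + d) + \<kappa>0 + \<tau> - 1 < 0"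
  shows "\<exists>C \<eta>. C \<ge> 0 \<and> \<eta> < 0 \<and> (\<forall>\<^sub>F k in sequentially. \<forall>l\<in>Lam n.
     norm (weight n (g k) (a k) (b k) c d l) \<le> C * (\<Prod>j=1..n. e (l j) powr (\<eta> - \<tau>) / \<omega> (l j)))"
proof -
  \<comment> \<open>The hypothesis at \<open>j = 1\<close> covers positive \<open>Re g0\<close>, the
    one at \<open>j = n\<close> the other sign.\<close>
  define gp where "gp = max (Re g0) 0"
  define \<mu> where "\<mu> = 4 * real (n - 1) * gp + 2 * Re (a0 + c + d) + \<kappa>0 + \<tau> - 1"
  have \<mu>: "\<mu> < 0" using conv[of 1] conv[of n] n by (auto simp: \<mu>_def gp_def max_def)
  \<comment> \<open>\<open>\<delta>\<close> is spent \<open>2 n + 2\<close> times: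
    \<open>2 (n - 1)\<close> times in the pair exponents and once for each of the four single
    factors. Half of \<open>\<mu>\<close> remains as decay.\<close>
  define \<delta> where "\<delta> = - \<mu> / (2 * (2 * real n + 2))"
  have \<delta>: "\<delta> > 0" unfolding \<delta>_def using \<mu> by (intro divide_pos_pos) auto
  define \<gamma> where "\<gamma> = 2 * gp + \<delta>"
  have \<gamma>: "\<gamma> \<ge> 0" "2 * Re g0 < \<gamma>" using \<delta> by (auto simp: \<gamma>_def gp_def)
  define r where "r = (\<lambda>k. rh n (g k) (a k))"
  define r0 where "r0 = rh n g0 a0"
  have rk: "rh n (g k) (a k) = r k" for k by (simp add: r_def)
  have r: "(\<lambda>k. r k j) \<longlonglongrightarrow> r0 j" for j unfolding r_def r0_def by (rule tendsto_rh[OF g a])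
  have adm1: "s (2 * r0 i) \<noteq> 0" if "i \<in> {1..n}" for i
    using adm that unfolding admissible_def r0_def by blast
  have adm': "s (r0 i + r0 j) \<noteq> 0" "s (r0 i - r0 j) \<noteq> 0"
     "s (1 - g0 + (r0 i + r0 j) + of_nat N) \<noteq> 0" "s (1 - g0 + (r0 i - r0 j) + of_nat N) \<noteq> 0"
    if "i \<in> {1..n}" "j \<in> {i<..n}" for i j N
    using adm that unfolding admissible_def r0_def by blast+
  have HCp: "\<exists>C\<ge>0. \<forall>\<^sub>F k in sequentially. \<forall>m. norm (pair_factor (g k) (r k i + r k j) m) \<le> C * e m powr \<gamma>"
    if "i \<in> {1..n}" "j \<in> {i<..n}" for i j
    by (rule pair_factor_bound[OF g tendsto_add[OF r r] adm'(1)[OF that] adm'(3)[OF that] \<gamma>(2)])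
  define Cp where "Cp = (\<lambda>i j. SOME C. C \<ge> 0 \<and> (\<forall>\<^sub>F k in sequentially. \<forall>m. norm (pair_factor (g k) (r k i + r k j) m) \<le> C * e m powr \<gamma>))"
  have Cp: "Cp i j \<ge> 0 \<and> (\<forall>\<^sub>F k in sequentially. \<forall>m. norm (pair_factor (g k) (r k i + r k j) m) \<le> Cp i j * e m powr \<gamma>)"
    if "i \<in> {1..n}" "j \<in> {i<..n}" for i j
    unfolding Cp_def by (rule someI_ex[OF HCp[OF that]])
  have HCm: "\<exists>C\<ge>0. \<forall>\<^sub>F k in sequentially. \<forall>m. norm (pair_factor (g k) (r k i - r k j) m) \<le> C * e m powr \<gamma>"
    if "i \<in> {1..n}" "j \<in> {i<..n}" for i j
    by (rule pair_factor_bound[OF g tendsto_diff[OF r r] adm'(2)[OF that] adm'(4)[OF that] \<gamma>(2)])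
  define Cm where "Cm = (\<lambda>i j. SOME C. C \<ge> 0 \<and> (\<forall>\<^sub>F k in sequentially. \<forall>m. norm (pair_factor (g k) (r k i - r k j) m) \<le> C * e m powr \<gamma>))"
  have Cm: "Cm i j \<ge> 0 \<and> (\<forall>\<^sub>F k in sequentially. \<forall>m. norm (pair_factor (g k) (r k i - r k j) m) \<le> Cm i j * e m powr \<gamma>)"
    if "i \<in> {1..n}" "j \<in> {i<..n}" for i j
    unfolding Cm_def by (rule someI_ex[OF HCm[OF that]])
  have HC2: "\<exists>C\<ge>0. \<forall>\<^sub>F k in sequentially. \<forall>m. norm (s (2 * r k j + 2 * of_nat m) / s (2 * r k j)) \<le> C * (e m powr 2 / \<omega> m)"
    if "j \<in> {1..n}" for j
    by (rule double_factor_bound[OF r adm1[OF that]])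
  define C2 where "C2 = (\<lambda>j. SOME C. C \<ge> 0 \<and> (\<forall>\<^sub>F k in sequentially. \<forall>m. norm (s (2 * r k j + 2 * of_nat m) / s (2 * r k j)) \<le> C * (e m powr 2 / \<omega> m)))"
  have C2: "C2 j \<ge> 0 \<and> (\<forall>\<^sub>F k in sequentially. \<forall>m. norm (s (2 * r k j + 2 * of_nat m) / s (2 * r k j)) \<le> C2 j * (e m powr 2 / \<omega> m))"
    if "j \<in> {1..n}" for j
    unfolding C2_def by (rule someI_ex[OF HC2[OF that]])
  have HCa: "\<exists>C\<ge>0. \<forall>\<^sub>F k in sequentially. \<forall>m. norm (single_factor (a k) (r k j) m) \<le> C * e m powr (2 * Re a0 - 1 + \<delta>)"
    if "j \<in> {1..n}" for j
    by (rule single_factor_bound[OF a r regularD[OF reg(1) that, folded r0_def]]) (use \<delta> in simp)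
  define Ca where "Ca = (\<lambda>j. SOME C. C \<ge> 0 \<and> (\<forall>\<^sub>F k in sequentially. \<forall>m. norm (single_factor (a k) (r k j) m) \<le> C * e m powr (2 * Re a0 - 1 + \<delta>)))"
  have Ca: "Ca j \<ge> 0 \<and> (\<forall>\<^sub>F k in sequentially. \<forall>m. norm (single_factor (a k) (r k j) m) \<le> Ca j * e m powr (2 * Re a0 - 1 + \<delta>))"
    if "j \<in> {1..n}" for j
    unfolding Ca_def by (rule someI_ex[OF HCa[OF that]])
  have HCc: "\<exists>C\<ge>0. \<forall>\<^sub>F k in sequentially. \<forall>m. norm (single_factor c (r k j) m) \<le> C * e m powr (2 * Re c - 1 + \<delta>)"
    if "j \<in> {1..n}" for j
    by (rule single_factor_bound[OF tendsto_const r regularD[OF reg(2) that, folded r0_def]]) (use \<delta> in simp)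
  define Cc where "Cc = (\<lambda>j. SOME C. C \<ge> 0 \<and> (\<forall>\<^sub>F k in sequentially. \<forall>m. norm (single_factor c (r k j) m) \<le> C * e m powr (2 * Re c - 1 + \<delta>)))"
  have Cc: "Cc j \<ge> 0 \<and> (\<forall>\<^sub>F k in sequentially. \<forall>m. norm (single_factor c (r k j) m) \<le> Cc j * e m powr (2 * Re c - 1 + \<delta>))"
    if "j \<in> {1..n}" for j
    unfolding Cc_def by (rule someI_ex[OF HCc[OF that]])
  have HCd: "\<exists>C\<ge>0. \<forall>\<^sub>F k in sequentially. \<forall>m. norm (single_factor d (r k j) m) \<le> C * e m powr (2 * Re d - 1 + \<delta>)"
    if "j \<in> {1..n}" for j
    by (rule single_factor_bound[OF tendsto_const r regularD[OF reg(3) that, folded r0_def]]) (use \<delta> in simp)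
  define Cd where "Cd = (\<lambda>j. SOME C. C \<ge> 0 \<and> (\<forall>\<^sub>F k in sequentially. \<forall>m. norm (single_factor d (r k j) m) \<le> C * e m powr (2 * Re d - 1 + \<delta>)))"
  have Cd: "Cd j \<ge> 0 \<and> (\<forall>\<^sub>F k in sequentially. \<forall>m. norm (single_factor d (r k j) m) \<le> Cd j * e m powr (2 * Re d - 1 + \<delta>))"
    if "j \<in> {1..n}" for j
    unfolding Cd_def by (rule someI_ex[OF HCd[OF that]])
  have HCb: "\<exists>C\<ge>0. \<forall>\<^sub>F k in sequentially. \<forall>m. norm (single_factor (b k) (r k j) m) \<le> C * e m powr (\<kappa>0 + \<delta>)"
    if "j \<in> {1..n}" for j
    unfolding r_def using that b[of "\<kappa>0 + \<delta>" j] \<delta> by simp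
  define Cb where "Cb = (\<lambda>j. SOME C. C \<ge> 0 \<and> (\<forall>\<^sub>F k in sequentially. \<forall>m. norm (single_factor (b k) (r k j) m) \<le> C * e m powr (\<kappa>0 + \<delta>)))"
  have Cb: "Cb j \<ge> 0 \<and> (\<forall>\<^sub>F k in sequentially. \<forall>m. norm (single_factor (b k) (r k j) m) \<le> Cb j * e m powr (\<kappa>0 + \<delta>))"
    if "j \<in> {1..n}" for j
    unfolding Cb_def by (rule someI_ex[OF HCb[OF that]])
  define C where "C = (\<Prod>i=1..n. \<Prod>j\<in>{i<..n}. Cp i j * Cm i j) * (\<Prod>j=1..n. C2 j * (Ca j * Cb j * Cc j * Cd j))"
  have C0: "C \<ge> 0" unfolding C_def using Cp Cm C2 Ca Cb Cc Cd
    by (intro mult_nonneg_nonneg prod_nonneg) (auto intro!: mult_nonneg_nonneg prod_nonneg)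
  define \<eta> where "\<eta> = \<mu> / 2"
  have expo: "2 * \<gamma> * real (n - 1) + (2 + ((2 * Re a0 - 1 + \<delta>) + (\<kappa>0 + \<delta>) + (2 * Re c - 1 + \<delta>) + (2 * Re d - 1 + \<delta>))) = \<eta> - \<tau>"
  proof -
    have "(2 * real n + 2) * \<delta> = - \<mu> / 2" by (simp add: \<delta>_def field_simps)
    moreover have "real (n - 1) = real n - 1" using n by simp
    ultimately show ?thesis by (simp add: \<gamma>_def \<eta>_def \<mu>_def algebra_simps)
  qed
  have e1: "\<forall>\<^sub>F k in sequentially. \<forall>i\<in>{1..n}. \<forall>j\<in>{i<..n}.
      (\<forall>m. norm (pair_factor (g k) (r k i + r k j) m) \<le> Cp i j * e m powr \<gamma>) \<and>
      (\<forall>m. norm (pair_factor (g k) (r k i - r k j) m) \<le> Cm i j * e m powr \<gamma>)"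
    using Cp Cm by (intro eventually_ball_finite ballI eventually_conj) auto
  have e2: "\<forall>\<^sub>F k in sequentially. \<forall>j\<in>{1..n}.
      (\<forall>m. norm (s (2 * r k j + 2 * of_nat m) / s (2 * r k j)) \<le> C2 j * (e m powr 2 / \<omega> m)) \<and>
      (\<forall>m. norm (single_factor (a k) (r k j) m) \<le> Ca j * e m powr (2 * Re a0 - 1 + \<delta>)) \<and>
      (\<forall>m. norm (single_factor (b k) (r k j) m) \<le> Cb j * e m powr (\<kappa>0 + \<delta>)) \<and>
      (\<forall>m. norm (single_factor c (r k j) m) \<le> Cc j * e m powr (2 * Re c - 1 + \<delta>)) \<and>
      (\<forall>m. norm (single_factor d (r k j) m) \<le> Cd j * e m powr (2 * Re d - 1 + \<delta>))"
    using C2 Ca Cb Cc Cd by (intro eventually_ball_finite ballI eventually_conj) auto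
  from e1 e2 have "\<forall>\<^sub>F k in sequentially. \<forall>l\<in>Lam n.
     norm (weight n (g k) (a k) (b k) c d l) \<le> C * (\<Prod>j=1..n. e (l j) powr (\<eta> - \<tau>) / \<omega> (l j))"
  proof eventually_elim
    case (elim k)
    show ?case
    proof
      fix l assume l: "l \<in> Lam n"
      have 1: "norm (\<Prod>i=1..n. \<Prod>j\<in>{i<..n}. pair_factor (g k) (r k i + r k j) (l i + l j) * pair_factor (g k) (r k i - r k j) (l i - l j))
        \<le> (\<Prod>i=1..n. \<Prod>j\<in>{i<..n}. (Cp i j * e (l i + l j) powr \<gamma>) * (Cm i j * e (l i - l j) powr \<gamma>))"
        unfolding prod_norm[symmetric] norm_mult using elim(1) Cp
        by (intro prod_mono conjI mult_mono prod_nonneg) auto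
      have "(\<Prod>i=1..n. \<Prod>j\<in>{i<..n}. (Cp i j * e (l i + l j) powr \<gamma>) * (Cm i j * e (l i - l j) powr \<gamma>))
         = (\<Prod>i=1..n. \<Prod>j\<in>{i<..n}. Cp i j * Cm i j) * (\<Prod>i=1..n. \<Prod>j\<in>{i<..n}. e (l i + l j) powr \<gamma> * e (l i - l j) powr \<gamma>)"
        unfolding prod.distrib by (simp add: mult_ac)
      also have "\<dots> \<le> (\<Prod>i=1..n. \<Prod>j\<in>{i<..n}. Cp i j * Cm i j) * (\<Prod>j=1..n. e (l j) powr (2 * \<gamma> * real (n - 1)))"
        using Cp Cm by (intro mult_left_mono pairs_e_bound[OF l \<gamma>(1) n] prod_nonneg ballI) auto
      finally have 2: "norm (\<Prod>i=1..n. \<Prod>j\<in>{i<..n}. pair_factor (g k) (r k i + r k j) (l i + l j) * pair_factor (g k) (r k i - r k j) (l i - l j))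
        \<le> (\<Prod>i=1..n. \<Prod>j\<in>{i<..n}. Cp i j * Cm i j) * (\<Prod>j=1..n. e (l j) powr (2 * \<gamma> * real (n - 1)))"
        using 1 by linarith
      have 3: "norm (\<Prod>j=1..n. s (2 * r k j + 2 * of_nat (l j)) / s (2 * r k j) *
        (single_factor (a k) (r k j) (l j) * single_factor (b k) (r k j) (l j) *
         single_factor c (r k j) (l j) * single_factor d (r k j) (l j)))
        \<le> (\<Prod>j=1..n. (C2 j * (e (l j) powr 2 / \<omega> (l j))) * ((Ca j * e (l j) powr (2 * Re a0 - 1 + \<delta>)) *
             (Cb j * e (l j) powr (\<kappa>0 + \<delta>)) * (Cc j * e (l j) powr (2 * Re c - 1 + \<delta>)) * (Cd j * e (l j) powr (2 * Re d - 1 + \<delta>))))"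
        (is "_ \<le> ?rhs")
        unfolding prod_norm[symmetric] norm_mult using elim(2) C2 Ca Cb Cc Cd \<omega>_pos
        by (intro prod_mono conjI mult_mono mult_nonneg_nonneg norm_ge_zero) (auto simp: less_imp_le)
      have "?rhs = (\<Prod>j=1..n. C2 j * (Ca j * Cb j * Cc j * Cd j)) *
          (\<Prod>j=1..n. e (l j) powr (2 + ((2 * Re a0 - 1 + \<delta>) + (\<kappa>0 + \<delta>) + (2 * Re c - 1 + \<delta>) + (2 * Re d - 1 + \<delta>))) / \<omega> (l j))"
        unfolding prod.distrib[symmetric] powr_add by (intro prod.cong refl) simp
      hence "norm (weight n (g k) (a k) (b k) c d l) \<le>
         ((\<Prod>i=1..n. \<Prod>j\<in>{i<..n}. Cp i j * Cm i j) * (\<Prod>j=1..n. e (l j) powr (2 * \<gamma> * real (n - 1)))) *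
         ((\<Prod>j=1..n. C2 j * (Ca j * Cb j * Cc j * Cd j)) *
          (\<Prod>j=1..n. e (l j) powr (2 + ((2 * Re a0 - 1 + \<delta>) + (\<kappa>0 + \<delta>) + (2 * Re c - 1 + \<delta>) + (2 * Re d - 1 + \<delta>))) / \<omega> (l j)))"
        unfolding weight_def rk norm_mult[of "prod _ _" "prod _ _"]
        by (intro mult_mono 2 mult_nonneg_nonneg prod_nonneg norm_ge_zero order.trans[OF 3 eq_refl]) (use Cp Cm in auto)
      also have "\<dots> = C * (\<Prod>j=1..n. e (l j) powr (2 * \<gamma> * real (n - 1)) *
            (e (l j) powr (2 + ((2 * Re a0 - 1 + \<delta>) + (\<kappa>0 + \<delta>) + (2 * Re c - 1 + \<delta>) + (2 * Re d - 1 + \<delta>))) / \<omega> (l j)))"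
        unfolding C_def prod.distrib by (simp only: mult_ac)
      also have "\<dots> = C * (\<Prod>j=1..n. e (l j) powr (\<eta> - \<tau>) / \<omega> (l j))"
        unfolding times_divide_eq_right powr_add[symmetric] expo ..
      finally show "norm (weight n (g k) (a k) (b k) c d l) \<le> C * (\<Prod>j=1..n. e (l j) powr (\<eta> - \<tau>) / \<omega> (l j))" .
    qed
  qed
  moreover have "\<eta> < 0" using \<mu> by (simp add: \<eta>_def)
  ultimately show ?thesis using C0 by blast
qed

lemma summable_on_majorant:
  assumes "\<eta> < 0"
  shows "(\<lambda>l. C * (\<Prod>j=1..n. e (l j) powr \<eta> / \<omega> (l j))) summable_on Lam n"
  by (intro summable_on_cmult_right summable_on_prod_Lam summable_e assms)
     (auto simp: \<omega>_pos less_imp_le)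

end

section \<open>The recurrence in a parameter\<close>

context sfun_growth
begin

text \<open>
  At a zero of \<open>\<Prod>\<^sub>j s (g\<^sub>b + \<rho>\<^sub>j)\<close> the relation between the series for \<open>g\<^sub>b\<close> and \<open>g\<^sub>b + 1\<close> degenerates to \<open>0 = 0\<close>;
  \<open>regular2\<close> excludes this along the whole sequence \<open>g\<^sub>b - 1, g\<^sub>b - 2, \<dots>\<close>.
\<close>
definition regular2 :: "nat \<Rightarrow> complex \<Rightarrow> complex \<Rightarrow> complex \<Rightarrow> bool" where
  "regular2 n g a v \<longleftrightarrow> (\<forall>w<n. \<forall>i::nat. s (1 - v - a - of_nat w * g + of_nat i) \<noteq> 0)"

definition converges :: "nat \<Rightarrow> complex \<Rightarrow> complex \<Rightarrow> bool" where
  "converges n g \<sigma> \<longleftrightarrow> (\<forall>j\<in>{1..n}. Re (1 - \<sigma> - 2 * of_nat (n - j) * g) > 0)"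

definition S :: "nat \<Rightarrow> complex \<Rightarrow> complex \<Rightarrow> complex \<Rightarrow> complex \<Rightarrow> complex \<Rightarrow> complex" where
  "S n g a b c d = infsum (weight n g a b c d) (Lam n)"

text \<open>The weight treats \<open>b\<close>, \<open>c\<close>, \<open>d\<close> alike, whereas
  \<open>a\<close> fixes the lattice; so the recurrence in the second slot can be run in each of the
  three.\<close>

lemma S_commute: "S n g a b c d = S n g a c b d" "S n g a b c d = S n g a d c b"
  unfolding S_def weight_def by (simp_all only: mult_ac)

lemma strongly_generic_admissible: "strongly_generic g a \<Longrightarrow> admissible n g a"
  unfolding admissible_def
  using rh_double_nz[of g a n _ 0] rh_sum_nz[of g a n _ _ 0] rh_diff_nz[of g a _ _ n 0] rh_sum_nz1[of g a n] rh_diff_nz1[of g a _ _ n]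
  by (auto simp: add_diff_eq add.assoc)

lemma tendsto_truncated_sum:
  fixes w :: "(nat \<Rightarrow> nat) \<Rightarrow> complex"
  assumes h: "h summable_on Lam n" and wh: "\<And>l. l \<in> Lam n \<Longrightarrow> norm (w l) \<le> h l"
  shows "(\<lambda>L. \<Sum>l\<in>{l\<in>Lam n. l 1 \<le> L}. w l) \<longlonglongrightarrow> infsum w (Lam n)"
proof -
  have h0: "h l \<ge> 0" if "l \<in> Lam n" for l using wh[OF that] norm_ge_zero order_trans by blast
  have fin: "finite {l\<in>Lam n. l 1 \<le> L}" for L
    by (rule finite_subset[OF _ finite_Lam_bounded[of n L]]) (auto intro: order_trans[OF LamD[of _ n 1]])
  have "(\<lambda>L. infsum (\<lambda>l. if l 1 \<le> L then w l else 0) (Lam n)) \<longlonglongrightarrow> infsum w (Lam n)"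
  proof (rule infsum_tendsto_dominated(2)[OF h])
    show "\<forall>\<^sub>F L in sequentially. \<forall>l\<in>Lam n. norm (if l 1 \<le> L then w l else 0) \<le> h l"
      using wh h0 by auto
    show "(\<lambda>L. if l 1 \<le> L then w l else 0) \<longlonglongrightarrow> w l" for l :: "nat \<Rightarrow> nat"
      by (rule tendsto_eventually, rule eventually_mono[OF eventually_ge_at_top[of "l 1"]]) auto
  qed
  also have "(\<lambda>L. infsum (\<lambda>l. if l 1 \<le> L then w l else 0) (Lam n)) = (\<lambda>L. \<Sum>l\<in>{l\<in>Lam n. l 1 \<le> L}. w l)"
  proof
    fix L
    have "infsum (\<lambda>l. if l 1 \<le> L then w l else 0) (Lam n) = infsum w {l\<in>Lam n. l 1 \<le> L}"
      by (rule infsum_cong_neutral) auto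
    thus "infsum (\<lambda>l. if l 1 \<le> L then w l else 0) (Lam n) = (\<Sum>l\<in>{l\<in>Lam n. l 1 \<le> L}. w l)"
      using fin by simp
  qed
  finally show ?thesis .
qed

lemma weight_majorant:
  assumes n: "n \<ge> 1" and adm: "admissible n g a"
    and reg: "regular n g a a" "regular n g a b" "regular n g a c" "regular n g a d"
    and conv: "\<And>j. j \<in> {1..n} \<Longrightarrow> 4 * real (n - j) * Re g + 2 * Re (a + b + c + d) + \<tau> - 2 < 0"
  shows "\<exists>C \<eta>. C \<ge> 0 \<and> \<eta> < 0 \<and> (\<forall>l\<in>Lam n.
     norm (weight n g a b c d l) \<le> C * (\<Prod>j=1..n. e (l j) powr (\<eta> - \<tau>) / \<omega> (l j)))"
proof -
  have "\<exists>C \<eta>. C \<ge> 0 \<and> \<eta> < 0 \<and> (\<forall>\<^sub>F k::nat in sequentially. \<forall>l\<in>Lam n.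
     norm (weight n g a b c d l) \<le> C * (\<Prod>j=1..n. e (l j) powr (\<eta> - \<tau>) / \<omega> (l j)))"
  proof (rule weight_dominated[OF n tendsto_const tendsto_const adm reg(1,3,4), where ?\<kappa>0.0 = "2 * Re b - 1"])
    show "\<exists>C\<ge>0. \<forall>\<^sub>F k::nat in sequentially. \<forall>m. norm (single_factor b (rh n g a j) m) \<le> C * e m powr \<kappa>"
      if "\<kappa> > 2 * Re b - 1" "j \<in> {1..n}" for \<kappa> j
      using regularD[OF reg(2) that(2)] that(1) by (intro single_factor_bound[OF tendsto_const tendsto_const]) auto
    show "4 * real (n - j) * Re g + 2 * Re (a + c + d) + (2 * Re b - 1) + \<tau> - 1 < 0" if "j \<in> {1..n}" for j
      using conv[OF that] by simp
  qed
  thus ?thesis by simp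
qed

text \<open>Only the first row contributes to the boundary. \<open>num4\<close> grows like
  \<open>e^4\<close> and \<open>s (2 x)\<close> like \<open>e^2 / \<omega>\<close>; the remaining
  quotients stay bounded because a shift by \<open>g\<close> does not change the order of
  growth.\<close>

lemma hop_first_bound:
  assumes sg: "strongly_generic g a" and n: "n \<ge> 1"
  shows "\<exists>C\<ge>0. \<forall>l\<in>Lam n. norm (hop n g a b c d (\<lambda>k. f (pt n g a l k)) 1 (pt n g a l 1)) \<le> C * (e (l 1) ^ 2 * \<omega> (l 1))"
proof -
  define r where "r = rh n g a"
  have "\<exists>C\<ge>0. \<forall>m. norm (s (v + r 1 + of_nat m)) \<le> C * e m" for v
    by (rule s_upper_const)
  then obtain A where A: "\<And>v. A v \<ge> 0" "\<And>v m. norm (s (v + r 1 + of_nat m)) \<le> A v * e m" by metis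
  have "s (2 * r 1 + 2 * of_nat m) \<noteq> 0" for m
    using rh_double_nz[OF sg, of n 1 "2 * m"] by (simp add: r_def)
  then obtain B where B: "B > 0" "\<And>m. e m ^ 2 / \<omega> m \<le> B * norm (s (2 * r 1 + 2 * of_nat m))"
    using s2_lower by blast
  have ratio: "\<exists>C\<ge>0. \<forall>m. norm (s (g + x + of_nat m) / s (x + of_nat m)) \<le> C" if nzx: "\<And>m. s (x + of_nat m) \<noteq> 0" for x
  proof -
    obtain U where U: "U \<ge> 0" "\<And>m. norm (s (g + x + of_nat m)) \<le> U * e m" using s_upper_const by blast
    obtain V where V: "V > 0" "\<And>m. e m \<le> V * norm (s (x + of_nat m))" using s_lower[OF nzx] by blast
    have "norm (s (g + x + of_nat m) / s (x + of_nat m)) \<le> U * V" for m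
    proof -
      have "norm (s (g + x + of_nat m)) \<le> U * (V * norm (s (x + of_nat m)))"
        using order.trans[OF U(2) mult_left_mono[OF V(2) U(1)]] .
      thus ?thesis using nzx[of m] by (simp add: norm_divide divide_le_eq mult.assoc)
    qed
    thus ?thesis using U V by (intro exI[of _ "U * V"]) auto
  qed
  have "\<exists>C\<ge>0. \<forall>m. norm (s (g + (r 1 + r k) + of_nat m) / s (r 1 + r k + of_nat m)) \<le> C" for k
    using rh_sum_nz[OF sg, of n 1 k] by (intro ratio) (simp add: r_def)
  then obtain P where P: "\<And>k. P k \<ge> 0" "\<And>k m. norm (s (g + (r 1 + r k) + of_nat m) / s (r 1 + r k + of_nat m)) \<le> P k" by metis
  have "\<exists>C\<ge>0. \<forall>m. norm (s (g + (r 1 - r k) + of_nat m) / s (r 1 - r k + of_nat m)) \<le> C" if "k \<in> {1..n} - {1}" for k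
    using rh_diff_nz[OF sg, of 1 k n] that by (intro ratio) (auto simp: r_def)
  then obtain M where M: "\<And>k. k \<in> {1..n} - {1} \<Longrightarrow> M k \<ge> 0"
     "\<And>k m. k \<in> {1..n} - {1} \<Longrightarrow> norm (s (g + (r 1 - r k) + of_nat m) / s (r 1 - r k + of_nat m)) \<le> M k" by metis
  define C where "C = A a * A b * A c * A d * B * (\<Prod>k\<in>{1..n}-{1}. P k * M k)"
  have C: "C \<ge> 0" unfolding C_def using A B P M by (intro mult_nonneg_nonneg prod_nonneg) (auto simp: less_imp_le)
  have "norm (hop n g a b c d (\<lambda>k. f (pt n g a l k)) 1 (pt n g a l 1)) \<le> C * (e (l 1) ^ 2 * \<omega> (l 1))"
    if l: "l \<in> Lam n" for l
  proof -
    define m where "m = l 1"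
    define x where "x = pt n g a l 1"
    have xr: "x = r 1 + of_nat m" by (simp add: x_def pt_def r_def m_def)
    have "norm (num4 a b c d x) \<le> (A a * e m) * (A b * e m) * (A c * e m) * (A d * e m)"
      unfolding num4_def norm_mult xr add.assoc[symmetric] using A e_pos[of m]
      by (intro mult_mono mult_nonneg_nonneg) (auto simp: less_imp_le)
    also have "\<dots> = A a * A b * A c * A d * e m ^ 4" by (simp add: power4_eq_xxxx mult_ac)
    finally have 1: "norm (num4 a b c d x) \<le> A a * A b * A c * A d * e m ^ 4" .
    have nz: "s (2 * x) \<noteq> 0" unfolding x_def by (rule pt_double_nz[OF sg])
    have "e m ^ 2 / \<omega> m \<le> B * norm (s (2 * x))" using B(2)[of m] by (simp add: xr distrib_left)
    hence "1 \<le> B * norm (s (2 * x)) * (\<omega> m / e m ^ 2)"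
      using \<omega>_pos[of m] e_pos[of m] by (simp add: field_simps)
    hence 2: "1 / norm (s (2 * x)) \<le> B * (\<omega> m / e m ^ 2)"
      using nz by (simp add: field_simps)
    have 3: "norm (\<Prod>k\<in>{1..n}-{1}. (f (x + g) - f (pt n g a l k)) / (f x - f (pt n g a l k))) \<le> (\<Prod>k\<in>{1..n}-{1}. P k * M k)"
      unfolding prod_norm[symmetric]
    proof (intro prod_mono conjI norm_ge_zero)
      fix k assume k: "k \<in> {1..n} - {1}"
      define y where "y = pt n g a l k"
      have s: "x + y = r 1 + r k + of_nat (l 1 + l k)" by (simp add: x_def y_def pt_def r_def)
      have d: "x - y = r 1 - r k + of_nat (l 1 - l k)"
        unfolding x_def y_def r_def using k n by (intro pt_diff[OF l]) auto
      have "(f (x + g) - f y) / (f x - f y) = (s (g + (x + y)) / s (x + y)) * (s (g + (x - y)) / s (x - y))"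
        unfolding s_mult_s[symmetric] by (simp add: algebra_simps)
      thus "norm ((f (x + g) - f (pt n g a l k)) / (f x - f (pt n g a l k))) \<le> P k * M k"
        unfolding y_def[symmetric] using P(1)[of k] P(2)[of k "l 1 + l k"] M[OF k] 
        unfolding s d by (simp only: norm_mult) (intro mult_mono; simp add: add.assoc)
    qed
    have "norm (hop n g a b c d (\<lambda>k. f (pt n g a l k)) 1 x)
      = norm (num4 a b c d x) * (1 / norm (s (2 * x))) * norm (\<Prod>k\<in>{1..n}-{1}. (f (x + g) - f (pt n g a l k)) / (f x - f (pt n g a l k)))"
      unfolding hop_def norm_mult norm_divide by simp
    also have "\<dots> \<le> (A a * A b * A c * A d * e m ^ 4) * (B * (\<omega> m / e m ^ 2)) * (\<Prod>k\<in>{1..n}-{1}. P k * M k)"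
    proof (intro mult_mono 1 2 3)
      have p: "e m > 0" "\<omega> m > 0" "B > 0" by (auto intro: e_pos \<omega>_pos B)
      show q1: "0 \<le> A a * A b * A c * A d * e m ^ 4"
        using A(1) p by (intro mult_nonneg_nonneg) auto
      have q2: "0 \<le> B * (\<omega> m / e m ^ 2)" using p by simp
      show "0 \<le> A a * A b * A c * A d * e m ^ 4 * (B * (\<omega> m / (e m)\<^sup>2))"
        by (intro mult_nonneg_nonneg q1 q2)
      show "0 \<le> 1 / norm (s (2 * x))" by simp
    qed (rule norm_ge_zero)
    also have "\<dots> = C * (e m ^ 2 * \<omega> m)"
      using e_pos[of m] by (simp add: C_def power4_eq_xxxx power2_eq_square)
    finally show ?thesis by (simp add: x_def m_def)
  qed
  thus ?thesis using C by blast
qed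

text \<open>Sum the kernel identity against the weight. The truncated sums tend to a combination of
  the moments \<open>A m\<close>, and they equal the boundary term, which tends to 0. As this holds
  for every \<open>Y\<close>, each Newton coefficient of the combination vanishes.\<close>

lemma moments_recurrence:
  assumes n: "n \<ge> 1" and sg: "strongly_generic g a"
    and reg: "regular n g a b" "regular n g a c" "regular n g a d"
    and conv: "converges n g (a + (b + 1) + c + d)"
  defines "A \<equiv> (\<lambda>m. infsum (\<lambda>l. weight n g a b c d l * newton_coeff (node g b) (\<lambda>k. f (pt n g a l k)) n m) (Lam n))"
    and "\<sigma> \<equiv> a + b + c + d"
  assumes m: "m < n"
  shows "A m * (E_coeff g \<sigma> n - E_coeff g \<sigma> m) = A (Suc m) * F_coeff g a b c d (Suc m)"
proof -
  \<comment> \<open>Convergence at \<open>b + 1\<close> supplies \<open>\<tau> = 2\<close> for the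
    weight at \<open>b\<close>: two powers of \<open>e\<close> per coordinate, the growth of
    \<open>f\<close>.\<close>
  have "4 * real (n - j) * Re g + 2 * Re (a + b + c + d) + 2 - 2 < 0" if "j \<in> {1..n}" for j
  proof -
    have "Re (1 - (a + (b + 1) + c + d) - 2 * of_nat (n - j) * g) > 0"
      using conv that unfolding converges_def by blast
    thus ?thesis by (simp add: algebra_simps)
  qed
  from weight_majorant[OF n strongly_generic_admissible[OF sg] regular_self[OF sg] reg this]
  obtain C \<eta> where C: "C \<ge> 0" and \<eta>: "\<eta> < 0" and
    W: "\<And>l. l \<in> Lam n \<Longrightarrow> norm (weight n g a b c d l) \<le> C * (\<Prod>j=1..n. e (l j) powr (\<eta> - 2) / \<omega> (l j))"
    by blast
  define X where "X = (\<lambda>l k. f (pt n g a l k))"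
  have "\<exists>D\<ge>0. \<forall>l. B + norm (X l k) \<le> D * e (l k) ^ 2" for k B
    using f_upper[of B "rh n g a k"] unfolding X_def pt_def by blast
  then obtain D where D: "\<And>B k. D B k \<ge> 0" "\<And>B k l. B + norm (X l k) \<le> D B k * e (l k) ^ 2" by metis
  have WX: "norm (weight n g a b c d l) * (\<Prod>k=1..n. B + norm (X l k)) \<le> (C * (\<Prod>k=1..n. D B k)) * (\<Prod>j=1..n. e (l j) powr \<eta> / \<omega> (l j))"
    if l: "l \<in> Lam n" and B: "B \<ge> 0" for l B
  proof -
    have "norm (weight n g a b c d l) * (\<Prod>k=1..n. B + norm (X l k))
      \<le> (C * (\<Prod>j=1..n. e (l j) powr (\<eta> - 2) / \<omega> (l j))) * (\<Prod>k=1..n. D B k * e (l k) ^ 2)"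
      using W[OF l] D B C \<omega>_pos
      by (intro mult_mono prod_mono prod_nonneg mult_nonneg_nonneg conjI) (auto simp: less_imp_le)
    also have "\<dots> = (C * (\<Prod>k=1..n. D B k)) * (\<Prod>j=1..n. e (l j) powr (\<eta> - 2) / \<omega> (l j) * e (l j) ^ 2)"
      unfolding prod.distrib by (simp only: mult_ac)
    also have "(\<Prod>j=1..n. e (l j) powr (\<eta> - 2) / \<omega> (l j) * e (l j) ^ 2) = (\<Prod>j=1..n. e (l j) powr \<eta> / \<omega> (l j))"
    proof (intro prod.cong refl)
      fix j
      have "e (l j) powr (\<eta> - 2) * e (l j) ^ 2 = e (l j) powr (\<eta> - 2) * e (l j) powr 2"
        using e_pos[of "l j"] by (simp add: powr_numeral)
      also have "\<dots> = e (l j) powr \<eta>" unfolding powr_add[symmetric] by simp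
      finally show "e (l j) powr (\<eta> - 2) / \<omega> (l j) * e (l j) ^ 2 = e (l j) powr \<eta> / \<omega> (l j)" by simp
    qed
    finally show ?thesis .
  qed
  define B where "B = (\<Sum>i\<le>n. norm (node g b i))"
  have B: "B \<ge> 0" "\<And>i. i \<le> n \<Longrightarrow> norm (node g b i) \<le> B"
    unfolding B_def by (auto intro!: sum_nonneg member_le_sum)
  define co where "co = (\<lambda>l m. newton_coeff (node g b) (X l) n m)"
  define H where "H = (\<lambda>l. (C * (\<Prod>k=1..n. D (1 + B) k)) * (\<Prod>j=1..n. e (l j) powr \<eta> / \<omega> (l j)))"
  have Hs: "H summable_on Lam n" unfolding H_def by (rule summable_on_majorant[OF \<eta>])
  have co_le: "norm (weight n g a b c d l * co l m) \<le> H l" if l: "l \<in> Lam n" for l m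
  proof -
    have "norm (co l m) \<le> (\<Prod>k=1..n. (1 + B) + norm (X l k))"
      unfolding co_def by (rule norm_newton_coeff_le) (use B in auto)
    hence "norm (weight n g a b c d l * co l m) \<le> norm (weight n g a b c d l) * (\<Prod>k=1..n. (1 + B) + norm (X l k))"
      unfolding norm_mult by (intro mult_left_mono) auto
    also have "\<dots> \<le> H l" unfolding H_def using B by (intro WX[OF l]) auto
    finally show ?thesis .
  qed
  define K where "K = (\<lambda>m. smult (E_coeff g \<sigma> m - E_coeff g \<sigma> n) (newton_poly (node g b) m) +
       smult (F_coeff g a b c d m) (newton_poly (node g b) (m - 1)))"
  have A_eq: "A m = infsum (\<lambda>l. weight n g a b c d l * co l m) (Lam n)" for m
    unfolding A_def co_def X_def ..
  have zero: "(\<Sum>m\<le>n. A m * poly (K m) Y) = 0" for Y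
  proof (rule LIMSEQ_unique)
    define T where "T = (\<lambda>L. \<Sum>l\<in>{l\<in>Lam n. l 1 = L}. weight n g a b c d l * hop n g a b c d (X l) 1 (pt n g a l 1) * (\<Prod>k\<in>{1..n}-{1}. Y - X l k))"
    have "(\<lambda>L. \<Sum>m\<le>n. (\<Sum>l\<in>{l\<in>Lam n. l 1 \<le> L}. weight n g a b c d l * co l m) * poly (K m) Y) \<longlonglongrightarrow> (\<Sum>m\<le>n. A m * poly (K m) Y)"
    proof (intro tendsto_sum tendsto_mult tendsto_const)
      show "(\<lambda>L. \<Sum>l\<in>{l\<in>Lam n. l 1 \<le> L}. weight n g a b c d l * co l m) \<longlonglongrightarrow> A m" for m
        unfolding A_eq by (rule tendsto_truncated_sum[OF Hs co_le])
    qed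
    also have "(\<lambda>L. \<Sum>m\<le>n. (\<Sum>l\<in>{l\<in>Lam n. l 1 \<le> L}. weight n g a b c d l * co l m) * poly (K m) Y) = T"
    proof
      fix L
      have "T L = (\<Sum>l\<in>{l\<in>Lam n. l 1 \<le> L}. weight n g a b c d l *
        (\<Sum>j=1..n. (hop n g a b c d (X l) j (pt n g a l j) + hop n g a b c d (X l) j (- pt n g a l j)) *
           (\<Prod>k\<in>{1..n}-{j}. Y - X l k)))"
        unfolding T_def X_def by (rule truncated_sum[OF sg reg n, symmetric])
      also have "\<dots> = (\<Sum>l\<in>{l\<in>Lam n. l 1 \<le> L}. weight n g a b c d l * (\<Sum>m\<le>n. co l m * poly (K m) Y))"
      proof (rule sum.cong[OF refl], rule arg_cong[where f = "(*) _"])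
        fix l assume "l \<in> {l\<in>Lam n. l 1 \<le> L}"
        hence l: "l \<in> Lam n" by simp
        show "(\<Sum>j=1..n. (hop n g a b c d (X l) j (pt n g a l j) + hop n g a b c d (X l) j (- pt n g a l j)) *
           (\<Prod>k\<in>{1..n}-{j}. Y - X l k)) = (\<Sum>m\<le>n. co l m * poly (K m) Y)"
        proof -
          have "s g \<noteq> 0" using strongly_generic_diff[OF sg, of 1 0] by simp
          moreover have "s (2 * pt n g a l j) \<noteq> 0 \<and> s (2 * pt n g a l j + g) \<noteq> 0 \<and> s (g - 2 * pt n g a l j) \<noteq> 0" for j
            using pt_double_nz[OF sg] pt_double_g_nz[OF sg] pt_g_double_nz[OF sg] by blast
          ultimately show ?thesis
            using kernel_identity[OF inj_on_f_pt[OF sg l] n, of g a b c d Y]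
            by (simp add: X_def co_def K_def \<sigma>_def)
        qed
      qed
      also have "\<dots> = (\<Sum>m\<le>n. (\<Sum>l\<in>{l\<in>Lam n. l 1 \<le> L}. weight n g a b c d l * co l m) * poly (K m) Y)"
        unfolding sum_distrib_left sum_distrib_right by (subst sum.swap) (simp only: mult.assoc)
      finally show "(\<Sum>m\<le>n. (\<Sum>l\<in>{l\<in>Lam n. l 1 \<le> L}. weight n g a b c d l * co l m) * poly (K m) Y) = T L" ..
    qed
    finally show "T \<longlonglongrightarrow> (\<Sum>m\<le>n. A m * poly (K m) Y)" .
    obtain U where U: "U \<ge> 0" "\<And>l. l \<in> Lam n \<Longrightarrow> norm (hop n g a b c d (X l) 1 (pt n g a l 1)) \<le> U * (e (l 1) ^ 2 * \<omega> (l 1))"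
      using hop_first_bound[OF sg n] unfolding X_def by blast
    define V where "V = C * U * (\<Prod>k\<in>{1..n}-{1}. D (norm Y) k)"
    define h where "h = (\<lambda>(j::nat) m. e m powr \<eta> / \<omega> m)"
    have h0: "h j m \<ge> 0" for j m by (simp add: h_def less_imp_le[OF \<omega>_pos])
    have V0: "V \<ge> 0" unfolding V_def using C U D by (intro mult_nonneg_nonneg prod_nonneg) auto
    have tbound: "norm (weight n g a b c d l * hop n g a b c d (X l) 1 (pt n g a l 1) * (\<Prod>k\<in>{1..n}-{1}. Y - X l k))
       \<le> V * \<omega> (l 1) * (\<Prod>j\<in>{1..n}. h j (l j))" if l: "l \<in> Lam n" for l
    proof -
      have "norm (\<Prod>k\<in>{1..n}-{1}. Y - X l k) \<le> (\<Prod>k\<in>{1..n}-{1}. D (norm Y) k * e (l k) ^ 2)"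
        unfolding prod_norm[symmetric]
        by (intro prod_mono conjI norm_ge_zero order.trans[OF norm_triangle_ineq4 D(2)])
      hence "norm (weight n g a b c d l * hop n g a b c d (X l) 1 (pt n g a l 1) * (\<Prod>k\<in>{1..n}-{1}. Y - X l k))
        \<le> (C * (\<Prod>j=1..n. e (l j) powr (\<eta> - 2) / \<omega> (l j))) * (U * (e (l 1) ^ 2 * \<omega> (l 1))) * (\<Prod>k\<in>{1..n}-{1}. D (norm Y) k * e (l k) ^ 2)"
        unfolding norm_mult using W[OF l] U(1) U(2)[OF l] C \<omega>_pos
        by (intro mult_mono mult_nonneg_nonneg prod_nonneg) (auto simp: less_imp_le)
      also have "\<dots> = V * \<omega> (l 1) * ((\<Prod>j=1..n. e (l j) powr (\<eta> - 2) / \<omega> (l j)) * (e (l 1) ^ 2 * (\<Prod>k\<in>{1..n}-{1}. e (l k) ^ 2)))"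
        unfolding V_def prod.distrib by (simp only: mult_ac)
      also have "e (l 1) ^ 2 * (\<Prod>k\<in>{1..n}-{1}. e (l k) ^ 2) = (\<Prod>k=1..n. e (l k) ^ 2)"
        using n by (subst prod.remove[of "{1..n}" 1]) auto
      also have "(\<Prod>j=1..n. e (l j) powr (\<eta> - 2) / \<omega> (l j)) * (\<Prod>k=1..n. e (l k) ^ 2) = (\<Prod>j\<in>{1..n}. h j (l j))"
        unfolding prod.distrib[symmetric]
      proof (intro prod.cong refl)
        fix j
        have "e (l j) powr (\<eta> - 2) * e (l j) ^ 2 = e (l j) powr (\<eta> - 2) * e (l j) powr 2"
          using e_pos[of "l j"] by (simp add: powr_numeral)
        also have "\<dots> = e (l j) powr \<eta>" unfolding powr_add[symmetric] by simp
        finally show "e (l j) powr (\<eta> - 2) / \<omega> (l j) * e (l j) ^ 2 = h j (l j)" by (simp add: h_def)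
      qed
      finally show ?thesis .
    qed
    define Z where "Z = V * (\<Prod>j\<in>{2..n}. suminf (h j))"
    have "norm (T L) \<le> Z * e L powr \<eta>" for L
    proof -
      have "norm (T L) \<le> (\<Sum>l\<in>{l\<in>Lam n. l 1 = L}. V * \<omega> (l 1) * (\<Prod>j\<in>{1..n}. h j (l j)))"
        unfolding T_def using tbound by (intro sum_norm_le) auto
      also have "\<dots> = V * \<omega> L * (\<Sum>l\<in>{l\<in>Lam n. l 1 = L}. \<Prod>j\<in>{1..n}. h j (l j))"
        unfolding sum_distrib_left by (intro sum.cong refl) auto
      also have "\<dots> \<le> V * \<omega> L * (h 1 L * (\<Prod>j\<in>{2..n}. suminf (h j)))"
        using V0 less_imp_le[OF \<omega>_pos] summable_e[OF \<eta>]
        by (intro mult_left_mono sum_prod_Lam_top_le h0 n mult_nonneg_nonneg) (auto simp: h_def)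
      \<comment> \<open>The factor \<open>\<omega> L\<close> of the hop cancels the
        \<open>1 / \<omega> L\<close> in \<open>h 1 L\<close>, so the layer is bounded by a negative
        power of \<open>e L\<close>.\<close>
      also have "\<dots> = Z * e L powr \<eta>" using \<omega>_pos[of L] by (simp add: Z_def h_def)
      finally show ?thesis .
    qed
    moreover have "(\<lambda>L. Z * e L powr \<eta>) \<longlonglongrightarrow> 0"
      using tendsto_mult[OF tendsto_const[of Z] e_powr_tendsto_0[OF \<eta>]] by simp
    ultimately show "T \<longlonglongrightarrow> 0" by (rule Lim_null_comparison[OF always_eventually[OF allI]])
  qed
  \<comment> \<open>The coefficient of the basis element \<open>m\<close>: the diagonal entry at
    \<open>m\<close> plus the off-diagonal entry coming from \<open>m + 1\<close>.\<close>
  define R where "R = (\<lambda>m. A m * (E_coeff g \<sigma> m - E_coeff g \<sigma> n) + (if m < n then A (Suc m) * F_coeff g a b c d (Suc m) else 0))"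
  have "(\<Sum>m\<le>n. smult (A m) (K m)) = (\<Sum>m\<le>n. smult (R m) (newton_poly (node g b) m))"
  proof -
    have F0: "F_coeff g a b c d 0 = 0" by (simp add: F_coeff_def)
    have "(\<Sum>m\<le>n. smult (A m * F_coeff g a b c d m) (newton_poly (node g b) (m - 1)))
      = (\<Sum>m<n. smult (A (Suc m) * F_coeff g a b c d (Suc m)) (newton_poly (node g b) m))"
    proof -
      obtain n' where n': "n = Suc n'" using n by (cases n) auto
      show ?thesis unfolding n' by (subst sum.atMost_Suc_shift) (simp add: F0 lessThan_Suc_atMost)
    qed
    also have "\<dots> = (\<Sum>m\<le>n. smult (if m < n then A (Suc m) * F_coeff g a b c d (Suc m) else 0) (newton_poly (node g b) m))"
      by (rule sum.mono_neutral_cong_left) auto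
    finally show ?thesis
      unfolding K_def R_def smult_add_left smult_add_right sum.distrib smult_smult by simp
  qed
  moreover have "poly (\<Sum>m\<le>n. smult (A m) (K m)) Y = 0" for Y
    using zero[of Y] by (simp add: poly_sum)
  hence "(\<Sum>m\<le>n. smult (A m) (K m)) = 0" using poly_all_0_iff_0 by blast
  ultimately have "(\<Sum>m\<le>n. smult (R m) (newton_poly (node g b) m)) = 0" by simp
  from newton_poly_independent[OF this, of m] m have "R m = 0" by simp
  thus ?thesis using m by (simp add: R_def algebra_simps)
qed

text \<open>Multiply the two-term relations for all \<open>m < n\<close>. The last moment is the
  series at \<open>b\<close>; by \<open>weight_shift\<close> the first is the series at
  \<open>b + 1\<close> times a product. Its factors \<open>s (a + b + i g)\<close> occur on both
  sides and are cancelled; \<open>regular2\<close> at \<open>b + 1\<close> makes them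
  nonzero.\<close>

lemma S_recurrence:
  assumes n: "n \<ge> 1" and sg: "strongly_generic g a"
    and reg: "regular n g a (b + 1)" "regular n g a c" "regular n g a d" and reg2: "regular2 n g a (b + 1)"
    and conv: "converges n g (a + (b + 1) + c + d)"
  shows "S n g a (b + 1) c d * (\<Prod>m<n. s (a + b + c + d + of_nat (n - 1 + m) * g) * s (b - a - of_nat m * g))
    = S n g a b c d * (\<Prod>m<n. s (b + c + of_nat m * g) * s (b + d + of_nat m * g))"
proof -
  define \<sigma> where "\<sigma> = a + b + c + d"
  have regb: "regular n g a b"
    unfolding regular_def
  proof (intro allI impI)
    fix w i assume "w < n"
    with reg(1) have "s (1 - (b + 1) + a + of_nat w * g + of_nat (Suc i)) \<noteq> 0" unfolding regular_def by blast
    thus "s (1 - b + a + of_nat w * g + of_nat i) \<noteq> 0" by (simp add: algebra_simps)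
  qed
  define A where "A = (\<lambda>m. infsum (\<lambda>l. weight n g a b c d l * newton_coeff (node g b) (\<lambda>k. f (pt n g a l k)) n m) (Lam n))"
  have sgz: "s g \<noteq> 0" using strongly_generic_diff[OF sg, of 1 0] by simp
  have rec: "A m * (s (of_nat (n - m) * g) * s (\<sigma> + (of_nat (n + m) - 1) * g)) =
     A (Suc m) * (s (of_nat (Suc m) * g) * (s (a + b + of_nat m * g) * s (c + b + of_nat m * g) * s (d + b + of_nat m * g)))"
    if m: "m < n" for m
  proof -
    have "A m * (E_coeff g \<sigma> n - E_coeff g \<sigma> m) = A (Suc m) * F_coeff g a b c d (Suc m)"
      unfolding A_def \<sigma>_def by (rule moments_recurrence[OF n sg regb reg(2,3) conv m])
    hence "A m * ((E_coeff g \<sigma> n - E_coeff g \<sigma> m) * s g) = A (Suc m) * (F_coeff g a b c d (Suc m) * s g)"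
      by simp
    thus ?thesis using E_coeff_diff[OF sgz, of m n \<sigma>] m sgz by (simp add: F_coeff_def)
  qed
  have prods: "A 0 * (\<Prod>i<m. s (of_nat (n - i) * g) * s (\<sigma> + (of_nat (n + i) - 1) * g)) =
     A m * (\<Prod>i<m. s (of_nat (Suc i) * g) * (s (a + b + of_nat i * g) * s (c + b + of_nat i * g) * s (d + b + of_nat i * g)))"
    if "m \<le> n" for m
    using that
  proof (induction m)
    case (Suc m)
    have "A 0 * (\<Prod>i<Suc m. s (of_nat (n - i) * g) * s (\<sigma> + (of_nat (n + i) - 1) * g)) =
      (\<Prod>i<m. s (of_nat (Suc i) * g) * (s (a + b + of_nat i * g) * s (c + b + of_nat i * g) * s (d + b + of_nat i * g))) *
      (A m * (s (of_nat (n - m) * g) * s (\<sigma> + (of_nat (n + m) - 1) * g)))"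
      using Suc by (simp only: prod.lessThan_Suc mult.assoc[symmetric]) (simp add: mult_ac)
    also have "\<dots> = A (Suc m) * (\<Prod>i<Suc m. s (of_nat (Suc i) * g) * (s (a + b + of_nat i * g) * s (c + b + of_nat i * g) * s (d + b + of_nat i * g)))"
      unfolding rec[OF Suc_le_lessD[OF Suc.prems]] by (simp only: prod.lessThan_Suc mult_ac)
    finally show ?case .
  qed simp
  have An: "A n = S n g a b c d" unfolding A_def S_def newton_coeff_same by simp
  have A0: "A 0 = S n g a (b + 1) c d * ((\<Prod>i<n. s (a + b + of_nat i * g)) * (\<Prod>i<n. s (b - a - of_nat i * g)))"
  proof -
    have "A 0 = infsum (\<lambda>l. weight n g a (b + 1) c d l * (\<Prod>k=1..n. s (b + rh n g a k) * s (b - rh n g a k))) (Lam n)"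
      unfolding A_def newton_coeff_0 using weight_shift[OF reg(1)]
      by (intro infsum_cong) (simp add: node_def)
    also have "\<dots> = S n g a (b + 1) c d * (\<Prod>k=1..n. s (b + rh n g a k) * s (b - rh n g a k))"
      unfolding S_def by (rule infsum_cmult_left')
    also have "(\<Prod>k=1..n. s (b + rh n g a k) * s (b - rh n g a k)) = (\<Prod>i<n. s (a + b + of_nat i * g) * s (b - a - of_nat i * g))"
      by (rule prod.reindex_bij_witness[of _ "\<lambda>i. n - i" "\<lambda>k. n - k"]) (auto simp: rh_def algebra_simps)
    finally show ?thesis by (simp add: prod.distrib)
  qed
  have nz1: "(\<Prod>i<n. s (of_nat (Suc i) * g)) \<noteq> 0"
    using strongly_generic_diff[OF sg, of "Suc _" 0] by (simp del: of_nat_Suc)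
  have nz2: "(\<Prod>i<n. s (a + b + of_nat i * g)) \<noteq> 0"
  proof -
    have "s (a + b + of_nat i * g) \<noteq> 0" if "i < n" for i
    proof -
      have "s (1 - (b + 1) - a - of_nat i * g + of_nat 0) \<noteq> 0" using reg2 that unfolding regular2_def by blast
      moreover have "1 - (b + 1) - a - of_nat i * g + of_nat 0 = - (a + b + of_nat i * g)" by simp
      ultimately show ?thesis using s_minus[of "a + b + of_nat i * g"] by (metis neg_equal_0_iff_equal)
    qed
    thus ?thesis by simp
  qed
  have refl: "(\<Prod>i<n. s (of_nat (n - i) * g)) = (\<Prod>i<n. s (of_nat (Suc i) * g))"
    by (rule prod.reindex_bij_witness[of _ "\<lambda>i. n - Suc i" "\<lambda>i. n - Suc i"]) (auto simp: Suc_diff_Suc simp del: of_nat_Suc)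
  have shift: "\<sigma> + (of_nat (n + i) - 1) * g = a + b + c + d + of_nat (n - 1 + i) * g" for i
    using n by (simp add: \<sigma>_def of_nat_diff)
  have "S n g a (b + 1) c d * (\<Prod>m<n. s (a + b + c + d + of_nat (n - 1 + m) * g) * s (b - a - of_nat m * g)) *
      ((\<Prod>i<n. s (of_nat (Suc i) * g)) * (\<Prod>i<n. s (a + b + of_nat i * g)))
    = S n g a b c d * (\<Prod>m<n. s (b + c + of_nat m * g) * s (b + d + of_nat m * g)) *
      ((\<Prod>i<n. s (of_nat (Suc i) * g)) * (\<Prod>i<n. s (a + b + of_nat i * g)))"
    using prods[OF order_refl] unfolding An A0 prod.distrib refl shift
    by (simp only: add.commute[of c b] add.commute[of d b] mult_ac)
  thus ?thesis using nz1 nz2 by simp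
qed

end

section \<open>Evaluation of the series\<close>

text \<open>\<open>G x\<close> is \<open>(q\<^sup>x; q)\<^sub>\<infinity>\<close> or \<open>1 / \<Gamma>(x)\<close>.\<close>
locale sfun_full = sfun_growth +
  fixes t \<kappa> G :: "complex \<Rightarrow> complex"
  assumes s_t: "s x = \<kappa> x * t x"
    and \<kappa>_add: "\<kappa> (x + y) = \<kappa> x * \<kappa> y"
    and \<kappa>_nonzero: "\<kappa> x \<noteq> 0"
    and G_rec: "G x = t x * G (x + 1)"
    and G_nonzero: "(\<And>i::nat. s (x + of_nat i) \<noteq> 0) \<Longrightarrow> G x \<noteq> 0"
    and continuous_G: "continuous_on UNIV G"
    and G_limit: "finite I \<Longrightarrow> sum ys I = sum zs (I :: (nat \<times> bool) set) \<Longrightarrow>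
        (\<lambda>M. (\<Prod>i\<in>I. G (ys i + of_nat M)) / (\<Prod>i\<in>I. G (zs i + of_nat M))) \<longlonglongrightarrow> 1"
    and countable_zeros: "countable {x. s x = 0}"
begin

lemma tendsto_G: "(h \<longlongrightarrow> L) F \<Longrightarrow> ((\<lambda>x. G (h x)) \<longlongrightarrow> G L) F"
  by (rule continuous_on_tendsto_compose[OF continuous_G]) auto

lemma \<kappa>_prod: "finite I \<Longrightarrow> (\<Prod>i\<in>I. \<kappa> (x i)) = \<kappa> (\<Sum>i\<in>I. x i)"
proof (induction I rule: finite_induct)
  case empty
  have "\<kappa> 0 * \<kappa> 0 = \<kappa> 0" using \<kappa>_add[of 0 0] by simp
  thus ?case using \<kappa>_nonzero[of 0] by simp
qed (simp add: \<kappa>_add)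

text \<open>\<open>N0\<close> is the right-hand side after telescoping the products over pairs, \<open>N_part\<close> its dependence on \<open>b\<close>.\<close>
definition N_part :: "nat \<Rightarrow> complex \<Rightarrow> complex \<Rightarrow> complex \<Rightarrow> complex \<Rightarrow> complex \<Rightarrow> complex" where
  "N_part n g a b c d =
     (\<Prod>m<n. G (1 - b - c - of_nat m * g) * G (1 - b - d - of_nat m * g)) /
     (\<Prod>m<n. G (1 - (a + b + c + d) - of_nat (n - 1 + m) * g) * G (1 - b + a + of_nat m * g))"

definition N0 :: "nat \<Rightarrow> complex \<Rightarrow> complex \<Rightarrow> complex \<Rightarrow> complex \<Rightarrow> complex \<Rightarrow> complex" where
  "N0 n g a b c d =
     (\<Prod>m<n. G (1 + 2 * a + of_nat (n - 1 + m) * g) * (G (1 - b - c - of_nat m * g) *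
              G (1 - b - d - of_nat m * g) * G (1 - c - d - of_nat m * g))) /
     (\<Prod>m<n. G (1 - (a + b + c + d) - of_nat (n - 1 + m) * g) * (G (1 - b + a + of_nat m * g) *
              G (1 - c + a + of_nat m * g) * G (1 - d + a + of_nat m * g)))"

lemma N0_commute: "N0 n g a b c d = N0 n g a c b d" "N0 n g a b c d = N0 n g a d c b"
proof -
  have "1 - b - c - x = 1 - c - b - x" "1 - b - d - x = 1 - d - b - x" "1 - c - d - x = 1 - d - c - x"
     "a + b + c + d = a + c + b + d" "a + b + c + d = a + d + c + b" for x
    by (auto simp: algebra_simps)
  thus "N0 n g a b c d = N0 n g a c b d" "N0 n g a b c d = N0 n g a d c b"
    unfolding N0_def by (simp_all only: mult_ac)
qed

lemma N0_N_part: "N0 n g a b c d = N_part n g a b c d *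
   ((\<Prod>m<n. G (1 + 2 * a + of_nat (n - 1 + m) * g) * G (1 - c - d - of_nat m * g)) /
    (\<Prod>m<n. G (1 - c + a + of_nat m * g) * G (1 - d + a + of_nat m * g)))"
  unfolding N0_def N_part_def prod.distrib by (simp add: mult_ac)

text \<open>The real part is affine in \<open>w\<close>, and convergence makes it positive at both
  ends \<open>w = 0\<close> and \<open>w = 2 (n - 1)\<close>; zeros of \<open>s\<close> have real
  part 0.\<close>

lemma converges_nz':
  assumes "n \<ge> 1" "converges n g \<sigma>" "w \<le> 2 * (n - 1)"
  shows "s (1 - \<sigma> - of_nat w * g + of_nat i) \<noteq> 0"
proof -
  have 1: "1 - Re \<sigma> > 0" and 2: "1 - Re \<sigma> - 2 * real (n - 1) * Re g > 0"
    using bspec[OF assms(2)[unfolded converges_def], of n] bspec[OF assms(2)[unfolded converges_def], of 1] assms(1)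
    by auto
  have "1 - Re \<sigma> - real w * Re g > 0"
  proof (cases "Re g \<ge> 0")
    case True
    have "real w * Re g \<le> real (2 * (n - 1)) * Re g"
      using assms(3) True by (intro mult_right_mono) (simp_all only: of_nat_le_iff)
    thus ?thesis using 2 by simp
  next
    case False
    hence "real w * Re g \<le> 0" by (simp add: mult_nonneg_nonpos)
    thus ?thesis using 1 by simp
  qed
  hence "Re (1 - \<sigma> - of_nat w * g + of_nat i) > 0" by simp
  thus ?thesis using Re_eq_0_if_s by fastforce
qed

lemma converges_nz:
  assumes "n \<ge> 1" "converges n g \<sigma>" "m < n"
  shows "s (1 - \<sigma> - of_nat (n - 1 + m) * g + of_nat i) \<noteq> 0"
  using assms by (intro converges_nz') auto

lemma converges_mono: "converges n g \<sigma> \<Longrightarrow> Re \<sigma>' \<le> Re \<sigma> \<Longrightarrow> converges n g \<sigma>'"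
  unfolding converges_def by force

lemma regular_mono: "regular n g a v \<Longrightarrow> regular n g a (v - of_nat K)"
  unfolding regular_def
proof (intro allI impI)
  fix w i assume *: "\<forall>w<n. \<forall>i::nat. s (1 - v + a + of_nat w * g + of_nat i) \<noteq> 0" "w < n"
  hence "s (1 - v + a + of_nat w * g + of_nat (i + K)) \<noteq> 0" by blast
  thus "s (1 - (v - of_nat K) + a + of_nat w * g + of_nat i) \<noteq> 0" by (simp add: algebra_simps)
qed

lemma regular2_mono: "regular2 n g a v \<Longrightarrow> regular2 n g a (v - of_nat K)"
  unfolding regular2_def
proof (intro allI impI)
  fix w i assume *: "\<forall>w<n. \<forall>i::nat. s (1 - v - a - of_nat w * g + of_nat i) \<noteq> 0" "w < n"
  hence "s (1 - v - a - of_nat w * g + of_nat (i + K)) \<noteq> 0" by blast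
  thus "s (1 - (v - of_nat K) - a - of_nat w * g + of_nat i) \<noteq> 0" by (simp add: algebra_simps)
qed

lemma sum_lessThan_of_nat: "(\<Sum>m<n. of_nat m :: complex) * 2 = of_nat n * (of_nat n - 1)"
  by (induction n) (auto simp: algebra_simps)

text \<open>A unit shift of \<open>G\<close> produces \<open>t\<close>, while the recurrence of the
  series has \<open>s\<close>, the product of \<open>\<kappa>\<close> and \<open>t\<close>. As
  \<open>\<kappa>\<close> is multiplicative, the discrepancy depends only on the sums of the
  arguments, which agree on the two sides.\<close>

lemma N_part_recurrence:
  assumes n: "n \<ge> 1" and conv: "converges n g (a + (b + 1) + c + d)" and reg: "regular n g a (b + 1)"
  shows "N_part n g a (b + 1) c d * (\<Prod>m<n. s (a + b + c + d + of_nat (n - 1 + m) * g) * s (b - a - of_nat m * g))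
    = N_part n g a b c d * (\<Prod>m<n. s (b + c + of_nat m * g) * s (b + d + of_nat m * g))"
proof -
  define \<sigma> where "\<sigma> = a + b + c + d"
  define p1 where "p1 = (\<lambda>m. - b - c - of_nat m * g)"
  define p2 where "p2 = (\<lambda>m. - b - d - of_nat m * g)"
  define p3 where "p3 = (\<lambda>m. - \<sigma> - of_nat (n - 1 + m) * g)"
  define p4 where "p4 = (\<lambda>m. - b + a + of_nat m * g)"
  have G3: "G (p3 m) \<noteq> 0" if "m < n" for m
  proof (rule G_nonzero)
    fix i
    show "s (p3 m + of_nat i) \<noteq> 0"
      using converges_nz[OF n conv that, of i] by (simp add: p3_def \<sigma>_def algebra_simps)
  qed
  have G4: "G (p4 m) \<noteq> 0" if "m < n" for m
  proof (rule G_nonzero)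
    fix i
    have "s (1 - (b + 1) + a + of_nat m * g + of_nat i) \<noteq> 0" using reg that unfolding regular_def by blast
    thus "s (p4 m + of_nat i) \<noteq> 0" by (simp add: p4_def)
  qed
  have N1: "N_part n g a (b + 1) c d = (\<Prod>m<n. G (p1 m) * G (p2 m)) / (\<Prod>m<n. G (p3 m) * G (p4 m))"
    unfolding N_part_def p1_def p2_def p3_def p4_def \<sigma>_def by (simp add: algebra_simps)
  have N2: "N_part n g a b c d = (\<Prod>m<n. G (p1 m + 1) * G (p2 m + 1)) / (\<Prod>m<n. G (p3 m + 1) * G (p4 m + 1))"
    unfolding N_part_def p1_def p2_def p3_def p4_def \<sigma>_def by (simp add: algebra_simps)
  have \<kappa>: "(\<Prod>m<n. \<kappa> (p1 m) * \<kappa> (p2 m)) = (\<Prod>m<n. \<kappa> (p3 m) * \<kappa> (p4 m))"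
  proof -
    have "(\<Sum>m<n. p3 m + p4 m) = (\<Sum>m<n. p1 m + p2 m)"
    proof -
      have A: "(\<Sum>m<n. p3 m + p4 m) = of_nat n * (- 2 * b - c - d - (of_nat n - 1) * g)"
        using n by (simp add: p3_def p4_def \<sigma>_def of_nat_diff algebra_simps)
      have B: "(\<Sum>m<n. p1 m + p2 m) = of_nat n * (- 2 * b - c - d) - (\<Sum>m<n. of_nat m) * 2 * g"
        by (simp add: p1_def p2_def sum.distrib sum_subtractf sum_distrib_right sum_distrib_left algebra_simps)
      show ?thesis unfolding A B sum_lessThan_of_nat by (simp add: algebra_simps)
    qed
    thus ?thesis unfolding \<kappa>_add[symmetric] by (simp add: \<kappa>_prod)
  qed
  have S12: "(\<Prod>m<n. s (b + c + of_nat m * g) * s (b + d + of_nat m * g)) = (\<Prod>m<n. s (p1 m) * s (p2 m))"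
  proof (intro prod.cong refl)
    fix m
    have "p1 m = - (b + c + of_nat m * g)" "p2 m = - (b + d + of_nat m * g)" by (auto simp: p1_def p2_def)
    thus "s (b + c + of_nat m * g) * s (b + d + of_nat m * g) = s (p1 m) * s (p2 m)" by (simp only: s_minus) simp
  qed
  have S34: "(\<Prod>m<n. s (a + b + c + d + of_nat (n - 1 + m) * g) * s (b - a - of_nat m * g)) = (\<Prod>m<n. s (p3 m) * s (p4 m))"
  proof (intro prod.cong refl)
    fix m
    have "p3 m = - (a + b + c + d + of_nat (n - 1 + m) * g)" "p4 m = - (b - a - of_nat m * g)" 
      by (auto simp: p3_def p4_def \<sigma>_def)
    thus "s (a + b + c + d + of_nat (n - 1 + m) * g) * s (b - a - of_nat m * g) = s (p3 m) * s (p4 m)" by (simp only: s_minus) simp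
  qed
  have "(\<Prod>m<n. G (p3 m) * G (p4 m)) \<noteq> 0" using G3 G4 by simp
  moreover have "(\<Prod>m<n. G (p3 m) * G (p4 m)) = (\<Prod>m<n. t (p3 m) * t (p4 m)) * (\<Prod>m<n. G (p3 m + 1) * G (p4 m + 1))"
    unfolding prod.distrib[symmetric] by (subst (1 2) G_rec) (simp add: mult_ac)
  moreover have "(\<Prod>m<n. G (p1 m) * G (p2 m)) = (\<Prod>m<n. t (p1 m) * t (p2 m)) * (\<Prod>m<n. G (p1 m + 1) * G (p2 m + 1))"
    unfolding prod.distrib[symmetric] by (subst (1 2) G_rec) (simp add: mult_ac)
  ultimately have "N_part n g a (b + 1) c d * (\<Prod>m<n. t (p3 m) * t (p4 m)) = N_part n g a b c d * (\<Prod>m<n. t (p1 m) * t (p2 m))"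
    unfolding N1 N2 by (simp add: field_simps)
  note tt = this
  have "N_part n g a (b + 1) c d * (\<Prod>m<n. s (p3 m) * s (p4 m))
     = (\<Prod>m<n. \<kappa> (p3 m) * \<kappa> (p4 m)) * (N_part n g a (b + 1) c d * (\<Prod>m<n. t (p3 m) * t (p4 m)))"
    unfolding s_t prod.distrib by (simp only: mult_ac)
  also have "\<dots> = (\<Prod>m<n. \<kappa> (p1 m) * \<kappa> (p2 m)) * (N_part n g a b c d * (\<Prod>m<n. t (p1 m) * t (p2 m)))"
    unfolding tt \<kappa> ..
  also have "\<dots> = N_part n g a b c d * (\<Prod>m<n. s (p1 m) * s (p2 m))"
    unfolding s_t prod.distrib by (simp only: mult_ac)
  finally show ?thesis unfolding S12 S34 .
qed

lemma recurrence_nz: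
  assumes n: "n \<ge> 1" and conv: "converges n g (a + (b + 1) + c + d)" and reg: "regular n g a (b + 1)"
  shows "(\<Prod>m<n. s (a + b + c + d + of_nat (n - 1 + m) * g) * s (b - a - of_nat m * g)) \<noteq> 0"
proof -
  have "s (a + b + c + d + of_nat (n - 1 + m) * g) * s (b - a - of_nat m * g) \<noteq> 0" if "m < n" for m
  proof -
    have "s (1 - (a + (b + 1) + c + d) - of_nat (n - 1 + m) * g + of_nat 0) \<noteq> 0"
      by (rule converges_nz[OF n conv that])
    also have "1 - (a + (b + 1) + c + d) - of_nat (n - 1 + m) * g + of_nat 0 = - (a + b + c + d + of_nat (n - 1 + m) * g)" by simp
    finally have 1: "s (a + b + c + d + of_nat (n - 1 + m) * g) \<noteq> 0" unfolding s_minus by simp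
    have "s (1 - (b + 1) + a + of_nat m * g + of_nat 0) \<noteq> 0" using reg that unfolding regular_def by blast
    also have "1 - (b + 1) + a + of_nat m * g + of_nat 0 = - (b - a - of_nat m * g)" by simp
    finally have "s (b - a - of_nat m * g) \<noteq> 0" unfolding s_minus by simp
    with 1 show ?thesis by simp
  qed
  thus ?thesis by simp
qed

lemma S_eq_N0_step:
  assumes n: "n \<ge> 1" and sg: "strongly_generic g a"
    and reg: "regular n g a (b + 1)" "regular n g a c" "regular n g a d" and reg2: "regular2 n g a (b + 1)"
    and conv: "converges n g (a + (b + 1) + c + d)"
    and eq: "S n g a b c d = N0 n g a b c d"
  shows "S n g a (b + 1) c d = N0 n g a (b + 1) c d"
proof -
  define D where "D = (\<Prod>m<n. s (a + b + c + d + of_nat (n - 1 + m) * g) * s (b - a - of_nat m * g))"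
  define U where "U = (\<Prod>m<n. s (b + c + of_nat m * g) * s (b + d + of_nat m * g))"
  have "D \<noteq> 0" unfolding D_def by (rule recurrence_nz[OF n conv reg(1)])
  moreover have "S n g a (b + 1) c d * D = S n g a b c d * U"
    unfolding D_def U_def by (rule S_recurrence[OF n sg reg reg2 conv])
  moreover have "N0 n g a (b + 1) c d * D = N0 n g a b c d * U"
    using N_part_recurrence[OF n conv reg(1), folded D_def U_def] unfolding N0_N_part
    by (simp add: mult_ac)
  ultimately show ?thesis using eq by (metis mult_right_cancel)
qed

text \<open>Numerator and denominator have \<open>2 n\<close> factors each, with equal sums of
  arguments; this balance is what \<open>G_limit\<close> asks for. The Boolean tells apart the two
  factors belonging to each \<open>m\<close>.\<close>

lemma N_part_limit:
  assumes n: "n \<ge> 1"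
  shows "(\<lambda>M. N_part n g a (b - of_nat M) c d) \<longlonglongrightarrow> 1"
proof -
  define y where "y = (\<lambda>(m, r::bool). if r then 1 - b - c - of_nat m * g else 1 - b - d - of_nat m * g)"
  define z where "z = (\<lambda>(m, r::bool). if r then 1 - (a + b + c + d) - of_nat (n - 1 + m) * g else 1 - b + a + of_nat m * g)"
  define I where "I = {..<n} \<times> (UNIV :: bool set)"
  have spl: "(\<Prod>i\<in>I. h i) = (\<Prod>m<n. h (m, True) * h (m, False))" for h :: "nat \<times> bool \<Rightarrow> complex"
    unfolding I_def prod.cartesian_product' UNIV_bool by (simp add: mult.commute)
  have spl2: "(\<Sum>i\<in>I. h i) = (\<Sum>m<n. h (m, True) + h (m, False))" for h :: "nat \<times> bool \<Rightarrow> complex"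
    unfolding I_def sum.cartesian_product' UNIV_bool by (simp add: add.commute)
  have "(\<lambda>M. (\<Prod>i\<in>I. G (y i + of_nat M)) / (\<Prod>i\<in>I. G (z i + of_nat M))) \<longlonglongrightarrow> 1"
  proof (rule G_limit)
    show "sum y I = sum z I"
    proof -
      have A: "sum y I = of_nat n * (2 - 2 * b - c - d) - (\<Sum>m<n. of_nat m) * 2 * g"
        unfolding spl2 by (simp add: y_def sum.distrib sum_subtractf sum_distrib_right sum_distrib_left algebra_simps)
      have B: "sum z I = of_nat n * (2 - 2 * b - c - d - (of_nat n - 1) * g)"
        unfolding spl2 using n by (simp add: z_def of_nat_diff algebra_simps)
      show ?thesis unfolding A B sum_lessThan_of_nat by (simp add: algebra_simps)
    qed
  qed (simp add: I_def)
  thus ?thesis unfolding spl N_part_def y_def z_def by (simp add: algebra_simps)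
qed

lemma single_factor_far_bound:
  assumes "\<kappa>0 > 0"
  shows "\<exists>C\<ge>0. \<forall>\<^sub>F M in sequentially. \<forall>m. norm (single_factor (b - of_nat M) x m) \<le> C * e m powr \<kappa>0"
proof -
  obtain C where C: "C \<ge> 0" "\<forall>\<^sub>F M in sequentially. \<forall>m. norm (sp (x - (- b) - of_nat M) m / sp (1 + x + (- b) + of_nat M) m) \<le> C * e m powr 0"
    using sp_far_bound[of x "- b"] by blast
  from C(2) have "\<forall>\<^sub>F M in sequentially. \<forall>m. norm (single_factor (b - of_nat M) x m) \<le> C * e m powr \<kappa>0"
  proof eventually_elim
    case (elim M)
    show ?case
    proof
      fix m
      have "b - of_nat M + x = x - (- b) - of_nat M" "1 - (b - of_nat M) + x = 1 + x + (- b) + of_nat M"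
        by (auto simp: algebra_simps)
      hence "norm (single_factor (b - of_nat M) x m) \<le> C * e m powr 0"
        unfolding single_factor_def using elim by metis
      also have "\<dots> \<le> C * e m powr \<kappa>0"
        using C(1) assms e_ge_1[of m] by (intro mult_left_mono powr_mono) auto
      finally show "norm (single_factor (b - of_nat M) x m) \<le> C * e m powr \<kappa>0" .
    qed
  qed
  thus ?thesis using C(1) by blast
qed

text \<open>\<open>T\<close> is chosen before \<open>b\<close>: the limits from
  \<open>s_far_limit\<close> do not depend on \<open>u = - b\<close>, so neither does the limiting
  weight \<open>W\<close>. The factor with \<open>b\<close> is merely bounded along the way, so
  \<open>a\<close>, \<open>c\<close>, \<open>d\<close> alone must provide the decay.\<close>

lemma S_limit:
  assumes n: "n \<ge> 1" and sg: "strongly_generic g a" and reg: "regular n g a c" "regular n g a d"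
    and conv: "\<And>j. j \<in> {1..n} \<Longrightarrow> 4 * real (n - j) * Re g + 2 * Re (a + c + d) - 1 < 0"
  obtains T where "\<And>b. (\<lambda>M. S n g a (b - of_nat M) c d) \<longlonglongrightarrow> T"
proof -
  define L where "L = (\<lambda>x. SOME L. \<forall>u. (\<lambda>M. s (x - u - of_nat M) / s (1 + x + u + of_nat M)) \<longlonglongrightarrow> L)"
  have L: "(\<lambda>M. s (x - u - of_nat M) / s (1 + x + u + of_nat M)) \<longlonglongrightarrow> L x" for x u
    unfolding L_def using someI_ex[OF s_far_limit[of x]] by blast
  define r where "r = rh n g a"
  define W where "W = (\<lambda>l. (\<Prod>j=1..n. \<Prod>k\<in>{j<..n}. pair_factor g (r j + r k) (l j + l k) * pair_factor g (r j - r k) (l j - l k)) *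
     (\<Prod>j=1..n. s (2 * r j + 2 * of_nat (l j)) / s (2 * r j) *
        (single_factor a (r j) (l j) * (\<Prod>i<l j. L (r j + of_nat i)) * single_factor c (r j) (l j) * single_factor d (r j) (l j))))"
  have "(\<lambda>M. S n g a (b - of_nat M) c d) \<longlonglongrightarrow> infsum W (Lam n)" for b
  proof -
    have "\<exists>C \<eta>. C \<ge> 0 \<and> \<eta> < 0 \<and> (\<forall>\<^sub>F M in sequentially. \<forall>l\<in>Lam n.
        norm (weight n g a (b - of_nat M) c d l) \<le> C * (\<Prod>j=1..n. e (l j) powr (\<eta> - 0) / \<omega> (l j)))"
      using conv by (intro weight_dominated[OF n tendsto_const tendsto_const strongly_generic_admissible[OF sg] regular_self[OF sg] reg, where ?\<kappa>0.0 = 0]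
          single_factor_far_bound) auto
    then obtain C \<eta> where C: "C \<ge> 0" "\<eta> < 0" "\<forall>\<^sub>F M in sequentially. \<forall>l\<in>Lam n.
        norm (weight n g a (b - of_nat M) c d l) \<le> C * (\<Prod>j=1..n. e (l j) powr \<eta> / \<omega> (l j))" by auto
    have sf: "(\<lambda>M. single_factor (b - of_nat M) (r j) m) \<longlonglongrightarrow> (\<Prod>i<m. L (r j + of_nat i))" for j m
    proof -
      have "(\<lambda>M. \<Prod>i<m. s (r j + of_nat i - (- b) - of_nat M) / s (1 + (r j + of_nat i) + (- b) + of_nat M)) \<longlonglongrightarrow> (\<Prod>i<m. L (r j + of_nat i))"
        by (intro tendsto_prod L)
      moreover have "single_factor (b - of_nat M) (r j) m = (\<Prod>i<m. s (r j + of_nat i - (- b) - of_nat M) / s (1 + (r j + of_nat i) + (- b) + of_nat M))" for M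
        unfolding single_factor_def sp_ratio by (simp add: algebra_simps)
      ultimately show ?thesis by simp
    qed
    show ?thesis unfolding S_def
    proof (rule infsum_tendsto_dominated(2)[OF summable_on_majorant[OF C(2)] C(3)])
      show "(\<lambda>M. weight n g a (b - of_nat M) c d l) \<longlonglongrightarrow> W l" for l
        unfolding weight_def W_def r_def[symmetric] by (intro tendsto_mult tendsto_prod tendsto_const sf)
    qed
  qed
  thus ?thesis using that by blast
qed

lemma S_terminating:
  assumes n: "n \<ge> 1" and sg: "strongly_generic g a"
  shows "S n g a (- a - of_nat (n - 1) * g) c d = 1"
proof -
  define b where "b = - a - of_nat (n - 1) * g"
  define l0 where "l0 = (\<lambda>j. if j \<in> {1..n} then 0 else (undefined :: nat))"
  have l0: "l0 \<in> Lam n" by (auto simp: l0_def Lam_def)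
  have "weight n g a b c d l = 0" if l: "l \<in> Lam n - {l0}" for l
  proof -
    have "l 1 \<noteq> 0"
    proof
      assume "l 1 = 0"
      hence "l j = 0" if "j \<in> {1..n}" for j using LamD[of l n 1 j] l that by auto
      hence "l = l0" using l by (auto simp: l0_def Lam_def PiE_def extensional_def)
      thus False using l by simp
    qed
    \<comment> \<open>\<open>b + rh n g a 1 = 0\<close>, so the first factor of \<open>sp\<close> is
      \<open>s 0\<close> as soon as \<open>l 1\<close> is positive.\<close>
    hence "sp (b + rh n g a 1) (l 1) = 0"
      by (auto simp: sp_eq_0_iff b_def rh_def intro!: exI[of _ 0])
    hence "single_factor b (rh n g a 1) (l 1) = 0" by (simp add: single_factor_def)
    hence "(\<Prod>j=1..n. s (2 * rh n g a j + 2 * of_nat (l j)) / s (2 * rh n g a j) *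
        (single_factor a (rh n g a j) (l j) * single_factor b (rh n g a j) (l j) *
         single_factor c (rh n g a j) (l j) * single_factor d (rh n g a j) (l j))) = 0"
      using n by (intro prod_zero bexI[of _ 1]) auto
    thus ?thesis by (simp add: weight_def)
  qed
  hence "S n g a b c d = infsum (weight n g a b c d) {l0}"
    unfolding S_def using l0 by (intro infsum_cong_neutral) auto
  also have "\<dots> = weight n g a b c d l0" by simp
  also have "\<dots> = 1"
  proof -
    have "pair_factor g (rh n g a j + rh n g a k) (l0 j + l0 k) * pair_factor g (rh n g a j - rh n g a k) (l0 j - l0 k) = 1"
      if "j \<in> {1..n}" "k \<in> {j<..n}" for j k
      using that rh_sum_nz[OF sg, of n j k 0] rh_diff_nz[OF sg, of j k n 0] by (simp add: l0_def pair_factor_def)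
    moreover have "s (2 * rh n g a j + 2 * of_nat (l0 j)) / s (2 * rh n g a j) *
        (single_factor a (rh n g a j) (l0 j) * single_factor b (rh n g a j) (l0 j) *
         single_factor c (rh n g a j) (l0 j) * single_factor d (rh n g a j) (l0 j)) = 1" if "j \<in> {1..n}" for j
      using that rh_double_nz[OF sg, of n j 0] by (simp add: l0_def single_factor_def)
    ultimately show ?thesis unfolding weight_def by simp
  qed
  finally show ?thesis unfolding b_def .
qed

lemma N0_terminating:
  assumes n: "n \<ge> 1" and sg: "strongly_generic g a" and reg: "regular n g a c" "regular n g a d"
    and conv: "converges n g (a + (- a - of_nat (n - 1) * g) + c + d)"
  shows "N0 n g a (- a - of_nat (n - 1) * g) c d = 1"
proof -
  define b where "b = - a - of_nat (n - 1) * g"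
  define A where "A = (\<lambda>m. G (1 + 2 * a + of_nat (n - 1 + m) * g))"
  define P where "P = (\<lambda>v m. G (1 - v + a + of_nat m * g))"
  define Q where "Q = (\<lambda>m. G (1 - c - d - of_nat m * g))"
  \<comment> \<open>The reversal of \<open>m\<close> into \<open>n - 1 - m\<close> matches the
    numerator factors containing \<open>b\<close> with the denominator factors
    \<open>P v\<close>.\<close>
  have refl: "(\<Prod>m<n. G (1 - b - v - of_nat m * g)) = (\<Prod>m<n. P v m)" for v
  proof (rule prod.reindex_bij_witness[of _ "\<lambda>i. n - Suc i" "\<lambda>i. n - Suc i"])
    fix m assume "m \<in> {..<n}"
    hence m: "m < n" by simp
    have eq: "1 - v + a + of_nat (n - Suc m) * g = 1 - b - v - of_nat m * g"
      using m n by (simp add: b_def of_nat_diff algebra_simps)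
    show "P v (n - Suc m) = G (1 - b - v - of_nat m * g)" unfolding P_def eq ..
  qed auto
  have e1: "G (1 - (a + b + c + d) - of_nat (n - 1 + m) * g) = Q m" for m
    using n by (simp add: Q_def b_def of_nat_diff algebra_simps)
  have e2: "G (1 - b + a + of_nat m * g) = A m" for m
    using n by (simp add: A_def b_def of_nat_diff algebra_simps)
  have Pnz: "P v m \<noteq> 0" if "regular n g a v" "m < n" for v m
    unfolding P_def using that by (intro G_nonzero) (auto simp: regular_def)
  have Qnz: "Q m \<noteq> 0" if "m < n" for m
    unfolding e1[symmetric] by (rule G_nonzero, rule converges_nz[OF n _ that]) (use conv in \<open>simp add: b_def\<close>)
  have Anz: "A m \<noteq> 0" for m
    unfolding A_def
  proof (rule G_nonzero)
    fix i
    show "s (1 + 2 * a + of_nat (n - 1 + m) * g + of_nat i) \<noteq> 0"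
      using strongly_generic_sum[OF sg, of "n + m" "Suc i"] n by (simp add: of_nat_diff algebra_simps)
  qed
  have "N0 n g a b c d = (prod A {..<n} * (prod (P c) {..<n} * prod (P d) {..<n} * prod Q {..<n})) /
     (prod Q {..<n} * (prod A {..<n} * prod (P c) {..<n} * prod (P d) {..<n}))"
    unfolding N0_def prod.distrib refl e1 e2 by (simp add: A_def P_def Q_def)
  also have "\<dots> = 1" using Anz Qnz Pnz reg by simp
  finally show ?thesis unfolding b_def .
qed

text \<open>Quotient of the recurrences for \<open>S\<close> and \<open>N_part\<close>, iterated towards \<open>b \<rightarrow> -\<infinity>\<close>.\<close>
lemma S_eq_far:
  assumes n: "n \<ge> 1" and sg: "strongly_generic g a"
    and reg: "regular n g a b" "regular n g a c" "regular n g a d" and reg2: "regular2 n g a b"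
    and conv: "converges n g (a + b + c + d)"
    and far: "\<And>b. (\<lambda>M. S n g a (b - of_nat M) c d) \<longlonglongrightarrow> T"
  shows "S n g a b c d = N_part n g a b c d * T"
proof -
  define D where "D = (\<lambda>M. (\<Prod>m<n. s (a + (b - of_nat (Suc M)) + c + d + of_nat (n - 1 + m) * g) * s ((b - of_nat (Suc M)) - a - of_nat m * g)))"
  define U where "U = (\<lambda>M. (\<Prod>m<n. s ((b - of_nat (Suc M)) + c + of_nat m * g) * s ((b - of_nat (Suc M)) + d + of_nat m * g)))"
  have b1: "(b - of_nat (Suc M)) + 1 = b - of_nat M" for M by simp
  have cv: "converges n g (a + (b - of_nat M) + c + d)" for M
    by (rule converges_mono[OF conv]) simp
  have Dnz: "D M \<noteq> 0" for M
    unfolding D_def by (rule recurrence_nz[OF n]) (unfold b1, rule cv, rule regular_mono[OF reg(1)])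
  have stepS: "S n g a (b - of_nat M) c d = S n g a (b - of_nat (Suc M)) c d * (U M / D M)" for M
  proof -
    have "S n g a (b - of_nat M) c d * D M = S n g a (b - of_nat (Suc M)) c d * U M"
      using S_recurrence[OF n sg, of "b - of_nat (Suc M)" c d, unfolded b1,
          OF regular_mono[OF reg(1)] reg(2,3) regular2_mono[OF reg2] cv]
      unfolding D_def U_def .
    thus ?thesis using Dnz[of M] by (simp add: field_simps del: of_nat_Suc)
  qed
  have stepN: "N_part n g a (b - of_nat M) c d = N_part n g a (b - of_nat (Suc M)) c d * (U M / D M)" for M
  proof -
    have "N_part n g a (b - of_nat M) c d * D M = N_part n g a (b - of_nat (Suc M)) c d * U M"
      using N_part_recurrence[OF n, of g a "b - of_nat (Suc M)" c d, unfolded b1, OF cv regular_mono[OF reg(1)]]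
      unfolding D_def U_def .
    thus ?thesis using Dnz[of M] by (simp add: field_simps del: of_nat_Suc)
  qed
  define R where "R = (\<lambda>M. \<Prod>i<M. U i / D i)"
  have S: "S n g a b c d = S n g a (b - of_nat M) c d * R M" for M
  proof (induction M)
    case (Suc M)
    have "S n g a b c d = S n g a (b - of_nat (Suc M)) c d * (U M / D M) * R M"
      using Suc unfolding stepS[of M] .
    thus ?case by (simp add: R_def mult_ac)
  qed (simp add: R_def)
  have N: "N_part n g a b c d = N_part n g a (b - of_nat M) c d * R M" for M
  proof (induction M)
    case (Suc M)
    have "N_part n g a b c d = N_part n g a (b - of_nat (Suc M)) c d * (U M / D M) * R M"
      using Suc unfolding stepN[of M] .
    thus ?case by (simp add: R_def mult_ac)
  qed (simp add: R_def)
  have "(\<lambda>M. N_part n g a b c d / N_part n g a (b - of_nat M) c d) \<longlonglongrightarrow> N_part n g a b c d / 1"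
    by (intro tendsto_divide tendsto_const N_part_limit n) simp
  moreover have "\<forall>\<^sub>F M in sequentially. N_part n g a (b - of_nat M) c d \<noteq> 0"
    by (rule tendsto_imp_eventually_ne[OF N_part_limit[OF n]]) simp
  hence "\<forall>\<^sub>F M in sequentially. N_part n g a b c d / N_part n g a (b - of_nat M) c d = R M"
  proof eventually_elim
    case (elim M)
    thus ?case using N[of M] by (metis nonzero_mult_div_cancel_left)
  qed
  ultimately have "R \<longlonglongrightarrow> N_part n g a b c d"
    using tendsto_cong[of "\<lambda>M. N_part n g a b c d / N_part n g a (b - of_nat M) c d" R] by simp
  hence "(\<lambda>M. S n g a (b - of_nat M) c d * R M) \<longlonglongrightarrow> T * N_part n g a b c d"
    by (intro tendsto_mult far)
  moreover have "(\<lambda>M. S n g a (b - of_nat M) c d * R M) \<longlonglongrightarrow> S n g a b c d"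
    unfolding S[symmetric] by (rule tendsto_const)
  ultimately show ?thesis using LIMSEQ_unique by (metis mult.commute)
qed

text \<open>\<open>S_eq_far\<close> at the terminating value \<open>b1\<close> determines
  \<open>T\<close>, which does not depend on \<open>b\<close>; applied again at \<open>b\<close> it
  gives the formula. The regularity of \<open>b1\<close> comes from
  \<open>strongly_generic\<close>.\<close>

lemma S_eq_N0_far:
  assumes n: "n \<ge> 1" and sg: "strongly_generic g a"
    and reg: "regular n g a b" "regular n g a c" "regular n g a d" and reg2: "regular2 n g a b"
    and conv: "converges n g (a + b + c + d)"
    and conv1: "converges n g (a + (- a - of_nat (n - 1) * g) + c + d)"
    and conv2: "\<And>j. j \<in> {1..n} \<Longrightarrow> 4 * real (n - j) * Re g + 2 * Re (a + c + d) - 1 < 0"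
  shows "S n g a b c d = N0 n g a b c d"
proof -
  define b1 where "b1 = - a - of_nat (n - 1) * g"
  obtain T where T: "\<And>b. (\<lambda>M. S n g a (b - of_nat M) c d) \<longlonglongrightarrow> T"
    using S_limit[OF n sg reg(2,3) conv2] by blast
  have r1: "regular n g a b1"
    unfolding regular_def
  proof (intro allI impI)
    fix w i
    show "s (1 - b1 + a + of_nat w * g + of_nat i) \<noteq> 0"
      using strongly_generic_sum[OF sg, of "n + w" "Suc i"] n by (simp add: b1_def of_nat_diff algebra_simps)
  qed
  have r2: "regular2 n g a b1"
    unfolding regular2_def
  proof (intro allI impI)
    fix w i assume "w < n"
    thus "s (1 - b1 - a - of_nat w * g + of_nat i) \<noteq> 0"
      using strongly_generic_diff1[OF sg, of "n - 1 - w" i] n by (simp add: b1_def of_nat_diff algebra_simps)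
  qed
  define K where "K = ((\<Prod>m<n. G (1 + 2 * a + of_nat (n - 1 + m) * g) * G (1 - c - d - of_nat m * g)) /
    (\<Prod>m<n. G (1 - c + a + of_nat m * g) * G (1 - d + a + of_nat m * g)))"
  have "1 = N_part n g a b1 c d * T"
    using S_eq_far[OF n sg r1 reg(2,3) r2 conv1[folded b1_def] T] S_terminating[OF n sg] by (simp add: b1_def)
  moreover have "1 = N_part n g a b1 c d * K"
    using N0_terminating[OF n sg reg(2,3) conv1] unfolding N0_N_part K_def b1_def by simp
  ultimately have "T = K" by (metis mult_left_cancel zero_neq_one mult_zero_left)
  thus ?thesis
    using S_eq_far[OF n sg reg reg2 conv T] unfolding N0_N_part K_def by simp
qed

text \<open>Lowering \<open>c\<close> and \<open>d\<close> by \<open>K\<close> makes the far limit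
  available; then \<open>c\<close> and afterwards \<open>d\<close> are raised one unit at a time.
  The real part of the parameter sum never exceeds its final value, so convergence is
  inherited.\<close>

lemma S_eq_N0_strongly_generic:
  assumes n: "n \<ge> 1" and sg: "strongly_generic g a"
    and reg: "regular n g a b" "regular n g a c" "regular n g a d"
    and reg2: "regular2 n g a b" "regular2 n g a c" "regular2 n g a d"
    and conv: "converges n g (a + b + c + d)"
  shows "S n g a b c d = N0 n g a b c d"
proof -
  \<comment> \<open>Large enough for the two convergence conditions of \<open>S_eq_N0_far\<close>
    that are not inherited, by the estimate \<open>gj\<close>.\<close>
  obtain K :: nat where K: "real K > 4 * real n * \<bar>Re g\<bar> + \<bar>Re a\<bar> + \<bar>Re c\<bar> + \<bar>Re d\<bar> + 1"
    using reals_Archimedean2 by blast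
  have gj: "\<bar>real (n - j) * Re g\<bar> \<le> real n * \<bar>Re g\<bar>" for j
    by (auto simp: abs_mult intro!: mult_right_mono)
  have base: "S n g a b (c - of_nat K) (d - of_nat K) = N0 n g a b (c - of_nat K) (d - of_nat K)"
  proof (rule S_eq_N0_far[OF n sg reg(1) regular_mono[OF reg(2)] regular_mono[OF reg(3)] reg2(1)])
    show "converges n g (a + b + (c - of_nat K) + (d - of_nat K))"
      by (rule converges_mono[OF conv]) simp
    show "converges n g (a + (- a - of_nat (n - 1) * g) + (c - of_nat K) + (d - of_nat K))"
      unfolding converges_def
    proof
      fix j
      have "Re (1 - (a + (- a - of_nat (n - 1) * g) + (c - of_nat K) + (d - of_nat K)) - 2 * of_nat (n - j) * g)
        = 1 + real (n - 1) * Re g - Re c - Re d + 2 * real K - 2 * (real (n - j) * Re g)"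
        by (simp add: algebra_simps del: of_nat_diff)
      thus "Re (1 - (a + (- a - of_nat (n - 1) * g) + (c - of_nat K) + (d - of_nat K)) - 2 * of_nat (n - j) * g) > 0"
        using gj[of 1] gj[of j] K by linarith
    qed
    show "4 * real (n - j) * Re g + 2 * Re (a + (c - of_nat K) + (d - of_nat K)) - 1 < 0" for j
      using gj[of j] K abs_ge_self[of "Re a"] abs_ge_self[of "Re c"] abs_ge_self[of "Re d"] abs_ge_zero[of "Re a"]
        abs_ge_zero[of "Re c"] abs_ge_zero[of "Re d"] mult_nonneg_nonneg[OF of_nat_0_le_iff[of n] abs_ge_zero[of "Re g"]]
      by (simp add: abs_le_iff mult.assoc)
  qed
  have c: "S n g a b (c - of_nat (K - i)) (d - of_nat K) = N0 n g a b (c - of_nat (K - i)) (d - of_nat K)" if "i \<le> K" for i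
    using that
  proof (induction i)
    case 0
    thus ?case using base by simp
  next
    case (Suc i)
    define c' where "c' = c - of_nat (K - i)"
    have c': "c' + 1 = c - of_nat (K - Suc i)" using Suc.prems by (simp add: c'_def of_nat_diff)
    have "S n g a (c' + 1) b (d - of_nat K) = N0 n g a (c' + 1) b (d - of_nat K)"
    proof (rule S_eq_N0_step[OF n sg])
      show "S n g a c' b (d - of_nat K) = N0 n g a c' b (d - of_nat K)"
        using Suc S_commute(1) N0_commute(1) by (simp add: c'_def)
      show "converges n g (a + (c' + 1) + b + (d - of_nat K))"
        by (rule converges_mono[OF conv]) (simp add: c')
      show "regular n g a (c' + 1)" unfolding c' by (rule regular_mono[OF reg(2)])
      show "regular2 n g a (c' + 1)" unfolding c' by (rule regular2_mono[OF reg2(2)])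
      show "regular n g a b" by (rule reg(1))
      show "regular n g a (d - of_nat K)" by (rule regular_mono[OF reg(3)])
    qed
    thus ?case unfolding c' using S_commute(1) N0_commute(1) by metis
  qed
  have d: "S n g a b c (d - of_nat (K - i)) = N0 n g a b c (d - of_nat (K - i))" if "i \<le> K" for i
    using that
  proof (induction i)
    case 0
    thus ?case using c[of K] by simp
  next
    case (Suc i)
    define d' where "d' = d - of_nat (K - i)"
    have d': "d' + 1 = d - of_nat (K - Suc i)" using Suc.prems by (simp add: d'_def of_nat_diff)
    have "S n g a (d' + 1) c b = N0 n g a (d' + 1) c b"
    proof (rule S_eq_N0_step[OF n sg])
      show "S n g a d' c b = N0 n g a d' c b"
        using Suc S_commute(2) N0_commute(2) by (simp add: d'_def)
      show "converges n g (a + (d' + 1) + c + b)"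
        by (rule converges_mono[OF conv]) (simp add: d')
      show "regular n g a (d' + 1)" unfolding d' by (rule regular_mono[OF reg(3)])
      show "regular2 n g a (d' + 1)" unfolding d' by (rule regular2_mono[OF reg2(3)])
      show "regular n g a c" by (rule reg(2))
      show "regular n g a b" by (rule reg(1))
    qed
    thus ?case unfolding d' using S_commute(2) N0_commute(2) by metis
  qed
  from d[of K] show ?thesis by simp
qed

section \<open>Removal of the auxiliary genericity by continuity\<close>

lemma countable_affine_zeros:
  assumes "c \<noteq> 0"
  shows "countable {x::real. s (z + c * of_real x) = 0}"
proof (rule countable_image_inj_on)
  show "countable ((\<lambda>x. z + c * of_real x) ` {x::real. s (z + c * of_real x) = 0})"
    by (rule countable_subset[OF _ countable_zeros]) auto
  show "inj_on (\<lambda>x. z + c * of_real x) {x::real. s (z + c * of_real x) = 0}"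
    using assms by (auto simp: inj_on_def)
qed

lemma tendsto_sp: "x \<longlonglongrightarrow> x0 \<Longrightarrow> (\<lambda>k. sp (x k) m) \<longlonglongrightarrow> sp x0 m"
  unfolding sp_def by (intro tendsto_prod tendsto_s tendsto_add tendsto_const)

lemma tendsto_pair_factor:
  assumes "g \<longlonglongrightarrow> g0" "x \<longlonglongrightarrow> x0" "s x0 \<noteq> 0" "\<And>i::nat. s (1 - g0 + x0 + of_nat i) \<noteq> 0"
  shows "(\<lambda>k. pair_factor (g k) (x k) m) \<longlonglongrightarrow> pair_factor g0 x0 m"
  unfolding pair_factor_def
  by (intro tendsto_mult tendsto_divide tendsto_s tendsto_sp tendsto_add tendsto_diff tendsto_const assms)
     (use assms in \<open>auto simp: sp_eq_0_iff\<close>)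

lemma tendsto_single_factor:
  assumes "v \<longlonglongrightarrow> v0" "x \<longlonglongrightarrow> x0" "\<And>i::nat. s (1 - v0 + x0 + of_nat i) \<noteq> 0"
  shows "(\<lambda>k. single_factor (v k) (x k) m) \<longlonglongrightarrow> single_factor v0 x0 m"
  unfolding single_factor_def
  by (intro tendsto_divide tendsto_sp tendsto_add tendsto_diff tendsto_const assms)
     (use assms in \<open>auto simp: sp_eq_0_iff\<close>)

lemma tendsto_weight:
  assumes g: "g \<longlonglongrightarrow> g0" and a: "a \<longlonglongrightarrow> a0" and adm: "admissible n g0 a0"
    and reg: "regular n g0 a0 a0" "regular n g0 a0 b" "regular n g0 a0 c" "regular n g0 a0 d"
  shows "(\<lambda>k. weight n (g k) (a k) b c d l) \<longlonglongrightarrow> weight n g0 a0 b c d l"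
proof -
  note r = tendsto_rh[OF g a, of n]
  have adm1: "s (2 * rh n g0 a0 i) \<noteq> 0" if "i \<in> {1..n}" for i
    using adm that unfolding admissible_def by blast
  have adm': "s (rh n g0 a0 i + rh n g0 a0 j) \<noteq> 0" "s (rh n g0 a0 i - rh n g0 a0 j) \<noteq> 0"
     "s (1 - g0 + (rh n g0 a0 i + rh n g0 a0 j) + of_nat N) \<noteq> 0" "s (1 - g0 + (rh n g0 a0 i - rh n g0 a0 j) + of_nat N) \<noteq> 0"
    if "i \<in> {1..n}" "j \<in> {i<..n}" for i j N
    using adm that unfolding admissible_def by blast+
  show ?thesis unfolding weight_def
  proof (intro tendsto_mult tendsto_prod)
    fix i j assume ij: "i \<in> {1..n}" "j \<in> {i<..n}"
    show "(\<lambda>k. pair_factor (g k) (rh n (g k) (a k) i + rh n (g k) (a k) j) (l i + l j)) \<longlonglongrightarrow>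
        pair_factor g0 (rh n g0 a0 i + rh n g0 a0 j) (l i + l j)"
      by (rule tendsto_pair_factor[OF g tendsto_add[OF r r] adm'(1)[OF ij] adm'(3)[OF ij]])
    show "(\<lambda>k. pair_factor (g k) (rh n (g k) (a k) i - rh n (g k) (a k) j) (l i - l j)) \<longlonglongrightarrow>
        pair_factor g0 (rh n g0 a0 i - rh n g0 a0 j) (l i - l j)"
      by (rule tendsto_pair_factor[OF g tendsto_diff[OF r r] adm'(2)[OF ij] adm'(4)[OF ij]])
  next
    fix j assume j: "j \<in> {1..n}"
    show "(\<lambda>k. s (2 * rh n (g k) (a k) j + 2 * of_nat (l j)) / s (2 * rh n (g k) (a k) j)) \<longlonglongrightarrow>
        s (2 * rh n g0 a0 j + 2 * of_nat (l j)) / s (2 * rh n g0 a0 j)"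
      by (intro tendsto_divide tendsto_s tendsto_add tendsto_mult tendsto_const r adm1[OF j])
    show "(\<lambda>k. single_factor (a k) (rh n (g k) (a k) j) (l j)) \<longlonglongrightarrow> single_factor a0 (rh n g0 a0 j) (l j)"
      by (rule tendsto_single_factor[OF a r regularD[OF reg(1) j]])
    show "(\<lambda>k. single_factor b (rh n (g k) (a k) j) (l j)) \<longlonglongrightarrow> single_factor b (rh n g0 a0 j) (l j)"
      by (rule tendsto_single_factor[OF tendsto_const r regularD[OF reg(2) j]])
    show "(\<lambda>k. single_factor c (rh n (g k) (a k) j) (l j)) \<longlonglongrightarrow> single_factor c (rh n g0 a0 j) (l j)"
      by (rule tendsto_single_factor[OF tendsto_const r regularD[OF reg(3) j]])
    show "(\<lambda>k. single_factor d (rh n (g k) (a k) j) (l j)) \<longlonglongrightarrow> single_factor d (rh n g0 a0 j) (l j)"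
      by (rule tendsto_single_factor[OF tendsto_const r regularD[OF reg(4) j]])
  qed
qed

lemma tendsto_N0:
  assumes n: "n \<ge> 1" and g: "g \<longlonglongrightarrow> g0" and a: "a \<longlonglongrightarrow> a0"
    and reg: "regular n g0 a0 b" "regular n g0 a0 c" "regular n g0 a0 d" and conv: "converges n g0 (a0 + b + c + d)"
  shows "(\<lambda>k. N0 n (g k) (a k) b c d) \<longlonglongrightarrow> N0 n g0 a0 b c d"
proof -
  have "G (1 - v + a0 + of_nat m * g0) \<noteq> 0" if "regular n g0 a0 v" "m < n" for v m
    using that by (intro G_nonzero) (auto simp: regular_def)
  moreover have "G (1 - (a0 + b + c + d) - of_nat (n - 1 + m) * g0) \<noteq> 0" if "m < n" for m
    by (rule G_nonzero, rule converges_nz[OF n conv that])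
  ultimately show ?thesis unfolding N0_def
    using reg by (intro tendsto_divide tendsto_prod tendsto_mult tendsto_G tendsto_add tendsto_diff tendsto_const g a) auto
qed

text \<open>Moving \<open>g\<close> and \<open>a\<close> by the same real \<open>x\<close> gives
  every forbidden argument a nonzero integer slope in \<open>x\<close>: \<open>2 + (w - 1)\<close>
  for the sums, and \<open>w + 1\<close> or its negative for the others after reindexing. So
  countably many countable sets must be avoided, and an interval is uncountable.\<close>

lemma perturbation:
  fixes g a b c d :: complex and \<delta> :: real
  assumes "\<delta> > 0"
  obtains x :: real where "0 < x" "x < \<delta>" "strongly_generic (g + of_real x) (a + of_real x)"
    "\<And>v. v \<in> {b, c, d} \<Longrightarrow> regular n (g + of_real x) (a + of_real x) v \<and> regular2 n (g + of_real x) (a + of_real x) v"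
proof -
  define zs where "zs = (\<lambda>(z, k::complex). {x::real. s (z + k * of_real x) = 0})"
  define I :: "(complex \<times> complex) set" where "I = (\<lambda>(w, N). (2 * a + (of_nat w - 1) * g + of_nat N, of_nat (Suc w))) ` (UNIV :: (nat \<times> nat) set) \<union>
     (\<lambda>(w, N). (of_nat (Suc w) * g + of_nat N, of_nat (Suc w))) ` (UNIV :: (nat \<times> nat) set) \<union>
     (\<Union>v\<in>{b, c, d}. (\<lambda>(w, N). (1 - v + a + of_nat w * g + of_nat N, of_nat (Suc w))) ` (UNIV :: (nat \<times> nat) set)) \<union>
     (\<Union>v\<in>{b, c, d}. (\<lambda>(w, N). (1 - v - a - of_nat w * g + of_nat N, - of_nat (Suc w))) ` (UNIV :: (nat \<times> nat) set))"
  have "countable I" unfolding I_def by (intro countable_Un countable_UN countable_image) auto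
  moreover have "countable (zs p)" if "p \<in> I" for p
    using that unfolding I_def zs_def by (auto intro!: countable_affine_zeros simp del: of_nat_Suc)
  ultimately have "countable (\<Union>p\<in>I. zs p)" by (rule countable_UN)
  moreover have "uncountable {0<..<\<delta>}" using assms by (rule uncountable_open_interval[THEN iffD2])
  ultimately have "{0<..<\<delta>} - (\<Union>p\<in>I. zs p) \<noteq> {}" by (metis countable_empty uncountable_minus_countable)
  then obtain x where "x \<in> {0<..<\<delta>} - (\<Union>p\<in>I. zs p)" by blast
  hence x: "0 < x" "x < \<delta>" "\<And>p. p \<in> I \<Longrightarrow> x \<notin> zs p" by auto
  have sg: "strongly_generic (g + of_real x) (a + of_real x)"
    unfolding strongly_generic_def
  proof (intro conjI allI impI)
    fix w N :: nat
    have "(2 * a + (of_nat w - 1) * g + of_nat N, of_nat (Suc w)) \<in> I"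
      unfolding I_def by (rule UnI1, rule UnI1, rule UnI1, rule image_eqI[of _ _ "(w, N)"]) auto
    from x(3)[OF this] show "s (2 * (a + of_real x) + (of_nat w - 1) * (g + of_real x) + of_nat N) \<noteq> 0"
      by (simp add: zs_def algebra_simps)
    assume "w \<ge> 1"
    then obtain w' where w': "w = Suc w'" by (cases w) auto
    have "(of_nat (Suc w') * g + of_nat N, of_nat (Suc w')) \<in> I"
      unfolding I_def by (rule UnI1, rule UnI1, rule UnI2, rule image_eqI[of _ _ "(w', N)"]) auto
    from x(3)[OF this] show "s (of_nat w * (g + of_real x) + of_nat N) \<noteq> 0"
      by (simp add: zs_def w' algebra_simps)
  qed
  have rg: "regular n (g + of_real x) (a + of_real x) v \<and> regular2 n (g + of_real x) (a + of_real x) v" if v: "v \<in> {b, c, d}" for v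
    unfolding regular_def regular2_def
  proof (intro conjI allI impI)
    fix w N :: nat
    have "(1 - v + a + of_nat w * g + of_nat N, of_nat (Suc w)) \<in> I"
      unfolding I_def by (rule UnI1, rule UnI2, rule UN_I[OF v], rule image_eqI[of _ _ "(w, N)"]) auto
    from x(3)[OF this] show "s (1 - v + (a + of_real x) + of_nat w * (g + of_real x) + of_nat N) \<noteq> 0"
      by (simp add: zs_def algebra_simps)
    have "(1 - v - a - of_nat w * g + of_nat N, - of_nat (Suc w)) \<in> I"
      unfolding I_def by (rule UnI2, rule UN_I[OF v], rule image_eqI[of _ _ "(w, N)"]) auto
    from x(3)[OF this] show "s (1 - v - (a + of_real x) - of_nat w * (g + of_real x) + of_nat N) \<noteq> 0"
      by (simp add: zs_def algebra_simps)
  qed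
  show ?thesis by (rule that[OF x(1,2) sg rg])
qed

text \<open>The formula is known at the strongly generic perturbed points. Convergence is an open
  condition, and regularity at the limit point yields one majorant for all late \<open>k\<close>, so
  the series and the closed form both pass to the limit.\<close>

lemma summation:
  assumes n: "n \<ge> 1" and adm: "admissible n g0 a0"
    and reg: "regular n g0 a0 a0" "regular n g0 a0 b" "regular n g0 a0 c" "regular n g0 a0 d"
    and conv: "converges n g0 (a0 + b + c + d)"
  shows "(\<lambda>l. norm (weight n g0 a0 b c d l)) summable_on Lam n"
    and "infsum (weight n g0 a0 b c d) (Lam n) = N0 n g0 a0 b c d"
proof -
  have "\<exists>x::real. 0 < x \<and> x < 1 / real (Suc k) \<and> strongly_generic (g0 + of_real x) (a0 + of_real x) \<and>
    (\<forall>v\<in>{b, c, d}. regular n (g0 + of_real x) (a0 + of_real x) v \<and> regular2 n (g0 + of_real x) (a0 + of_real x) v)" for k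
    using perturbation[of "1 / real (Suc k)" g0 a0 b c d n] by (metis of_nat_0_less_iff zero_less_Suc zero_less_divide_1_iff)
  then obtain x :: "nat \<Rightarrow> real" where x: "\<And>k. 0 < x k" "\<And>k. x k < 1 / real (Suc k)"
    "\<And>k. strongly_generic (g0 + of_real (x k)) (a0 + of_real (x k))"
    "\<And>k v. v \<in> {b, c, d} \<Longrightarrow> regular n (g0 + of_real (x k)) (a0 + of_real (x k)) v"
    "\<And>k v. v \<in> {b, c, d} \<Longrightarrow> regular2 n (g0 + of_real (x k)) (a0 + of_real (x k)) v"
    by metis
  have x0: "x \<longlonglongrightarrow> 0"
  proof (rule tendsto_sandwich[OF _ _ tendsto_const LIMSEQ_inverse_real_of_nat])
    show "\<forall>\<^sub>F k in sequentially. 0 \<le> x k" using x(1) by (intro always_eventually allI less_imp_le)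
    show "\<forall>\<^sub>F k in sequentially. x k \<le> inverse (real (Suc k))"
      using x(2) by (intro always_eventually allI less_imp_le) (simp add: inverse_eq_divide)
  qed
  define g where "g = (\<lambda>k. g0 + of_real (x k))"
  define a where "a = (\<lambda>k. a0 + of_real (x k))"
  have g: "g \<longlonglongrightarrow> g0" unfolding g_def using tendsto_add[OF tendsto_const[of g0] tendsto_of_real[OF x0]] by simp
  have a: "a \<longlonglongrightarrow> a0" unfolding a_def using tendsto_add[OF tendsto_const[of a0] tendsto_of_real[OF x0]] by simp
  have conv_k: "\<forall>\<^sub>F k in sequentially. converges n (g k) (a k + b + c + d)"
    unfolding converges_def
  proof (intro eventually_ball_finite ballI)
    fix j assume j: "j \<in> {1..n}"
    have "(\<lambda>k. Re (1 - (a k + b + c + d) - 2 * of_nat (n - j) * g k)) \<longlonglongrightarrow> Re (1 - (a0 + b + c + d) - 2 * of_nat (n - j) * g0)"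
      by (intro tendsto_Re tendsto_diff tendsto_add tendsto_mult tendsto_const g a)
    thus "\<forall>\<^sub>F k in sequentially. Re (1 - (a k + b + c + d) - 2 * of_nat (n - j) * g k) > 0"
      using conv j unfolding converges_def by (intro order_tendstoD(1)) auto
  qed simp
  have "\<exists>C \<eta>. C \<ge> 0 \<and> \<eta> < 0 \<and> (\<forall>\<^sub>F k in sequentially. \<forall>l\<in>Lam n.
     norm (weight n (g k) (a k) b c d l) \<le> C * (\<Prod>j=1..n. e (l j) powr (\<eta> - 0) / \<omega> (l j)))"
  proof (rule weight_dominated[OF n g a adm reg(1,3,4), where ?\<kappa>0.0 = "2 * Re b - 1"])
    show "\<exists>C\<ge>0. \<forall>\<^sub>F k in sequentially. \<forall>m. norm (single_factor b (rh n (g k) (a k) j) m) \<le> C * e m powr \<kappa>"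
      if "\<kappa> > 2 * Re b - 1" "j \<in> {1..n}" for \<kappa> j
      by (rule single_factor_bound[OF tendsto_const tendsto_rh[OF g a] regularD[OF reg(2) that(2)] that(1)])
    show "4 * real (n - j) * Re g0 + 2 * Re (a0 + c + d) + (2 * Re b - 1) + 0 - 1 < 0" if "j \<in> {1..n}" for j
    proof -
      have "Re (1 - (a0 + b + c + d) - 2 * of_nat (n - j) * g0) > 0"
        using conv that unfolding converges_def by blast
      thus ?thesis by (simp add: algebra_simps)
    qed
  qed
  then obtain C \<eta> where C: "\<eta> < 0" "\<forall>\<^sub>F k in sequentially. \<forall>l\<in>Lam n.
     norm (weight n (g k) (a k) b c d l) \<le> C * (\<Prod>j=1..n. e (l j) powr \<eta> / \<omega> (l j))" by auto
  note dom = infsum_tendsto_dominated[OF summable_on_majorant[OF C(1)] C(2) tendsto_weight[OF g a adm reg]]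
  show "(\<lambda>l. norm (weight n g0 a0 b c d l)) summable_on Lam n" by (rule dom(1))
  have "\<forall>\<^sub>F k in sequentially. infsum (weight n (g k) (a k) b c d) (Lam n) = N0 n (g k) (a k) b c d"
    using conv_k
  proof eventually_elim
    case (elim k)
    thus ?case using S_eq_N0_strongly_generic[OF n x(3)[of k], of b c d] x(4,5)[of _ k]
      unfolding S_def g_def a_def by simp
  qed
  hence "(\<lambda>k. N0 n (g k) (a k) b c d) \<longlonglongrightarrow> infsum (weight n g0 a0 b c d) (Lam n)"
    using dom(2) tendsto_cong by force
  thus "infsum (weight n g0 a0 b c d) (Lam n) = N0 n g0 a0 b c d"
    using tendsto_N0[OF n g a reg(2-4) conv] LIMSEQ_unique by blast
qed

end

section \<open>The rational case\<close>

lemma prod_ratio_telescope: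
  fixes h :: "nat \<Rightarrow> 'a::field"
  assumes "\<And>v. v < k \<Longrightarrow> h v \<noteq> 0"
  shows "(\<Prod>v<k. h (Suc v) / h v) = (if k = 0 then 1 else h k / h 0)"
  using assms by (induction k) auto

text \<open>Row \<open>u\<close> telescopes to \<open>A (2 u) / A u\<close> times
  \<open>A (2 u + 1)\<close>. In the induction this moves the window of indices from
  \<open>n, ..., 2 n - 1\<close> to \<open>n + 1, ..., 2 n + 1\<close>. Row 0 is separate because
  its telescope is empty.\<close>

lemma prod_triangle_telescope:
  fixes A :: "nat \<Rightarrow> 'a::field"
  assumes "\<And>u v. v < u \<Longrightarrow> u < n \<Longrightarrow> A (u + v) \<noteq> 0"
  shows "(\<Prod>u<n. (\<Prod>v<u. A (Suc (u + v)) / A (u + v)) * A (Suc (2 * u))) = (\<Prod>m<n. A (n + m))"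
  using assms
proof (induction n)
  case (Suc n)
  have tel: "(\<Prod>v<n. A (Suc (n + v)) / A (n + v)) = (if n = 0 then 1 else A (2 * n) / A n)"
    using prod_ratio_telescope[of n "\<lambda>v. A (n + v)"] Suc.prems by (simp add: mult_2)
  have IH: "(\<Prod>u<n. (\<Prod>v<u. A (Suc (u + v)) / A (u + v)) * A (Suc (2 * u))) = (\<Prod>m<n. A (n + m))"
    using Suc by simp
  show ?case
  proof (cases "n = 0")
    case False
    have "(\<Prod>m<Suc n. A (n + m)) = A n * (\<Prod>m<n. A (Suc n + m))"
      by (subst prod.lessThan_Suc_shift) simp
    moreover have "(\<Prod>m<Suc n. A (n + m)) = (\<Prod>m<n. A (n + m)) * A (2 * n)" by (simp add: mult_2)
    moreover have "A n \<noteq> 0" using Suc.prems[of 0 n] False by simp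
    ultimately have e1: "(\<Prod>m<n. A (n + m)) * A (2 * n) / A n = (\<Prod>m<n. A (Suc n + m))"
      by (metis nonzero_mult_div_cancel_left)
    have e2: "(\<Prod>m<Suc n. A (Suc n + m)) = (\<Prod>m<n. A (Suc n + m)) * A (Suc (2 * n))" by (simp add: mult_2)
    have e3: "(\<Prod>u<Suc n. (\<Prod>v<u. A (Suc (u + v)) / A (u + v)) * A (Suc (2 * u))) =
        (\<Prod>m<n. A (n + m)) * (A (2 * n) / A n * A (Suc (2 * n)))"
      using False by (simp only: prod.lessThan_Suc IH tel if_False)
    show ?thesis unfolding e2 e3 e1[symmetric] by simp
  qed simp
qed simp

lemma prod_pairs_reindex:
  fixes n :: nat
  shows "(\<Prod>j=1..n. \<Prod>k\<in>{j<..n}. F (n - j) (n - k)) = (\<Prod>u<n. \<Prod>v<u. F u v)"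
proof -
  have "(\<Prod>j=1..n. \<Prod>k\<in>{j<..n}. F (n - j) (n - k)) = (\<Prod>j=1..n. \<Prod>v<n-j. F (n - j) v)"
  proof (rule prod.cong[OF refl])
    fix j assume j: "j \<in> {1..n}"
    show "(\<Prod>k\<in>{j<..n}. F (n - j) (n - k)) = (\<Prod>v<n-j. F (n - j) v)"
      by (rule prod.reindex_bij_witness[of _ "\<lambda>v. n - v" "\<lambda>k. n - k"]) (use j in auto)
  qed
  also have "\<dots> = (\<Prod>u<n. \<Prod>v<u. F u v)"
    by (rule prod.reindex_bij_witness[of _ "\<lambda>u. n - u" "\<lambda>j. n - j"]) auto
  finally show ?thesis .
qed

context sfun_full
begin

definition hh :: "nat \<Rightarrow> complex \<Rightarrow> complex \<Rightarrow> nat \<Rightarrow> complex" where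
  "hh n g \<sigma> j = of_nat (n - j) * g + \<sigma> / 2"

definition N_raw :: "nat \<Rightarrow> complex \<Rightarrow> complex \<Rightarrow> complex \<Rightarrow> complex \<Rightarrow> complex \<Rightarrow> complex" where
  "N_raw n g a b c d = (let \<rho> = rh n g a; \<sigma> = a + b + c + d; \<rho>h = hh n g \<sigma> in
     (\<Prod>j=1..n. \<Prod>k\<in>{j<..n}.
        (G (1 + \<rho> j + \<rho> k) * G (1 + \<rho> j - \<rho> k) * G (1 + g - \<rho>h j - \<rho>h k) * G (1 + g - \<rho>h j + \<rho>h k)) /
        (G (1 - g + \<rho> j + \<rho> k) * G (1 - g + \<rho> j - \<rho> k) * G (1 - \<rho>h j - \<rho>h k) * G (1 - \<rho>h j + \<rho>h k))) *
     (\<Prod>j=1..n.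
        (G (1 + 2 * \<rho> j) * (G (1 + \<sigma> / 2 - \<rho>h j) * G (1 + (a + b - c - d) / 2 - \<rho>h j) *
           G (1 + (a - b + c - d) / 2 - \<rho>h j) * G (1 + (a - b - c + d) / 2 - \<rho>h j))) /
        (G (1 - 2 * \<rho>h j) * (G (1 - a + \<rho> j) * G (1 - b + \<rho> j) * G (1 - c + \<rho> j) * G (1 - d + \<rho> j)))))"

text \<open>In \<open>u = n - j\<close> and \<open>v = n - k\<close> the pair arguments depend on
  \<open>u + v\<close> or on \<open>u - v\<close> alone. The first kind (\<open>A\<close>,
  \<open>C\<close>) telescopes over the triangle; the second (\<open>B\<close>, \<open>D\<close>)
  telescopes along each row and cancels against the single factors with \<open>a\<close> and
  \<open>\<sigma> / 2\<close>. \<open>C\<close> is an inverse so that the same triangle lemma covers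
  it.\<close>

lemma N_raw_eq_N0:
  assumes n: "n \<ge> 1" and conv: "converges n g (a + b + c + d)" and rega: "regular n g a a"
    and Anz: "\<And>j k. j \<in> {1..n} \<Longrightarrow> k \<in> {j<..n} \<Longrightarrow> G (1 - g + rh n g a j + rh n g a k) \<noteq> 0"
    and Bnz: "\<And>j k. j \<in> {1..n} \<Longrightarrow> k \<in> {j<..n} \<Longrightarrow> G (1 - g + rh n g a j - rh n g a k) \<noteq> 0"
    and Dnz: "\<And>j k. j \<in> {1..n} \<Longrightarrow> k \<in> {j<..n} \<Longrightarrow> G (1 - rh n g a j + rh n g a k) \<noteq> 0"
  shows "N_raw n g a b c d = N0 n g a b c d"
proof -
  define \<sigma> where "\<sigma> = a + b + c + d"
  define A where "A = (\<lambda>w::nat. G (1 + 2 * a + (of_nat w - 1) * g))"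
  define C where "C = (\<lambda>w::nat. inverse (G (1 - \<sigma> - (of_nat w - 1) * g)))"
  define B where "B = (\<lambda>w::nat. G (1 + of_nat w * g))"
  define D where "D = (\<lambda>w::nat. G (1 - of_nat w * g))"
  have A: "A (u + v) \<noteq> 0" if "v < u" "u < n" for u v
    using Anz[of "n - u" "n - v"] that by (auto simp: A_def rh_def algebra_simps)
  have C: "C w \<noteq> 0" if "1 \<le> w" "w \<le> 2 * n - 1" for w
  proof -
    have "G (1 - \<sigma> - of_nat (w - 1) * g) \<noteq> 0"
      by (rule G_nonzero, unfold \<sigma>_def, rule converges_nz'[OF n conv]) (use that in auto)
    thus ?thesis using that by (simp add: C_def of_nat_diff)
  qed
  have B: "B w \<noteq> 0" if "w < n" for w
    unfolding B_def using rega that by (intro G_nonzero) (auto simp: regular_def)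
  have D: "D w \<noteq> 0" if "w < n" for w
  proof (cases "w = 0")
    case True
    thus ?thesis using B[of 0] n by (simp add: B_def D_def)
  next
    case False
    thus ?thesis using Dnz[of "n - w" n] that by (auto simp: D_def rh_def algebra_simps)
  qed
  define F where "F = (\<lambda>u v. (A (Suc (u + v)) / A (u + v)) * (C (Suc (u + v)) / C (u + v)) *
      ((B (u - v) / B (u - v - 1)) * (D (u - v - 1) / D (u - v))))"
  define P where "P = (\<lambda>x u. G (1 - x + a + of_nat u * g))"
  define R where "R = (\<lambda>x u. G (1 - x - of_nat u * g))"
  define Q where "Q = (\<lambda>u. A (Suc (2 * u)) * C (Suc (2 * u)) * (D u / B u) *
      ((R (c + d) u * R (b + d) u * R (b + c) u) / (P b u * P c u * P d u)))"
  have pairF: "(G (1 + rh n g a j + rh n g a k) * G (1 + rh n g a j - rh n g a k) * G (1 + g - hh n g \<sigma> j - hh n g \<sigma> k) * G (1 + g - hh n g \<sigma> j + hh n g \<sigma> k)) /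
        (G (1 - g + rh n g a j + rh n g a k) * G (1 - g + rh n g a j - rh n g a k) * G (1 - hh n g \<sigma> j - hh n g \<sigma> k) * G (1 - hh n g \<sigma> j + hh n g \<sigma> k))
     = F (n - j) (n - k)" if "j \<in> {1..n}" "k \<in> {j<..n}" for j k
  proof -
    define u v where "u = n - j" and "v = n - k"
    have uv: "v < u" using that by (auto simp: u_def v_def)
    have "1 + rh n g a j + rh n g a k = 1 + 2 * a + (of_nat (Suc (u + v)) - 1) * g"
      "1 - g + rh n g a j + rh n g a k = 1 + 2 * a + (of_nat (u + v) - 1) * g"
      "1 + rh n g a j - rh n g a k = 1 + of_nat (u - v) * g"
      "1 - g + rh n g a j - rh n g a k = 1 + of_nat (u - v - 1) * g"
      "1 + g - hh n g \<sigma> j - hh n g \<sigma> k = 1 - \<sigma> - (of_nat (u + v) - 1) * g"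
      "1 - hh n g \<sigma> j - hh n g \<sigma> k = 1 - \<sigma> - (of_nat (Suc (u + v)) - 1) * g"
      "1 + g - hh n g \<sigma> j + hh n g \<sigma> k = 1 - of_nat (u - v - 1) * g"
      "1 - hh n g \<sigma> j + hh n g \<sigma> k = 1 - of_nat (u - v) * g"
      using uv unfolding rh_def hh_def u_def[symmetric] v_def[symmetric] by (auto simp: of_nat_diff algebra_simps)
    thus ?thesis unfolding u_def[symmetric] v_def[symmetric]
      by (simp only: F_def A_def B_def C_def D_def) (simp add: field_simps)
  qed
  have singleQ: "(G (1 + 2 * rh n g a j) * (G (1 + \<sigma> / 2 - hh n g \<sigma> j) * G (1 + (a + b - c - d) / 2 - hh n g \<sigma> j) *
           G (1 + (a - b + c - d) / 2 - hh n g \<sigma> j) * G (1 + (a - b - c + d) / 2 - hh n g \<sigma> j))) /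
        (G (1 - 2 * hh n g \<sigma> j) * (G (1 - a + rh n g a j) * G (1 - b + rh n g a j) * G (1 - c + rh n g a j) * G (1 - d + rh n g a j)))
     = Q (n - j)" for j
  proof -
    define u where "u = n - j"
    have "1 + 2 * rh n g a j = 1 + 2 * a + (of_nat (Suc (2 * u)) - 1) * g"
      "1 + \<sigma> / 2 - hh n g \<sigma> j = 1 - of_nat u * g"
      "1 + (a + b - c - d) / 2 - hh n g \<sigma> j = 1 - (c + d) - of_nat u * g"
      "1 + (a - b + c - d) / 2 - hh n g \<sigma> j = 1 - (b + d) - of_nat u * g"
      "1 + (a - b - c + d) / 2 - hh n g \<sigma> j = 1 - (b + c) - of_nat u * g"
      "1 - 2 * hh n g \<sigma> j = 1 - \<sigma> - (of_nat (Suc (2 * u)) - 1) * g"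
      "1 - a + rh n g a j = 1 + of_nat u * g" "1 - b + rh n g a j = 1 - b + a + of_nat u * g"
      "1 - c + rh n g a j = 1 - c + a + of_nat u * g" "1 - d + rh n g a j = 1 - d + a + of_nat u * g"
      unfolding rh_def hh_def u_def[symmetric] by (auto simp: \<sigma>_def field_simps)
    thus ?thesis unfolding u_def[symmetric]
      by (simp only: Q_def A_def B_def C_def D_def P_def R_def) (simp add: field_simps)
  qed
  have "N_raw n g a b c d = (\<Prod>j=1..n. \<Prod>k\<in>{j<..n}. F (n - j) (n - k)) * (\<Prod>j=1..n. Q (n - j))"
    unfolding N_raw_def Let_def \<sigma>_def[symmetric] singleQ
    by (intro arg_cong2[where f = "(*)"] prod.cong refl pairF)
  also have "(\<Prod>j=1..n. Q (n - j)) = (\<Prod>u<n. Q u)"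
    by (rule prod.reindex_bij_witness[of _ "\<lambda>u. n - u" "\<lambda>j. n - j"]) auto
  also have "(\<Prod>j=1..n. \<Prod>k\<in>{j<..n}. F (n - j) (n - k)) = (\<Prod>u<n. \<Prod>v<u. F u v)"
    by (rule prod_pairs_reindex)
  also have "(\<Prod>u<n. \<Prod>v<u. F u v) * (\<Prod>u<n. Q u) =
     (\<Prod>u<n. ((\<Prod>v<u. A (Suc (u + v)) / A (u + v)) * A (Suc (2 * u))) *
             ((\<Prod>v<u. C (Suc (u + v)) / C (u + v)) * C (Suc (2 * u))) *
             ((R (c + d) u * R (b + d) u * R (b + c) u) / (P b u * P c u * P d u)))"
    unfolding prod.distrib[symmetric]
  proof (intro prod.cong refl)
    fix u assume "u \<in> {..<n}"
    hence u: "u < n" by simp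
    have tel: "(\<Prod>v<u. (B (u - v) / B (u - v - 1)) * (D (u - v - 1) / D (u - v))) * (D u / B u) = 1"
    proof -
      have "(\<Prod>v<u. (B (u - v) / B (u - v - 1)) * (D (u - v - 1) / D (u - v)))
         = (\<Prod>v<u. (B (Suc v) / D (Suc v)) / (B v / D v))"
        by (rule prod.reindex_bij_witness[of _ "\<lambda>v. u - Suc v" "\<lambda>v. u - Suc v"]) (auto simp: Suc_diff_Suc field_simps)
      also have "\<dots> = (if u = 0 then 1 else (B u / D u) / (B 0 / D 0))"
        using B D u by (intro prod_ratio_telescope) auto
      also have "B 0 / D 0 = 1" using D[of 0] n by (simp add: B_def D_def)
      finally show ?thesis using B[OF u] D[OF u] B[of 0] D[of 0] n by (auto simp: B_def D_def)
    qed
    have "(\<Prod>v<u. F u v) * Q u = (\<Prod>v<u. A (Suc (u + v)) / A (u + v)) * (\<Prod>v<u. C (Suc (u + v)) / C (u + v)) *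
        (A (Suc (2 * u)) * C (Suc (2 * u)) * ((R (c + d) u * R (b + d) u * R (b + c) u) / (P b u * P c u * P d u))) *
        ((\<Prod>v<u. (B (u - v) / B (u - v - 1)) * (D (u - v - 1) / D (u - v))) * (D u / B u))"
      unfolding F_def Q_def prod.distrib by (simp only: mult_ac)
    thus "(\<Prod>v<u. F u v) * Q u = ((\<Prod>v<u. A (Suc (u + v)) / A (u + v)) * A (Suc (2 * u))) *
             ((\<Prod>v<u. C (Suc (u + v)) / C (u + v)) * C (Suc (2 * u))) *
             ((R (c + d) u * R (b + d) u * R (b + c) u) / (P b u * P c u * P d u))"
      unfolding tel by (simp only: mult_ac mult_1_left mult_1_right)
  qed
  also have "\<dots> = (\<Prod>m<n. A (n + m)) * (\<Prod>m<n. C (n + m)) *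
      (\<Prod>u<n. (R (c + d) u * R (b + d) u * R (b + c) u) / (P b u * P c u * P d u))"
    using A C by (simp only: prod.distrib[of "\<lambda>u. _ u * _ u"] prod.distrib) 
       (subst (1 2) prod_triangle_telescope[symmetric], auto simp: prod.distrib)
  also have "\<dots> = N0 n g a b c d"
  proof -
    have AA: "A (n + m) = G (1 + 2 * a + of_nat (n - 1 + m) * g)" for m
      using n by (simp add: A_def of_nat_diff)
    have CC: "C (n + m) = inverse (G (1 - (a + b + c + d) - of_nat (n - 1 + m) * g))" for m
      using n by (simp add: C_def \<sigma>_def of_nat_diff)
    have RR: "R (b + c) u = G (1 - b - c - of_nat u * g)" "R (b + d) u = G (1 - b - d - of_nat u * g)"
      "R (c + d) u = G (1 - c - d - of_nat u * g)" for u
      by (simp_all add: R_def diff_diff_eq)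
    have inv: "(\<Prod>m<n. inverse (h m)) = inverse (\<Prod>m<n. h m)" for h :: "nat \<Rightarrow> complex"
      using prod_inversef[of h "{..<n}"] by (simp add: comp_def)
    show ?thesis unfolding N0_def AA CC RR P_def prod_dividef prod.distrib inv
      by (simp only: divide_inverse inverse_mult_distrib mult_ac)
  qed
  finally show ?thesis .
qed

end

section \<open>Identities and asymptotics for the linear function and the reciprocal gamma
  function\<close>

lemma rational_quad:
  "(h1 + z) * (h2 + z) * (h3 + z) * (h4 + z) - (h1 - z) * (h2 - z) * (h3 - z) * (h4 - z)
      = (2 * z) * ((h1 + h2 + h3 + h4) * (z\<^sup>2 - h4\<^sup>2) + (h1 + h4) * (h2 + h4) * (h3 + (h4::complex)))"
  by (simp add: algebra_simps power2_eq_square)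

lemma bounded_ratio_imp_bound:
  fixes z :: "nat \<Rightarrow> complex" and w :: "nat \<Rightarrow> real"
  assumes lim: "(\<lambda>m. w m / norm (z m)) \<longlonglongrightarrow> L" and nz: "\<And>m. z m \<noteq> 0"
  shows "\<exists>C>0. \<forall>m. w m \<le> C * norm (z m)"
proof -
  from lim have "Bseq (\<lambda>m. w m / norm (z m))" by (intro convergent_imp_Bseq convergentI)
  then obtain C where C: "C > 0" "\<And>m. norm (w m / norm (z m)) \<le> C" by (auto simp: Bseq_def)
  have "w m \<le> C * norm (z m)" for m
  proof -
    have "w m / norm (z m) \<le> C" using C(2)[of m] by (metis abs_le_D1 real_norm_def)
    thus ?thesis using nz[of m] by (simp add: divide_le_eq)
  qed
  thus ?thesis using C(1) by blast
qed

lemma norm_1_plus_le_exp: "norm (1 + z) \<le> exp (Re z + (norm z)\<^sup>2 / 2)"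
proof -
  have "(norm (1 + z))\<^sup>2 = 1 + (2 * Re z + (norm z)\<^sup>2)"
    unfolding cmod_power2 by (simp add: power2_eq_square algebra_simps)
  also have "\<dots> \<le> exp (2 * Re z + (norm z)\<^sup>2)" by (rule exp_ge_add_one_self)
  also have "\<dots> = (exp (Re z + (norm z)\<^sup>2 / 2))\<^sup>2" by (simp add: exp_double[symmetric] algebra_simps)
  finally show ?thesis by (rule power2_le_imp_le) simp
qed

text \<open>Uniform form of the expansion
  \<open>1 + Re (\<alpha> - \<beta>) / i + O(1 / i^2)\<close> of the ratio of norms. With
  \<open>z\<close> the relative difference, \<open>Re z\<close> brings an error
  \<open>4 K^2 / i^2\<close> and half of the squared norm another \<open>8 K^2 / i^2\<close>,
  together the 12; replacing \<open>ln (1 + 1 / (1 + i))\<close> by \<open>1 / i\<close> costs at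
  most \<open>2 |c| / i^2\<close>. The room \<open>c - c'\<close> pays for all of it.\<close>

lemma shifted_ratio_le:
  fixes \<alpha> \<beta> :: complex
  assumes K: "norm \<alpha> \<le> K" "norm \<beta> \<le> K" "Re (\<alpha> - \<beta>) \<le> c'" and K0: "K > 0" and c: "c' < c"
    and i: "real i \<ge> 2 * K + 1" "real i * (c - c') \<ge> 12 * K\<^sup>2 + 2 * \<bar>c\<bar>"
  shows "norm (\<alpha> + of_nat i) \<le> norm (\<beta> + of_nat i) * ((1 + real (Suc i)) / (1 + real i)) powr c"
proof -
  define r where "r = real i"
  have r: "r > 1" "r - K \<ge> r / 2" using i K0 by (auto simp: r_def)
  have bi: "norm (\<beta> + of_nat i) \<ge> r / 2"
    using norm_triangle_ineq2[of "of_nat i" "- \<beta>"] K(2) r by (simp add: r_def add.commute)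
  hence bnz: "\<beta> + of_nat i \<noteq> 0" using r by auto
  define z where "z = (\<alpha> - \<beta>) / (\<beta> + of_nat i)"
  have ab: "norm (\<alpha> - \<beta>) \<le> 2 * K" using norm_triangle_ineq4[of \<alpha> \<beta>] K by linarith
  have nz: "norm z \<le> 4 * K / r"
  proof -
    have "norm z \<le> (2 * K) / (r / 2)" unfolding z_def norm_divide using ab bi r K0 by (intro frac_le) auto
    thus ?thesis by (simp add: field_simps)
  qed
  have z_eq: "z = (\<alpha> - \<beta>) / of_nat i - z * \<beta> / of_nat i"
  proof -
    have "z * (\<beta> + of_nat i) = \<alpha> - \<beta>" using bnz by (simp add: z_def)
    hence "z * of_nat i = (\<alpha> - \<beta>) - z * \<beta>" by (simp add: algebra_simps)
    hence "z = ((\<alpha> - \<beta>) - z * \<beta>) / of_nat i" using r by (simp add: r_def eq_divide_eq)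
    thus ?thesis by (simp only: diff_divide_distrib)
  qed
  have "Re z = Re (\<alpha> - \<beta>) / r - Re (z * \<beta>) / r"
    by (subst z_eq) (simp add: r_def Re_divide_of_nat)
  also have "\<dots> \<le> c' / r + norm (z * \<beta>) / r"
  proof -
    have "- Re (z * \<beta>) \<le> norm (z * \<beta>)" using abs_Re_le_cmod[of "z * \<beta>"] by linarith
    hence "- Re (z * \<beta>) / r \<le> norm (z * \<beta>) / r" using r by (intro divide_right_mono) auto
    moreover have "Re (\<alpha> - \<beta>) / r \<le> c' / r" using K r by (intro divide_right_mono) auto
    ultimately show ?thesis by linarith
  qed
  also have "norm (z * \<beta>) / r \<le> (4 * K / r * K) / r"
    unfolding norm_mult using nz K r K0 by (intro divide_right_mono mult_mono) auto
  finally have Rez: "Re z \<le> c' / r + 4 * K\<^sup>2 / r\<^sup>2" by (simp add: power2_eq_square)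
  have "(norm z)\<^sup>2 \<le> (4 * K / r)\<^sup>2" using nz by (intro power_mono) auto
  hence E: "Re z + (norm z)\<^sup>2 / 2 \<le> c' / r + 12 * K\<^sup>2 / r\<^sup>2"
    using Rez by (simp add: power_divide)
  define x where "x = 1 / (1 + r)"
  have x: "0 < x" "x \<le> 1" "x < 1 / r" using r by (auto simp: x_def field_simps)
  have l1: "ln (1 + x) \<le> x" using x by (intro ln_add_one_self_le_self) auto
  have l2: "x - x\<^sup>2 \<le> ln (1 + x)" using x by (intro ln_one_plus_pos_lower_bound) auto
  have "c * ln (1 + x) \<ge> c * x - \<bar>c\<bar> * x\<^sup>2"
  proof -
    have "\<bar>c * (ln (1 + x) - x)\<bar> \<le> \<bar>c\<bar> * x\<^sup>2"
      unfolding abs_mult using l1 l2 by (intro mult_left_mono) auto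
    thus ?thesis by (simp add: algebra_simps abs_le_iff)
  qed
  moreover have "c * x \<ge> c / r - \<bar>c\<bar> / r\<^sup>2"
  proof -
    have eq: "1 / r - x = 1 / (r * (1 + r))" using r by (simp add: x_def field_simps)
    have "1 / (r * (1 + r)) \<le> 1 / (r * r)" using r by (intro divide_left_mono mult_left_mono) auto
    hence "\<bar>1 / r - x\<bar> \<le> 1 / r\<^sup>2" unfolding eq using r by (simp add: power2_eq_square)
    hence "\<bar>c * (1 / r - x)\<bar> \<le> \<bar>c\<bar> * (1 / r\<^sup>2)" unfolding abs_mult by (intro mult_left_mono) auto
    thus ?thesis by (simp add: algebra_simps abs_le_iff)
  qed
  moreover have "\<bar>c\<bar> * x\<^sup>2 \<le> \<bar>c\<bar> / r\<^sup>2"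
  proof -
    have "x\<^sup>2 \<le> (1 / r)\<^sup>2" using x by (intro power_mono) auto
    hence "\<bar>c\<bar> * x\<^sup>2 \<le> \<bar>c\<bar> * (1 / r)\<^sup>2" by (intro mult_left_mono) auto
    thus ?thesis by (simp add: power_divide)
  qed
  ultimately have "c * ln (1 + x) \<ge> c / r - 2 * \<bar>c\<bar> / r\<^sup>2" by simp
  moreover have "c' / r + 12 * K\<^sup>2 / r\<^sup>2 \<le> c / r - 2 * \<bar>c\<bar> / r\<^sup>2"
  proof -
    have "(12 * K\<^sup>2 + 2 * \<bar>c\<bar>) / r\<^sup>2 \<le> (r * (c - c')) / r\<^sup>2" using i by (intro divide_right_mono) (auto simp: r_def)
    also have "\<dots> = c / r - c' / r" using r by (simp add: power2_eq_square field_simps)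
    finally show ?thesis by (simp add: add_divide_distrib)
  qed
  ultimately have "exp (Re z + (norm z)\<^sup>2 / 2) \<le> exp (c * ln (1 + x))" using E by simp
  also have "\<dots> = ((1 + real (Suc i)) / (1 + real i)) powr c"
  proof -
    have "(1 + real (Suc i)) / (1 + real i) = 1 + x" by (simp add: x_def r_def field_simps)
    thus ?thesis using x by (simp add: powr_def)
  qed
  finally have "norm (1 + z) \<le> ((1 + real (Suc i)) / (1 + real i)) powr c"
    using norm_1_plus_le_exp[of z] by linarith
  moreover have "\<alpha> + of_nat i = (\<beta> + of_nat i) * (1 + z)" using bnz by (simp add: z_def field_simps)
  ultimately show ?thesis by (simp only: norm_mult) (intro mult_left_mono; simp)
qed

text \<open>In a quotient with equal sums of arguments the comparison factor
  \<open>(M - 1)! M^z\<close> cancels, so Stirling's formula can be avoided. Off the poles the claim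
  is the limit formula for the gamma function, read at \<open>M = n + 1\<close>.\<close>

lemma rGamma_shift_asymp:
  "(\<lambda>M. rGamma (z + of_nat M) * (fact (M - 1) * exp (z * of_real (ln (of_nat M))))) \<longlonglongrightarrow> (1 :: complex)"
proof -
  define \<phi> where "\<phi> = (\<lambda>(z::complex) M. rGamma (z + of_nat M) * (fact (M - 1) * exp (z * of_real (ln (of_nat M)))))"
  have base: "\<phi> z \<longlonglongrightarrow> 1" if "z \<notin> \<int>\<^sub>\<le>\<^sub>0" for z
  proof -
    have nz: "rGamma z \<noteq> 0" using that by (simp add: rGamma_eq_zero_iff)
    have "(\<lambda>n. rGamma z / rGamma_series z n) \<longlonglongrightarrow> rGamma z / rGamma z"
      by (intro tendsto_divide tendsto_const rGamma_series_LIMSEQ nz)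
    moreover have "rGamma z / rGamma_series z n = rGamma (z + of_nat (Suc n)) * (fact n * exp (z * of_real (ln (of_nat n))))" for n
    proof -
      have "rGamma z = pochhammer z (Suc n) * rGamma (z + of_nat (Suc n))" by (rule pochhammer_rGamma)
      moreover from this nz have "pochhammer z (Suc n) \<noteq> 0" by auto
      ultimately show ?thesis by (simp add: rGamma_series_def del: of_nat_Suc)
    qed
    moreover have "(\<lambda>n. exp (z * of_real (ln (of_nat (Suc n) / of_nat n)))) \<longlonglongrightarrow> exp (z * of_real (ln 1))"
      by (intro tendsto_exp tendsto_mult tendsto_const tendsto_of_real tendsto_ln LIMSEQ_Suc_n_over_n) auto
    ultimately have "(\<lambda>n. rGamma (z + of_nat (Suc n)) * (fact n * exp (z * of_real (ln (of_nat n)))) *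
        exp (z * of_real (ln (of_nat (Suc n) / of_nat n)))) \<longlonglongrightarrow> 1 * 1"
      using nz by (intro tendsto_mult) auto
    moreover have "\<forall>\<^sub>F n in sequentially. rGamma (z + of_nat (Suc n)) * (fact n * exp (z * of_real (ln (of_nat n)))) *
        exp (z * of_real (ln (of_nat (Suc n) / of_nat n))) = \<phi> z (Suc n)"
      using eventually_gt_at_top[of 0]
    proof eventually_elim
      case (elim n)
      have "ln (real n) + ln (real (Suc n) / real n) = ln (real (Suc n))"
        using elim by (simp add: ln_div)
      hence "exp (z * of_real (ln (of_nat n))) * exp (z * of_real (ln (of_nat (Suc n) / of_nat n))) = exp (z * of_real (ln (of_nat (Suc n))))"
        by (metis distrib_left exp_add of_real_add)
      thus ?case by (simp add: \<phi>_def mult.assoc del: of_nat_Suc)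
    qed
    ultimately have "(\<lambda>n. \<phi> z (Suc n)) \<longlonglongrightarrow> 1" using tendsto_cong by force
    thus ?thesis by (simp add: filterlim_sequentially_Suc)
  qed
  have down: "\<phi> z \<longlonglongrightarrow> 1" if "\<phi> (z + 1) \<longlonglongrightarrow> 1" for z
  proof -
    have "(\<lambda>M. (z / of_nat M + 1) * \<phi> (z + 1) M) \<longlonglongrightarrow> (0 + 1) * 1"
      by (intro tendsto_mult tendsto_add tendsto_const that lim_const_over_n)
    moreover have "\<forall>\<^sub>F M in sequentially. (z / of_nat M + 1) * \<phi> (z + 1) M = \<phi> z M"
      using eventually_gt_at_top[of 0]
    proof eventually_elim
      case (elim M)
      have "exp ((z + 1) * of_real (ln (of_nat M))) = exp (z * of_real (ln (of_nat M))) * of_nat M"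
        using elim by (simp add: distrib_right exp_add exp_of_real)
      moreover have "rGamma (z + of_nat M) = (z + of_nat M) * rGamma (z + 1 + of_nat M)"
        using rGamma_plus1[of "z + of_nat M"] by (simp add: add_ac)
      moreover have "z / of_nat M + 1 = (z + of_nat M) / of_nat M" using elim by (simp add: field_simps)
      ultimately show ?case using elim by (simp add: \<phi>_def)
    qed
    ultimately show ?thesis using tendsto_cong by force
  qed
  obtain K :: nat where "- Re z < real K" using reals_Archimedean2 by blast
  hence K: "Re z + real K > 0" by simp
  have "\<phi> (z + of_nat (K - i)) \<longlonglongrightarrow> 1" if "i \<le> K" for i
    using that
  proof (induction i)
    case 0
    have "z + of_nat K \<notin> \<int>\<^sub>\<le>\<^sub>0"
    proof
      assume "z + of_nat K \<in> \<int>\<^sub>\<le>\<^sub>0"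
      then obtain m where m: "z + of_nat K = - of_nat m" by (elim nonpos_Ints_cases')
      have "Re (z + of_nat K) = - real m" unfolding m by simp
      thus False using K by simp
    qed
    thus ?case using base by simp
  next
    case (Suc i)
    hence "z + of_nat (K - Suc i) + 1 = z + of_nat (K - i)" by (simp add: of_nat_diff)
    with Suc show ?case using down[of "z + of_nat (K - Suc i)"] by simp
  qed
  from this[of K] show ?thesis by (simp add: \<phi>_def)
qed

text \<open>The case numbers follow the order of the axioms: 1 to 4 from \<open>sfun\<close>, 5 to
  17 from \<open>sfun_growth\<close>, 18 to 25 from \<open>sfun_full\<close>.\<close>

lemma sfun_full_rational:
  "sfun_full (\<lambda>x. x) (\<lambda>x. x\<^sup>2) (\<lambda>m. 1 + real m) (\<lambda>m. 1 + real m) (\<lambda>x. x) (\<lambda>_. 1) rGamma"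
proof (unfold_locales, goal_cases)
  case (2 x y)
  show ?case by (simp add: algebra_simps power2_eq_square)
next
  case (3 h1 z h2 h3 h4)
  show ?case by (rule rational_quad)
next
  case (6 k m)
  thus ?case by (simp add: of_nat_diff power2_eq_square algebra_simps)
next
  case (9 \<alpha> \<alpha>0)
  have "\<forall>\<^sub>F k in sequentially. norm (\<alpha> k) < norm \<alpha>0 + 1"
    by (rule order_tendstoD(2)[OF tendsto_norm[OF 9]]) simp
  hence "\<forall>\<^sub>F k in sequentially. \<forall>m. norm (\<alpha> k + of_nat m) \<le> (norm \<alpha>0 + 1) * (1 + real m)"
  proof eventually_elim
    case (elim k)
    show ?case
    proof
      fix m
      have "norm (\<alpha> k + of_nat m) \<le> norm (\<alpha> k) + real m"
        using norm_triangle_ineq[of "\<alpha> k" "of_nat m"] by simp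
      also have "\<dots> \<le> (norm \<alpha>0 + 1) + (norm \<alpha>0 + 1) * real m"
        using elim mult_right_mono[of 1 "norm \<alpha>0 + 1" "real m"] by (intro add_mono) auto
      finally show "norm (\<alpha> k + of_nat m) \<le> (norm \<alpha>0 + 1) * (1 + real m)" by (simp add: algebra_simps)
    qed
  qed
  thus ?case by blast
next
  case (10 \<alpha> \<alpha>0)
  have "\<forall>\<^sub>F k in sequentially. norm (\<alpha> k) < norm \<alpha>0 + 1"
    by (rule order_tendstoD(2)[OF tendsto_norm[OF 10]]) simp
  hence "\<forall>\<^sub>F k in sequentially. \<forall>m. norm (\<alpha> k + 2 * of_nat m) \<le> (norm \<alpha>0 + 2) * ((1 + real m)\<^sup>2 / (1 + real m))"
  proof eventually_elim
    case (elim k)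
    show ?case
    proof
      fix m
      have "norm (\<alpha> k + 2 * of_nat m) \<le> norm (\<alpha> k) + 2 * real m"
        using norm_triangle_ineq[of "\<alpha> k" "2 * of_nat m"] by (simp add: norm_mult)
      also have "\<dots> \<le> (norm \<alpha>0 + 2) + (norm \<alpha>0 + 2) * real m"
        using elim mult_right_mono[of 2 "norm \<alpha>0 + 2" "real m"] by (intro add_mono) auto
      also have "\<dots> = (norm \<alpha>0 + 2) * (1 + real m)" by (simp add: algebra_simps)
      also have "\<dots> = (norm \<alpha>0 + 2) * ((1 + real m)\<^sup>2 / (1 + real m))" by (simp add: power2_eq_square)
      finally show "norm (\<alpha> k + 2 * of_nat m) \<le> (norm \<alpha>0 + 2) * ((1 + real m)\<^sup>2 / (1 + real m))" .
    qed
  qed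
  thus ?case by blast
next
  case (11 \<alpha>0)
  have "(\<lambda>m. 1 / norm ((\<alpha>0 - 1) / of_nat (Suc m) + 1)) \<longlonglongrightarrow> 1 / norm (0 + 1 :: complex)"
    by (intro tendsto_divide tendsto_norm tendsto_add tendsto_const LIMSEQ_Suc[OF lim_const_over_n]) auto
  moreover have "1 / norm ((\<alpha>0 - 1) / of_nat (Suc m) + 1) = (1 + real m) / norm (\<alpha>0 + of_nat m)" for m
  proof -
    have "(\<alpha>0 - 1) / of_nat (Suc m) + 1 = (\<alpha>0 - 1 + 1 * of_nat (Suc m)) / of_nat (Suc m)"
      using of_nat_neq_0[of m, where ?'a = complex] by (simp add: add_divide_distrib del: of_nat_Suc)
    also have "\<alpha>0 - 1 + 1 * of_nat (Suc m) = \<alpha>0 + of_nat m" by simp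
    finally have "(\<alpha>0 - 1) / of_nat (Suc m) + 1 = (\<alpha>0 + of_nat m) / of_nat (Suc m)" .
    thus ?thesis using norm_of_nat[of "Suc m", where ?'a = complex] by (simp add: norm_divide del: of_nat_Suc norm_of_nat)
  qed
  ultimately show ?case using 11 by (intro bounded_ratio_imp_bound) auto
next
  case (12 \<alpha>0)
  have "(\<lambda>m. 1 / norm ((\<alpha>0 - 2) / of_nat (Suc m) + 2)) \<longlonglongrightarrow> 1 / norm (0 + 2 :: complex)"
    by (intro tendsto_divide tendsto_norm tendsto_add tendsto_const LIMSEQ_Suc[OF lim_const_over_n]) auto
  moreover have "1 / norm ((\<alpha>0 - 2) / of_nat (Suc m) + 2) = ((1 + real m)\<^sup>2 / (1 + real m)) / norm (\<alpha>0 + 2 * of_nat m)" for m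
  proof -
    have "(\<alpha>0 - 2) / of_nat (Suc m) + 2 = (\<alpha>0 - 2 + 2 * of_nat (Suc m)) / of_nat (Suc m)"
      using of_nat_neq_0[of m, where ?'a = complex] by (simp add: add_divide_distrib del: of_nat_Suc)
    also have "\<alpha>0 - 2 + 2 * of_nat (Suc m) = \<alpha>0 + 2 * of_nat m" by simp
    finally have "(\<alpha>0 - 2) / of_nat (Suc m) + 2 = (\<alpha>0 + 2 * of_nat m) / of_nat (Suc m)" .
    thus ?thesis using norm_of_nat[of "Suc m", where ?'a = complex] by (simp add: norm_divide power2_eq_square del: of_nat_Suc norm_of_nat)
  qed
  ultimately show ?case using 12 by (intro bounded_ratio_imp_bound) auto
next
  case (13 \<alpha> \<alpha>0 \<beta> \<beta>0 c)
  define c' where "c' = (Re (\<alpha>0 - \<beta>0) + c) / 2"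
  have c': "Re (\<alpha>0 - \<beta>0) < c'" "c' < c" using 13(3) by (auto simp: c'_def)
  define K where "K = norm \<alpha>0 + norm \<beta>0 + 1"
  have K: "K > 0" by (simp add: K_def add_nonneg_pos)
  obtain i0 :: nat where i0: "real i0 > max (2 * K + 1) ((12 * K\<^sup>2 + 2 * \<bar>c\<bar>) / (c - c'))"
    using reals_Archimedean2 by blast
  have "\<forall>\<^sub>F k in sequentially. norm (\<alpha> k) < K" 
    by (rule order_tendstoD(2)[OF tendsto_norm[OF 13(1)]]) (simp add: K_def add_nonneg_pos)
  moreover have "\<forall>\<^sub>F k in sequentially. norm (\<beta> k) < K" 
    by (rule order_tendstoD(2)[OF tendsto_norm[OF 13(2)]]) (simp add: K_def add_nonneg_pos)
  moreover have "\<forall>\<^sub>F k in sequentially. Re (\<alpha> k - \<beta> k) < c'" 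
    by (rule order_tendstoD(2)[OF tendsto_Re[OF tendsto_diff[OF 13(1,2)]] c'(1)])
  ultimately have "\<forall>\<^sub>F k in sequentially. \<forall>i\<ge>i0. norm (\<alpha> k + of_nat i) \<le> norm (\<beta> k + of_nat i) * ((1 + real (Suc i)) / (1 + real i)) powr c"
  proof eventually_elim
    case (elim k)
    show ?case
    proof (intro allI impI)
      fix i assume "i \<ge> i0"
      hence i: "real i > 2 * K + 1" "real i > (12 * K\<^sup>2 + 2 * \<bar>c\<bar>) / (c - c')" using i0 by auto
      have "real i * (c - c') \<ge> 12 * K\<^sup>2 + 2 * \<bar>c\<bar>" using i(2) c' by (simp add: divide_less_eq)
      thus "norm (\<alpha> k + of_nat i) \<le> norm (\<beta> k + of_nat i) * ((1 + real (Suc i)) / (1 + real i)) powr c"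
        using elim K c' i by (intro shifted_ratio_le[of _ K _ c']) auto
    qed
  qed
  thus ?case by blast
next
  \<comment> \<open>Centred at \<open>w\<close> and \<open>v\<close> below, the arguments are
    \<open>w - v\<close> and \<open>w + v\<close>, so the claim is that the real inner product of
    \<open>w\<close> and \<open>v\<close> is nonnegative. \<open>M0\<close> makes
    \<open>Re v\<close> outweigh the product of the imaginary parts.\<close>
  case (14 x u)
  obtain i0 :: nat where i0: "real i0 > 1 - Re x" using reals_Archimedean2 by blast
  obtain M0 :: nat where M0: "real M0 > \<bar>Im x * Im u\<bar> - Re u" using reals_Archimedean2 by blast
  have "norm (x - u - of_nat M + of_nat i) \<le> norm (1 + x + u + of_nat M + of_nat i)" if "M \<ge> M0" "i \<ge> i0" for M i
  proof -
    define w v where "w = x + of_nat i + 1/2" and "v = u + of_nat M + 1/2"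
    have w: "Re w \<ge> 1" and v: "Re v \<ge> \<bar>Im x * Im u\<bar>" using that i0 M0 by (auto simp: w_def v_def)
    have "Re v \<le> Re w * Re v" using w v mult_right_mono[of 1 "Re w" "Re v"] by auto
    hence "Re w * Re v + Im w * Im v \<ge> 0" using v by (simp add: w_def v_def abs_le_iff)
    hence "(norm (w - v))\<^sup>2 \<le> (norm (w + v))\<^sup>2" unfolding cmod_power2 by (simp add: power2_eq_square algebra_simps)
    hence "norm (w - v) \<le> norm (w + v)" by (rule power2_le_imp_le) simp
    thus ?thesis by (simp add: w_def v_def algebra_simps)
  qed
  thus ?case unfolding eventually_sequentially by blast
next
  case (15 x)
  have "(\<lambda>M. (x - u - of_nat M) / (1 + x + u + of_nat M)) \<longlonglongrightarrow> -1" for u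
  proof -
    have "(\<lambda>M. ((x - u) / of_nat M - 1) / ((1 + x + u) / of_nat M + 1)) \<longlonglongrightarrow> (0 - 1) / (0 + 1)"
      by (intro tendsto_divide tendsto_add tendsto_diff tendsto_const lim_const_over_n) auto
    moreover have "\<forall>\<^sub>F M in sequentially. ((x - u) / of_nat M - 1) / ((1 + x + u) / of_nat M + 1) = (x - u - of_nat M) / (1 + x + u + of_nat M)"
      using eventually_gt_at_top[of 0]
    proof eventually_elim
      case (elim M)
      have "(x - u) / of_nat M - 1 = (x - u - of_nat M) / of_nat M" "(1 + x + u) / of_nat M + 1 = (1 + x + u + of_nat M) / of_nat M"
        using elim by (auto simp: field_simps)
      thus ?case using elim by simp
    qed
    ultimately show ?thesis using tendsto_cong by force
  qed
  thus ?case by blast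
next
  case (16 \<eta>)
  have "summable (\<lambda>m. real (Suc m) powr (\<eta> - 1))"
    using 16 summable_real_powr_iff[of "\<eta> - 1"] by (subst summable_Suc_iff) auto
  moreover have "(1 + real m) powr \<eta> / (1 + real m) = real (Suc m) powr (\<eta> - 1)" for m
    by (simp add: powr_diff add.commute)
  ultimately show ?case by simp
next
  case (17 \<eta>)
  have "filterlim (\<lambda>m. 1 + real m) at_top sequentially"
    by (rule filterlim_tendsto_add_at_top[OF tendsto_const filterlim_real_sequentially])
  from tendsto_neg_powr[OF 17 this] show ?case .
next
  case (21 x)
  show ?case using rGamma_plus1[of x] by simp
next
  case (22 x)
  show ?case
  proof
    assume "rGamma x = 0"
    then obtain n where "x = - of_nat n" by (auto simp: rGamma_eq_zero_iff elim: nonpos_Ints_cases')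
    thus False using 22[of n] by simp
  qed
next
  case (24 I ys zs)
  define \<phi> where "\<phi> = (\<lambda>(z::complex) M. rGamma (z + of_nat M) * (fact (M - 1) * exp (z * of_real (ln (of_nat M)))))"
  have \<phi>: "\<phi> z \<longlonglongrightarrow> 1" for z unfolding \<phi>_def by (rule rGamma_shift_asymp)
  have "(\<lambda>M. (\<Prod>i\<in>I. \<phi> (ys i) M) / (\<Prod>i\<in>I. \<phi> (zs i) M)) \<longlonglongrightarrow> (\<Prod>i\<in>I. 1) / (\<Prod>i\<in>I. 1)"
    by (intro tendsto_divide tendsto_prod \<phi>) auto
  moreover have "(\<Prod>i\<in>I. \<phi> (ys i) M) / (\<Prod>i\<in>I. \<phi> (zs i) M) = (\<Prod>i\<in>I. rGamma (ys i + of_nat M)) / (\<Prod>i\<in>I. rGamma (zs i + of_nat M))" for M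
  proof -
    \<comment> \<open>Equality of the sums makes the powers \<open>M^z\<close> cancel; the
      factorials cancel because both products run over \<open>I\<close>.\<close>
    have "(\<Prod>i\<in>I. exp (ys i * of_real (ln (of_nat M)))) = (\<Prod>i\<in>I. exp (zs i * of_real (ln (of_nat M))))"
      using 24 by (simp add: exp_sum[symmetric] sum_distrib_right[symmetric])
    moreover have "(\<Prod>i\<in>I. exp (zs i * of_real (ln (of_nat M)))) \<noteq> 0" using 24(1) by simp
    ultimately show ?thesis unfolding \<phi>_def prod.distrib by simp
  qed
  ultimately show ?case by simp
qed (auto intro!: continuous_intros simp: add_nonneg_pos)

section \<open>The trigonometric case\<close>

context
  fixes q :: real
  assumes q: "0 < q" "q < 1"
begin

lemma qpoch_LIMSEQ: "(\<lambda>n. \<Prod>k<n. 1 - x * of_real q ^ k) \<longlonglongrightarrow> qpoch_inf x (of_real q)"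
  and qpoch_inf_rec: "qpoch_inf x (of_real q) = (1 - x) * qpoch_inf (x * of_real q) (of_real q)"
  and qpoch_inf_nonzero: "(\<And>k. 1 - x * of_real q ^ k \<noteq> 0) \<Longrightarrow> qpoch_inf x (of_real q) \<noteq> 0"
proof -
  have conv: "convergent_prod (\<lambda>k. 1 - y * of_real q ^ k :: complex)" for y
  proof (intro abs_convergent_prod_imp_convergent_prod summable_imp_abs_convergent_prod)
    have "summable (\<lambda>k. norm y * q ^ k)" using q by (intro summable_mult summable_geometric) auto
    moreover have "norm (1 - y * of_real q ^ k - 1) = norm y * q ^ k" for k
      using q(1) by (simp add: norm_mult norm_power)
    ultimately show "summable (\<lambda>k. norm (1 - y * of_real q ^ k - 1))" by (simp only:)
  qed
  have lim: "(\<lambda>n. \<Prod>k<n. 1 - x * of_real q ^ k) \<longlonglongrightarrow> qpoch_inf x (of_real q)" for x :: complex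
    unfolding qpoch_inf_def
    using convergent_prod_LIMSEQ[OF conv[of x]] LIMSEQ_lessThan_iff_atMost[where f = "prod (\<lambda>k. 1 - x * of_real q ^ k)"]
    by simp
  show "(\<lambda>n. \<Prod>k<n. 1 - x * of_real q ^ k) \<longlonglongrightarrow> qpoch_inf x (of_real q)" by (rule lim)
  show "qpoch_inf x (of_real q) \<noteq> 0" if "\<And>k. 1 - x * of_real q ^ k \<noteq> 0"
    unfolding qpoch_inf_def using that by (intro prodinf_nonzero conv)
  have "(\<lambda>n. \<Prod>k<Suc n. 1 - x * of_real q ^ k) \<longlonglongrightarrow> qpoch_inf x (of_real q)"
    by (rule LIMSEQ_Suc[OF lim])
  also have "(\<lambda>n. \<Prod>k<Suc n. 1 - x * of_real q ^ k) = (\<lambda>n. (1 - x) * (\<Prod>k<n. 1 - (x * of_real q) * of_real q ^ k))"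
    by (subst prod.lessThan_Suc_shift) (simp add: mult_ac)
  finally have "(\<lambda>n. (1 - x) * (\<Prod>k<n. 1 - (x * of_real q) * of_real q ^ k)) \<longlonglongrightarrow> qpoch_inf x (of_real q)" .
  moreover have "(\<lambda>n. (1 - x) * (\<Prod>k<n. 1 - (x * of_real q) * of_real q ^ k)) \<longlonglongrightarrow> (1 - x) * qpoch_inf (x * of_real q) (of_real q)"
    by (intro tendsto_mult tendsto_const lim)
  ultimately show "qpoch_inf x (of_real q) = (1 - x) * qpoch_inf (x * of_real q) (of_real q)"
    by (rule LIMSEQ_unique)
qed

text \<open>The partial products converge uniformly on every ball, by comparison with a geometric
  series, and continuity is local.\<close>

lemma continuous_qpoch_inf: "continuous_on UNIV (\<lambda>x. qpoch_inf x (of_real q))"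
proof -
  have "continuous_on (ball 0 R) (\<lambda>x. qpoch_inf x (of_real q))" for R :: real
  proof -
    have uc: "uniformly_convergent_on (cball 0 R) (\<lambda>N x::complex. \<Prod>n<N. 1 + - x * of_real q ^ n)"
    proof (rule uniformly_convergent_on_prod)
      show "uniformly_convergent_on (cball 0 R) (\<lambda>N x::complex. \<Sum>n<N. norm (- x * of_real q ^ n))"
      proof (rule Weierstrass_m_test'_ev)
        show "\<forall>\<^sub>F n in sequentially. \<forall>x\<in>cball (0::complex) R. norm (norm (- x * of_real q ^ n)) \<le> \<bar>R\<bar> * q ^ n"
          using q by (intro always_eventually) (auto simp: norm_mult norm_power intro!: mult_right_mono)
        show "summable (\<lambda>n. \<bar>R\<bar> * q ^ n)" using q by (intro summable_mult summable_geometric) auto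
      qed
    qed (auto intro!: continuous_intros)
    then obtain l where l: "uniform_limit (cball 0 R) (\<lambda>N x::complex. \<Prod>n<N. 1 + - x * of_real q ^ n) l sequentially"
      by (auto simp: uniformly_convergent_on_def)
    have "l x = qpoch_inf x (of_real q)" if "x \<in> cball 0 R" for x
    proof (rule LIMSEQ_unique)
      show "(\<lambda>n. \<Prod>k<n. 1 - x * of_real q ^ k) \<longlonglongrightarrow> l x"
        using tendsto_uniform_limitI[OF l that] by simp
    qed (rule qpoch_LIMSEQ)
    moreover have "continuous_on (cball 0 R) l"
      by (rule uniform_limit_theorem[OF _ l]) (auto intro!: always_eventually continuous_intros)
    ultimately have "continuous_on (cball 0 R) (\<lambda>x. qpoch_inf x (of_real q))"
      by (subst continuous_on_cong[OF refl, of _ _ l]) auto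
    thus ?thesis by (rule continuous_on_subset) auto
  qed
  note cb = this
  have "isCont (\<lambda>x. qpoch_inf x (of_real q)) x" for x
    using continuous_on_interior[OF cb[of "norm x + 1"], of x] by (simp add: interior_open)
  thus ?thesis by (simp add: continuous_at_imp_continuous_on)
qed

section \<open>The function \<open>q^(-x/2) - q^(x/2)\<close>: identities and growth\<close>

definition lq :: complex where "lq = of_real (ln q)"

lemma ln_q_neg: "ln q < 0"
  using q by (simp add: ln_less_zero)

lemma lq_nz: "lq \<noteq> 0" and Re_lq: "Re lq = ln q" and Im_lq: "Im lq = 0"
proof -
  show "lq \<noteq> 0" unfolding lq_def of_real_eq_0_iff using ln_q_neg by linarith
qed (unfold lq_def, rule Re_complex_of_real, rule Im_complex_of_real)

definition ts :: "complex \<Rightarrow> complex" where "ts x = exp (- (x * lq / 2)) - exp (x * lq / 2)"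
definition tf :: "complex \<Rightarrow> complex" where "tf x = exp (x * lq) + exp (- (x * lq))"
definition te :: "nat \<Rightarrow> real" where "te m = exp (- (real m * ln q / 2))"

lemma exp_nat_lq: "exp (of_nat m * lq) = of_real (q ^ m)"
proof -
  have "exp lq = of_real q" unfolding lq_def exp_of_real using q(1) by simp
  thus ?thesis by (simp only: exp_of_nat_mult of_real_power)
qed

lemma ts_eq: "ts x = exp (- (x * lq / 2)) * (1 - exp (x * lq))"
  by (simp add: ts_def right_diff_distrib exp_add[symmetric])

lemma ts_eq_0_iff: "ts x = 0 \<longleftrightarrow> exp (x * lq) = 1"
  by (simp add: ts_eq)

text \<open>Once \<open>te m\<close> is split off, the other factor tends to a nonzero limit because
  \<open>q^m\<close> tends to 0; the growth estimates for \<open>ts\<close> along the integers start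
  from this.\<close>

lemma ts_shift: "ts (\<alpha> + of_nat m) = of_real (te m) * (exp (- (\<alpha> * lq / 2)) - exp (\<alpha> * lq / 2) * of_real (q ^ m))"
proof -
  have "of_real (te m) = exp (- (of_nat m * lq / 2))" by (simp add: te_def lq_def exp_of_real[symmetric])
  moreover have "exp (- (of_nat m * lq / 2)) * of_real (q ^ m) = exp (of_nat m * lq / 2)"
    unfolding exp_nat_lq[symmetric] exp_add[symmetric] by simp
  ultimately show ?thesis
    by (simp add: ts_def algebra_simps add_divide_distrib exp_add exp_diff exp_minus) (simp add: field_simps)
qed

lemma te_pos: "te m > 0" and te_ge_1: "te m \<ge> 1" and te_Suc: "te (Suc m) / te m = exp (- (ln q / 2))"
  using ln_q_neg by (auto simp: te_def exp_diff[symmetric] field_simps mult_nonneg_nonpos)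

lemma te_powr: "te m powr \<eta> = exp (- (ln q / 2) * \<eta>) ^ m"
  by (simp add: te_def exp_powr_real exp_of_nat_mult[symmetric])

text \<open>Exponentials become letters with explicit inverses, so the identity is polynomial modulo
  five relations and within reach of \<open>algebra\<close>.\<close>

lemma trig_quad_aux:
  fixes A B C D Z A' B' C' D' Z' :: complex
  assumes "A * A' = 1" "B * B' = 1" "C * C' = 1" "D * D' = 1" "Z * Z' = 1"
  shows "(A'*Z' - A*Z) * (B'*Z' - B*Z) * (C'*Z' - C*Z) * (D'*Z' - D*Z)
     - (A'*Z - A*Z') * (B'*Z - B*Z') * (C'*Z - C*Z') * (D'*Z - D*Z')
    = (Z'^2 - Z^2) * ((A'*B'*C'*D' - A*B*C*D) * (Z^2 + Z'^2 - (D^2 + D'^2)) +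
        (A'*D' - A*D) * (B'*D' - B*D) * (C'*D' - C*D))"
  using assms by algebra

lemma trig_quad:
  "ts (h1 + z) * ts (h2 + z) * ts (h3 + z) * ts (h4 + z)
        - ts (h1 - z) * ts (h2 - z) * ts (h3 - z) * ts (h4 - z)
      = ts (2 * z) * (ts (h1 + h2 + h3 + h4) * (tf z - tf h4) + ts (h1 + h4) * ts (h2 + h4) * ts (h3 + h4))"
proof -
  define E where "E = (\<lambda>x. exp (x * lq / 2))"
  have Eadd: "E (x + y) = E x * E y" for x y
    by (simp only: E_def distrib_right add_divide_distrib exp_add)
  have inv: "E x * E (- x) = 1" for x
    unfolding Eadd[symmetric] by (simp add: E_def)
  have tsE: "ts x = E (- x) - E x" for x by (simp add: ts_def E_def)
  have tfE: "tf x = E x ^ 2 + E (- x) ^ 2" for x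
  proof -
    have half: "y / 2 + y / 2 = y" for y :: complex by simp
    show ?thesis unfolding tf_def E_def power2_eq_square exp_add[symmetric] half by simp
  qed
  have ts_add: "ts (x + y) = E (- x) * E (- y) - E x * E y" for x y
    unfolding tsE minus_add_distrib Eadd ..
  have ts_diff: "ts (x - y) = E (- x) * E y - E x * E (- y)" for x y
    using ts_add[of x "- y"] by simp
  have ts_add4: "ts (x + y + z + w) = E (- x) * E (- y) * E (- z) * E (- w) - E x * E y * E z * E w" for x y z w
    unfolding tsE minus_add_distrib Eadd ..
  have ts_2: "ts (2 * z) = E (- z) ^ 2 - E z ^ 2"
    unfolding mult_2 power2_eq_square by (rule ts_add)
  show ?thesis
    unfolding ts_add4 ts_add[of h1 z] ts_add[of h2 z] ts_add[of h3 z] ts_add[of h4 z]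
      ts_add[of h1 h4] ts_add[of h2 h4] ts_add[of h3 h4] ts_diff ts_2 tfE
    by (rule trig_quad_aux[OF inv inv inv inv inv])
qed

lemma tendsto_exp_lq: "\<alpha> \<longlonglongrightarrow> \<alpha>0 \<Longrightarrow> (\<lambda>k. exp (\<alpha> k * lq / 2)) \<longlonglongrightarrow> exp (\<alpha>0 * lq / 2)"
  "\<alpha> \<longlonglongrightarrow> \<alpha>0 \<Longrightarrow> (\<lambda>k. exp (- (\<alpha> k * lq / 2))) \<longlonglongrightarrow> exp (- (\<alpha>0 * lq / 2))"
  by (intro tendsto_exp tendsto_minus tendsto_divide tendsto_mult tendsto_const; simp)+

lemma ts_upper:
  assumes "\<alpha> \<longlonglongrightarrow> \<alpha>0"
  shows "\<exists>C. \<forall>\<^sub>F k in sequentially. \<forall>m. norm (ts (\<alpha> k + of_nat m)) \<le> C * te m"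
proof -
  define C where "C = (norm (exp (- (\<alpha>0 * lq / 2))) + 1) + (norm (exp (\<alpha>0 * lq / 2)) + 1)"
  have "\<forall>\<^sub>F k in sequentially. norm (exp (- (\<alpha> k * lq / 2))) < norm (exp (- (\<alpha>0 * lq / 2))) + 1"
    by (rule order_tendstoD(2)[OF tendsto_norm[OF tendsto_exp_lq(2)[OF assms]]]) simp
  moreover have "\<forall>\<^sub>F k in sequentially. norm (exp (\<alpha> k * lq / 2)) < norm (exp (\<alpha>0 * lq / 2)) + 1"
    by (rule order_tendstoD(2)[OF tendsto_norm[OF tendsto_exp_lq(1)[OF assms]]]) simp
  ultimately have "\<forall>\<^sub>F k in sequentially. \<forall>m. norm (ts (\<alpha> k + of_nat m)) \<le> C * te m"
  proof eventually_elim
    case (elim k)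
    show ?case
    proof
      fix m
      have "norm (exp (- (\<alpha> k * lq / 2)) - exp (\<alpha> k * lq / 2) * of_real (q ^ m))
          \<le> norm (exp (- (\<alpha> k * lq / 2))) + norm (exp (\<alpha> k * lq / 2)) * q ^ m"
        using q by (intro order.trans[OF norm_triangle_ineq4]) (simp add: norm_mult norm_power)
      also have "\<dots> \<le> norm (exp (- (\<alpha> k * lq / 2))) + norm (exp (\<alpha> k * lq / 2)) * 1"
        using q by (intro add_left_mono mult_left_mono power_le_one) auto
      also have "\<dots> \<le> C" unfolding C_def using elim by linarith
      finally have "te m * norm (exp (- (\<alpha> k * lq / 2)) - exp (\<alpha> k * lq / 2) * of_real (q ^ m)) \<le> te m * C"
        using te_pos[of m] by (intro mult_left_mono) auto
      thus "norm (ts (\<alpha> k + of_nat m)) \<le> C * te m"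
        unfolding ts_shift norm_mult using te_pos[of m] by (simp add: mult.commute)
    qed
  qed
  thus ?thesis by blast
qed

lemma tendsto_q_power: "(\<lambda>m. of_real (q ^ m) :: complex) \<longlonglongrightarrow> 0"
  using tendsto_of_real[OF LIMSEQ_power_zero[of q]] q by simp

text \<open>The subsequence \<open>r\<close> lets one proof serve both lower growth axioms:
  \<open>r m = m\<close>, and \<open>r m = 2 m\<close> for the doubled step.\<close>

lemma ts_lower:
  assumes sub: "strict_mono r" and nz: "\<And>m::nat. ts (\<alpha>0 + of_nat (r m)) \<noteq> 0"
  shows "\<exists>C>0. \<forall>m. te (r m) \<le> C * norm (ts (\<alpha>0 + of_nat (r m)))"
proof (rule bounded_ratio_imp_bound[OF _ nz])
  have "(\<lambda>m. 1 / norm (exp (- (\<alpha>0 * lq / 2)) - exp (\<alpha>0 * lq / 2) * of_real (q ^ m))) \<longlonglongrightarrow> 1 / norm (exp (- (\<alpha>0 * lq / 2)) - exp (\<alpha>0 * lq / 2) * 0)"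
    by (intro tendsto_divide tendsto_norm tendsto_diff tendsto_mult tendsto_const tendsto_q_power) auto
  from LIMSEQ_subseq_LIMSEQ[OF this sub]
  have "(\<lambda>m. 1 / norm (exp (- (\<alpha>0 * lq / 2)) - exp (\<alpha>0 * lq / 2) * of_real (q ^ r m))) \<longlonglongrightarrow> 1 / norm (exp (- (\<alpha>0 * lq / 2)) - exp (\<alpha>0 * lq / 2) * 0)"
    by (simp add: o_def)
  moreover have "te (r m) / norm (ts (\<alpha>0 + of_nat (r m))) = 1 / norm (exp (- (\<alpha>0 * lq / 2)) - exp (\<alpha>0 * lq / 2) * of_real (q ^ r m))" for m
    unfolding ts_shift norm_mult using te_pos[of "r m"] by simp
  ultimately show "(\<lambda>m. te (r m) / norm (ts (\<alpha>0 + of_nat (r m)))) \<longlonglongrightarrow> 1 / norm (exp (- (\<alpha>0 * lq / 2)) - exp (\<alpha>0 * lq / 2) * 0)"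
    by simp
qed

lemma te_double: "te (2 * m) = te m ^ 2"
  by (simp add: te_def exp_double[symmetric] field_simps)

lemma ts_ratio:
  assumes \<alpha>: "\<alpha> \<longlonglongrightarrow> \<alpha>0" and \<beta>: "\<beta> \<longlonglongrightarrow> \<beta>0" and c: "Re (\<alpha>0 - \<beta>0) < c"
  shows "\<exists>i0. \<forall>\<^sub>F k in sequentially. \<forall>i\<ge>i0. norm (ts (\<alpha> k + of_nat i)) \<le> norm (ts (\<beta> k + of_nat i)) * (te (Suc i) / te i) powr c"
proof -
  define E where "E = exp (- (ln q / 2)) powr c"
  have E: "E > 0" by (simp add: E_def)
  define a0 where "a0 = norm (exp (- (\<alpha>0 * lq / 2)))"
  define b0 where "b0 = norm (exp (- (\<beta>0 * lq / 2))) * E"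
  have gap: "a0 < b0"
  proof -
    have "a0 = exp (- (Re \<alpha>0 * ln q / 2))" by (simp add: a0_def Re_lq Im_lq)
    moreover have "b0 = exp (- (Re \<beta>0 * ln q / 2) + - (ln q / 2) * c)" unfolding b0_def E_def exp_add
      by (simp add: Re_lq Im_lq exp_powr_real mult.commute)
    moreover have "(Re \<beta>0 + c - Re \<alpha>0) * ln q < 0" using c ln_q_neg by (intro mult_pos_neg) auto
    hence "- (Re \<alpha>0 * ln q / 2) < - (Re \<beta>0 * ln q / 2) + - (ln q / 2) * c" by (simp add: algebra_simps)
    ultimately show ?thesis by simp
  qed
  \<comment> \<open>A quarter of the gap between the leading terms: one quarter for each of the two
    limits and one for the remainders of order \<open>q^i\<close>.\<close>
  define \<delta> where "\<delta> = (b0 - a0) / 4"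
  have \<delta>: "\<delta> > 0" using gap by (simp add: \<delta>_def)
  define A1 where "A1 = norm (exp (\<alpha>0 * lq / 2)) + 1"
  define B1 where "B1 = norm (exp (\<beta>0 * lq / 2)) + 1"
  have "(\<lambda>i. (A1 + B1 * E) * q ^ i) \<longlonglongrightarrow> (A1 + B1 * E) * 0"
    using q by (intro tendsto_mult tendsto_const LIMSEQ_power_zero) auto
  hence "\<forall>\<^sub>F i in sequentially. (A1 + B1 * E) * q ^ i < \<delta>"
    using \<delta> by (intro order_tendstoD(2)) auto
  then obtain i0 where i0: "\<And>i. i \<ge> i0 \<Longrightarrow> (A1 + B1 * E) * q ^ i < \<delta>" by (auto simp: eventually_sequentially)
  have "\<forall>\<^sub>F k in sequentially. norm (exp (- (\<alpha> k * lq / 2))) < a0 + \<delta>"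
    by (rule order_tendstoD(2)[OF tendsto_norm[OF tendsto_exp_lq(2)[OF \<alpha>]]]) (simp add: a0_def \<delta>)
  moreover have "\<forall>\<^sub>F k in sequentially. norm (exp (\<alpha> k * lq / 2)) < A1"
    by (rule order_tendstoD(2)[OF tendsto_norm[OF tendsto_exp_lq(1)[OF \<alpha>]]]) (simp add: A1_def)
  moreover have "\<forall>\<^sub>F k in sequentially. norm (exp (- (\<beta> k * lq / 2))) * E > b0 - \<delta>"
    by (rule order_tendstoD(1)[OF tendsto_mult[OF tendsto_norm[OF tendsto_exp_lq(2)[OF \<beta>]] tendsto_const]]) (simp add: b0_def \<delta>)
  moreover have "\<forall>\<^sub>F k in sequentially. norm (exp (\<beta> k * lq / 2)) < B1"
    by (rule order_tendstoD(2)[OF tendsto_norm[OF tendsto_exp_lq(1)[OF \<beta>]]]) (simp add: B1_def)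
  ultimately have "\<forall>\<^sub>F k in sequentially. \<forall>i\<ge>i0. norm (ts (\<alpha> k + of_nat i)) \<le> norm (ts (\<beta> k + of_nat i)) * (te (Suc i) / te i) powr c"
  proof eventually_elim
    case (elim k)
    show ?case
    proof (intro allI impI)
      fix i assume i: "i \<ge> i0"
      define Q where "Q = q ^ i"
      have Q: "Q \<ge> 0" using q by (simp add: Q_def)
      define P where "P = exp (- (\<alpha> k * lq / 2)) - exp (\<alpha> k * lq / 2) * of_real Q"
      define R where "R = exp (- (\<beta> k * lq / 2)) - exp (\<beta> k * lq / 2) * of_real Q"
      have "norm P \<le> norm (exp (- (\<alpha> k * lq / 2))) + norm (exp (\<alpha> k * lq / 2)) * Q"
        unfolding P_def using Q by (intro order.trans[OF norm_triangle_ineq4]) (simp add: norm_mult)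
      also have "\<dots> \<le> (a0 + \<delta>) + A1 * Q"
        using elim Q by (intro add_mono mult_right_mono) auto
      finally have P: "norm P \<le> a0 + \<delta> + A1 * Q" .
      have "norm R \<ge> norm (exp (- (\<beta> k * lq / 2))) - norm (exp (\<beta> k * lq / 2)) * Q"
        unfolding R_def using Q by (intro order.trans[OF _ norm_triangle_ineq2]) (simp add: norm_mult)
      hence "norm R * E \<ge> (norm (exp (- (\<beta> k * lq / 2))) - norm (exp (\<beta> k * lq / 2)) * Q) * E"
        using E by (intro mult_right_mono) auto
      moreover have "norm (exp (\<beta> k * lq / 2)) * Q * E \<le> B1 * Q * E"
        using elim Q E by (intro mult_right_mono) auto
      ultimately have R: "norm R * E \<ge> b0 - \<delta> - B1 * Q * E"
        using elim by (simp add: left_diff_distrib)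
      have "(A1 + B1 * E) * Q < \<delta>" unfolding Q_def by (rule i0[OF i])
      hence "A1 * Q + B1 * Q * E < \<delta>" by (simp add: algebra_simps)
      moreover have "b0 - a0 = 4 * \<delta>" by (simp add: \<delta>_def)
      ultimately have "norm P \<le> norm R * E" using P R \<delta> by linarith
      hence "te i * norm P \<le> te i * (norm R * E)" using te_pos[of i] by (intro mult_left_mono) auto
      thus "norm (ts (\<alpha> k + of_nat i)) \<le> norm (ts (\<beta> k + of_nat i)) * (te (Suc i) / te i) powr c"
        unfolding ts_shift norm_mult te_Suc E_def[symmetric] P_def R_def Q_def using te_pos[of i] by (simp add: mult.assoc)
    qed
  qed
  thus ?thesis by blast
qed

lemma norm_ts_le: "norm (ts z) \<le> exp (- (\<bar>Re z\<bar> * ln q / 2)) + 1"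
  and norm_ts_ge: "Re z \<ge> 0 \<Longrightarrow> norm (ts z) \<ge> exp (- (Re z * ln q / 2)) - 1"
proof -
  have n: "norm (exp (- (z * lq / 2))) = exp (- (Re z * ln q / 2))" "norm (exp (z * lq / 2)) = exp (Re z * ln q / 2)"
    by (auto simp: Re_lq Im_lq)
  have "norm (ts z) \<le> exp (- (Re z * ln q / 2)) + exp (Re z * ln q / 2)"
    unfolding ts_def n[symmetric] by (rule norm_triangle_ineq4)
  also have "\<dots> \<le> exp (- (\<bar>Re z\<bar> * ln q / 2)) + 1"
    using ln_q_neg by (cases "Re z \<ge> 0") (auto simp: mult_nonneg_nonpos mult_nonpos_nonpos)
  finally show "norm (ts z) \<le> exp (- (\<bar>Re z\<bar> * ln q / 2)) + 1" .
  assume "Re z \<ge> 0"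
  hence "exp (Re z * ln q / 2) \<le> 1" using ln_q_neg by (simp add: mult_nonneg_nonpos)
  thus "norm (ts z) \<ge> exp (- (Re z * ln q / 2)) - 1"
    using norm_triangle_ineq2[of "exp (- (z * lq / 2))" "exp (z * lq / 2)"] n unfolding ts_def by linarith
qed

lemma ts_far_ratio:
  "\<exists>i0. \<forall>\<^sub>F M in sequentially. \<forall>i\<ge>i0. norm (ts (x - u - of_nat M + of_nat i)) \<le> norm (ts (1 + x + u + of_nat M + of_nat i))"
proof -
  \<comment> \<open>So that \<open>q^(-K) = 3\<close>: with \<open>E = q^(-d/2)\<close>, which is at
    least 1, the bounds compare as \<open>3 E - 1 \<ge> E + 1\<close>.\<close>
  define K where "K = ln 3 / (- ln q)"
  have K: "K > 0" "exp (- (K * ln q)) = 3"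
  proof -
    show "K > 0" unfolding K_def using ln_q_neg by (intro divide_pos_pos) auto
    have "- (K * ln q) = ln 3" unfolding K_def using ln_q_neg by (simp add: field_simps)
    thus "exp (- (K * ln q)) = 3" by simp
  qed
  obtain i0 :: nat where i0: "real i0 > K - Re x" using reals_Archimedean2 by blast
  obtain M0 :: nat where M0: "real M0 > K - Re u" using reals_Archimedean2 by blast
  have "norm (ts (x - u - of_nat M + of_nat i)) \<le> norm (ts (1 + x + u + of_nat M + of_nat i))" if "M \<ge> M0" "i \<ge> i0" for M i
  proof -
    define w v where "w = x + of_nat i + 1/2" and "v = u + of_nat M + 1/2"
    have w: "Re w \<ge> K" and v: "Re v \<ge> K" using that i0 M0 by (auto simp: w_def v_def)
    define d where "d = \<bar>Re w - Re v\<bar>"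
    have "d + 2 * K \<le> Re (w + v)" using w v by (auto simp: d_def)
    hence "exp (- ((d + 2 * K) * ln q / 2)) \<le> exp (- (Re (w + v) * ln q / 2))"
      using ln_q_neg by (simp add: mult_right_mono_neg)
    also have "exp (- ((d + 2 * K) * ln q / 2)) = exp (- (d * ln q / 2)) * 3"
      unfolding K(2)[symmetric] exp_add[symmetric] by (simp add: field_simps)
    finally have "exp (- (d * ln q / 2)) * 3 - 1 \<le> norm (ts (w + v))"
      using norm_ts_ge[of "w + v"] w v K by simp
    moreover have "norm (ts (w - v)) \<le> exp (- (d * ln q / 2)) + 1"
      using norm_ts_le[of "w - v"] by (simp add: d_def)
    moreover have "exp (- (d * ln q / 2)) \<ge> 1" using ln_q_neg by (simp add: d_def mult_nonneg_nonpos)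
    ultimately have "norm (ts (w - v)) \<le> norm (ts (w + v))" by linarith
    thus ?thesis by (simp add: w_def v_def algebra_simps)
  qed
  thus ?thesis unfolding eventually_sequentially by blast
qed

text \<open>The leading exponents \<open>x - u\<close> and \<open>1 + x + u\<close> add up in the
  quotient and \<open>u\<close> cancels; this is what frees the far limit of the series from
  \<open>b\<close>.\<close>

lemma ts_far_limit: "(\<lambda>M. ts (x - u - of_nat M) / ts (1 + x + u + of_nat M)) \<longlonglongrightarrow> - exp ((2 * x + 1) * lq / 2)"
proof -
  have num: "ts (x - u - of_nat M) = - of_real (te M) * (exp ((x - u) * lq / 2) - exp (- ((x - u) * lq / 2)) * of_real (q ^ M))" for M
  proof -
    have "ts (- z) = - ts z" for z by (simp add: ts_def)
    from this[of "- (x - u) + of_nat M"] have "ts (x - u - of_nat M) = - ts (- (x - u) + of_nat M)"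
      by (simp add: algebra_simps)
    also have "\<dots> = - of_real (te M) * (exp ((x - u) * lq / 2) - exp (- ((x - u) * lq / 2)) * of_real (q ^ M))"
      unfolding ts_shift mult_minus_left minus_divide_left minus_minus ..
    finally show ?thesis .
  qed
  have den: "ts (1 + x + u + of_nat M) = of_real (te M) * (exp (- ((1 + x + u) * lq / 2)) - exp ((1 + x + u) * lq / 2) * of_real (q ^ M))" for M
    by (rule ts_shift)
  have "(\<lambda>M. - (exp ((x - u) * lq / 2) - exp (- ((x - u) * lq / 2)) * of_real (q ^ M)) /
      (exp (- ((1 + x + u) * lq / 2)) - exp ((1 + x + u) * lq / 2) * of_real (q ^ M)))
    \<longlonglongrightarrow> - (exp ((x - u) * lq / 2) - exp (- ((x - u) * lq / 2)) * 0) / (exp (- ((1 + x + u) * lq / 2)) - exp ((1 + x + u) * lq / 2) * 0)"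
    by (intro tendsto_divide tendsto_minus tendsto_diff tendsto_mult tendsto_const tendsto_q_power) auto
  also have "- (exp ((x - u) * lq / 2) - exp (- ((x - u) * lq / 2)) * 0) / (exp (- ((1 + x + u) * lq / 2)) - exp ((1 + x + u) * lq / 2) * 0)
      = - exp ((2 * x + 1) * lq / 2)"
    by (simp add: exp_diff[symmetric]) (simp add: field_simps)
  finally have lim: "(\<lambda>M. - (exp ((x - u) * lq / 2) - exp (- ((x - u) * lq / 2)) * of_real (q ^ M)) /
      (exp (- ((1 + x + u) * lq / 2)) - exp ((1 + x + u) * lq / 2) * of_real (q ^ M))) \<longlonglongrightarrow> - exp ((2 * x + 1) * lq / 2)" .
  have cancel: "(- r * A) / (r * B) = - A / B" if "r \<noteq> 0" for r A B :: complex using that by simp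
  have "of_real (te M) \<noteq> (0::complex)" for M using te_pos[of M] by simp
  from cancel[OF this] show ?thesis unfolding num den using lim by (simp only:)
qed

lemma sfun_full_trig: "sfun_full ts tf te (\<lambda>_. 1) (\<lambda>x. 1 - exp (x * lq)) (\<lambda>x. exp (- (x * lq / 2)))
   (\<lambda>x. qpoch_inf (exp (x * lq)) (of_real q))"
proof (unfold_locales, goal_cases)
  case (1 x)
  show ?case by (simp add: ts_def)
next
  case (2 x y)
  show ?case unfolding ts_def tf_def
    by (simp add: algebra_simps exp_add[symmetric] exp_minus[symmetric] add_divide_distrib diff_divide_distrib)
next
  case (3 h1 z h2 h3 h4)
  show ?case by (rule trig_quad)
next
  case (4 x)
  hence "norm (exp (x * lq)) = 1" by (simp add: ts_eq_0_iff)
  thus ?case using lq_nz by (simp add: Re_lq Im_lq ln_q_neg less_imp_neq[OF ln_q_neg])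
next
  case (5 m)
  show ?case by (rule te_ge_1)
next
  case (6 k m)
  thus ?case by (simp add: te_def exp_add[symmetric] of_nat_diff exp_double[symmetric] field_simps)
next
  case 8
  show ?case unfolding ts_def by (intro continuous_intros) auto
next
  case (9 \<alpha> \<alpha>0)
  thus ?case by (rule ts_upper)
next
  case (10 \<alpha> \<alpha>0)
  from ts_upper[OF this] obtain C where C: "\<forall>\<^sub>F k in sequentially. \<forall>m. norm (ts (\<alpha> k + of_nat m)) \<le> C * te m" by blast
  from C have "\<forall>\<^sub>F k in sequentially. \<forall>m. norm (ts (\<alpha> k + 2 * of_nat m)) \<le> C * (te m ^ 2 / 1)"
  proof eventually_elim
    case (elim k)
    show ?case
    proof
      fix m
      show "norm (ts (\<alpha> k + 2 * of_nat m)) \<le> C * (te m ^ 2 / 1)"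
        using elim[rule_format, of "2 * m"] by (simp add: te_double)
    qed
  qed
  thus ?case by blast
next
  case (11 \<alpha>0)
  thus ?case using ts_lower[of "\<lambda>m. m" \<alpha>0] by (simp add: strict_mono_def)
next
  case (12 \<alpha>0)
  thus ?case using ts_lower[of "\<lambda>m. 2 * m" \<alpha>0] by (simp add: strict_mono_def te_double)
next
  case (13 \<alpha> \<alpha>0 \<beta> \<beta>0 c)
  thus ?case by (rule ts_ratio)
next
  case (14 x u)
  show ?case by (rule ts_far_ratio)
next
  case (15 x)
  show ?case using ts_far_limit by blast
next
  case (16 \<eta>)
  hence "exp (- (ln q / 2) * \<eta>) < 1" using ln_q_neg by (simp add: mult_neg_neg)
  thus ?case unfolding te_powr by (simp add: summable_geometric)
next
  case (17 \<eta>)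
  hence "exp (- (ln q / 2) * \<eta>) < 1" using ln_q_neg by (simp add: mult_neg_neg)
  thus ?case unfolding te_powr by (intro LIMSEQ_power_zero) auto
next
  case (18 x)
  show ?case by (rule ts_eq)
next
  case (19 x y)
  show ?case by (simp add: exp_add[symmetric] algebra_simps add_divide_distrib)
next
  case (21 x)
  have "exp ((x + 1) * lq) = exp (x * lq) * of_real q"
    using exp_nat_lq[of 1] by (simp add: distrib_right exp_add)
  thus ?case using qpoch_inf_rec[of "exp (x * lq)"] by simp
next
  case (22 x)
  show ?case
  proof (rule qpoch_inf_nonzero)
    fix k
    have "exp ((x + of_nat k) * lq) \<noteq> 1" using 22[of k] by (simp add: ts_eq_0_iff)
    thus "1 - exp (x * lq) * of_real q ^ k \<noteq> 0"
      using exp_nat_lq[of k] by (simp add: distrib_right exp_add)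
  qed
next
  case 23
  show ?case by (rule continuous_on_compose2[OF continuous_qpoch_inf]) (auto intro!: continuous_intros)
next
  case (24 I ys zs)
  have G: "(\<lambda>M. qpoch_inf (exp ((y + of_nat M) * lq)) (of_real q)) \<longlonglongrightarrow> 1" for y
  proof -
    have "(\<lambda>M. exp (y * lq) * of_real (q ^ M)) \<longlonglongrightarrow> exp (y * lq) * 0"
      by (intro tendsto_mult tendsto_const tendsto_q_power)
    hence "(\<lambda>M. exp ((y + of_nat M) * lq)) \<longlonglongrightarrow> 0"
      by (simp add: distrib_right exp_add exp_nat_lq)
    hence "(\<lambda>M. qpoch_inf (exp ((y + of_nat M) * lq)) (of_real q)) \<longlonglongrightarrow> qpoch_inf 0 (of_real q)"
      by (rule continuous_on_tendsto_compose[OF continuous_qpoch_inf]) auto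
    thus ?thesis by (simp add: qpoch_inf_def)
  qed
  have "(\<lambda>M. (\<Prod>i\<in>I. qpoch_inf (exp ((ys i + of_nat M) * lq)) (of_real q)) / (\<Prod>i\<in>I. qpoch_inf (exp ((zs i + of_nat M) * lq)) (of_real q)))
     \<longlonglongrightarrow> (\<Prod>i\<in>I. 1) / (\<Prod>i\<in>I. 1)"
    by (intro tendsto_divide tendsto_prod G) auto
  thus ?case by simp
next
  case 25
  have "{x. ts x = 0} \<subseteq> range (\<lambda>n::int. of_real (2 * of_int n * pi) * \<i> / lq)"
  proof
    fix x assume "x \<in> {x. ts x = 0}"
    hence "exp (x * lq) = 1" by (simp add: ts_eq_0_iff)
    then obtain n :: int where "x * lq = of_real (2 * of_int n * pi) * \<i>"
      unfolding exp_eq_1 by (auto simp: complex_eq_iff)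
    hence "x = of_real (2 * of_int n * pi) * \<i> / lq" using lq_nz by (simp add: field_simps)
    thus "x \<in> range (\<lambda>n::int. of_real (2 * of_int n * pi) * \<i> / lq)" by blast
  qed
  thus ?case by (rule countable_subset) auto
qed auto

end

section \<open>The summation formula\<close>

context sfun_full
begin

text \<open>The converse of \<open>G_nonzero\<close>. The genericity of the theorem also speaks of
  the factors \<open>G\<close> of the closed form; this turns it into nonvanishing denominators of
  the weight for all shifts at once.\<close>

lemma s_nonzero_if_G: "G x \<noteq> 0 \<Longrightarrow> s (x + of_nat i) \<noteq> 0"
proof
  assume "G x \<noteq> 0" "s (x + of_nat i) = 0"
  have "G x = (\<Prod>k<m. t (x + of_nat k)) * G (x + of_nat m)" for m
  proof (induction m)
    case (Suc m)
    thus ?case using G_rec[of "x + of_nat m"] by (simp add: add_ac mult_ac)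
  qed simp
  from this[of "Suc i"] have "G x = 0"
    using \<open>s (x + of_nat i) = 0\<close> \<kappa>_nonzero[of "x + of_nat i"] by (simp add: s_t)
  thus False using \<open>G x \<noteq> 0\<close> by simp
qed

lemma summation_N_raw:
  assumes n: "n \<ge> 1" and conv: "converges n g (a + b + c + d)"
    and double: "\<And>j. j \<in> {1..n} \<Longrightarrow> s (2 * rh n g a j) \<noteq> 0"
    and pair: "\<And>j k. j \<in> {1..n} \<Longrightarrow> k \<in> {j<..n} \<Longrightarrow>
       s (rh n g a j + rh n g a k) \<noteq> 0 \<and> s (rh n g a j - rh n g a k) \<noteq> 0 \<and>
       G (1 - g + rh n g a j + rh n g a k) \<noteq> 0 \<and> G (1 - g + rh n g a j - rh n g a k) \<noteq> 0 \<and>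
       G (1 - rh n g a j + rh n g a k) \<noteq> 0"
    and single: "\<And>v j. v \<in> {a, b, c, d} \<Longrightarrow> j \<in> {1..n} \<Longrightarrow> G (1 - v + rh n g a j) \<noteq> 0"
  shows "(\<lambda>l. norm (weight n g a b c d l)) summable_on Lam n"
    and "infsum (weight n g a b c d) (Lam n) = N_raw n g a b c d"
proof -
  have reg: "regular n g a v" if "v \<in> {a, b, c, d}" for v
    unfolding regular_def
  proof (intro allI impI)
    fix w i assume "w < n"
    hence "G (1 - v + (of_nat w * g + a)) \<noteq> 0"
      using single[OF that, of "n - w"] by (simp add: rh_def)
    from s_nonzero_if_G[OF this, of i] show "s (1 - v + a + of_nat w * g + of_nat i) \<noteq> 0"
      by (simp add: add_ac)
  qed
  have adm: "admissible n g a"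
    unfolding admissible_def
  proof (intro ballI conjI allI double)
    fix j k i assume jk: "j \<in> {1..n}" "k \<in> {j<..n}"
    show "s (rh n g a j + rh n g a k) \<noteq> 0" "s (rh n g a j - rh n g a k) \<noteq> 0" using pair[OF jk] by auto
    show "s (1 - g + (rh n g a j + rh n g a k) + of_nat i) \<noteq> 0"
      using s_nonzero_if_G[of "1 - g + rh n g a j + rh n g a k" i] pair[OF jk] by (simp add: add.assoc)
    show "s (1 - g + (rh n g a j - rh n g a k) + of_nat i) \<noteq> 0"
      using s_nonzero_if_G[of "1 - g + rh n g a j - rh n g a k" i] pair[OF jk] by (simp add: add_diff_eq)
  qed
  have sm: "(\<lambda>l. norm (weight n g a b c d l)) summable_on Lam n" "infsum (weight n g a b c d) (Lam n) = N0 n g a b c d"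
    by (rule summation[OF n adm _ _ _ _ conv]; rule reg; simp)+
  show "(\<lambda>l. norm (weight n g a b c d l)) summable_on Lam n" by (rule sm(1))
  have "N_raw n g a b c d = N0 n g a b c d"
    by (rule N_raw_eq_N0[OF n conv reg]) (use pair in auto)
  thus "infsum (weight n g a b c d) (Lam n) = N_raw n g a b c d" using sm(2) by simp
qed

end

lemma permutation4:
  fixes a b c d :: nat
  assumes "{a, b, c, d} = {1, 2, 3, 4}"
  shows "a \<noteq> b" "a \<noteq> c" "a \<noteq> d" "b \<noteq> c" "b \<noteq> d" "c \<noteq> d"
    and "{1..4} = {a, b, c, d}"
proof -
  have "card {a, b, c, d} = 4" unfolding assms by simp
  thus "a \<noteq> b" "a \<noteq> c" "a \<noteq> d" "b \<noteq> c" "b \<noteq> d" "c \<noteq> d"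
    by (auto simp: card_insert_if split: if_splits)
  show "{1..4} = {a, b, c, d}" unfolding assms by auto
qed

lemma prod_permutation4:
  fixes a b c d :: nat and F :: "nat \<Rightarrow> complex"
  assumes "{a, b, c, d} = {1, 2, 3, 4}"
  shows "(\<Prod>r=1..4. F r) = F a * F b * F c * F d"
  unfolding permutation4(7)[OF assms] using permutation4(1-6)[OF assms] by (simp add: mult_ac)

lemma sum_permutation4:
  fixes a b c d :: nat and F :: "nat \<Rightarrow> complex"
  assumes "{a, b, c, d} = {1, 2, 3, 4}"
  shows "F a + F b + F c + F d = F 1 + F 2 + F 3 + F 4"
proof -
  have "(\<Sum>r\<in>{a, b, c, d}. F r) = F a + F b + F c + F d"
    using permutation4(1-6)[OF assms] by (simp add: add_ac)
  moreover have "(\<Sum>r\<in>{1, 2, 3, 4::nat}. F r) = F 1 + F 2 + F 3 + F 4" by (simp add: add_ac)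
  ultimately show ?thesis unfolding assms by simp
qed

lemma ghat_values:
  assumes "{a, b, c, d} = {1, 2, 3, 4}"
  shows "ghat gs a b c d a = (gs a + gs b + gs c + gs d) / 2"
    "ghat gs a b c d b = (gs a + gs b - gs c - gs d) / 2"
    "ghat gs a b c d c = (gs a - gs b + gs c - gs d) / 2"
    "ghat gs a b c d d = (gs a - gs b - gs c + gs d) / 2"
  using permutation4(1-6)[OF assms] by (auto simp: ghat_def)

text \<open>The genericity predicates state even the conditions free of \<open>l\<close> under a
  quantifier over \<open>Lam n\<close>; extracting them takes an element.\<close>

lemma zero_in_Lam: "(\<lambda>j. if j \<in> {1..n} then 0 else undefined) \<in> Lam n"
  by (auto simp: Lam_def)

lemma summation_rational:
  assumes n: "n \<ge> 1" and perm: "{a, b, c, d} = {1, 2, 3, 4}" and gen: "generic_1 n g gs a b c d"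
    and conv: "\<forall>j\<in>{1..n}. Re (1 - 2 * of_nat (n - j) * g - gs 1 - gs 2 - gs 3 - gs 4) > 0"
  shows "(\<lambda>l. norm (Delta_1 n g gs a l)) summable_on Lam n \<and>
    infsum (Delta_1 n g gs a) (Lam n) = N_1 n g gs a b c d"
proof -
  interpret R: sfun_full "\<lambda>x. x" "\<lambda>x. x\<^sup>2" "\<lambda>m. 1 + real m" "\<lambda>m. 1 + real m" "\<lambda>x. x" "\<lambda>_. 1" rGamma
    by (rule sfun_full_rational)
  note R.s_0 [simp del] \<comment> \<open>here this is the looping rewrite rule \<open>0 = 0\<close>\<close>
  define \<sigma> where "\<sigma> = gs a + gs b + gs c + gs d"
  have \<rho>: "rho n g gs a j = R.rh n g (gs a) j" for j by (simp add: rho_def R.rh_def)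
  have \<rho>h: "rhohat n g gs a b c d j = R.hh n g \<sigma> j" for j
    by (simp add: rhohat_def R.hh_def ghat_values[OF perm] \<sigma>_def)
  have \<rho>hd: "R.hh n g \<sigma> j - R.hh n g \<sigma> k = R.rh n g (gs a) j - R.rh n g (gs a) k" for j k
    by (simp add: R.hh_def R.rh_def)
  note G = gen[unfolded generic_1_def Let_def \<rho> \<rho>h]
  have g1: "R.rh n g (gs a) j + R.rh n g (gs a) k \<noteq> 0" "R.rh n g (gs a) j - R.rh n g (gs a) k \<noteq> 0"
    if "j \<in> {1..n}" "k \<in> {j<..n}" for j k
    using G zero_in_Lam[of n] that by blast+
  have g2: "R.rh n g (gs a) j \<noteq> 0" if "j \<in> {1..n}" for j
    using G zero_in_Lam[of n] that by blast
  have g3: "1 - g + R.rh n g (gs a) j + R.rh n g (gs a) k \<notin> \<int>\<^sub>\<le>\<^sub>0"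
    "1 - g + R.rh n g (gs a) j - R.rh n g (gs a) k \<notin> \<int>\<^sub>\<le>\<^sub>0"
    "1 - R.hh n g \<sigma> j + R.hh n g \<sigma> k \<notin> \<int>\<^sub>\<le>\<^sub>0"
    if "j \<in> {1..n}" "k \<in> {j<..n}" for j k
    using G that by blast+
  have g4: "1 - gs r + R.rh n g (gs a) j \<notin> \<int>\<^sub>\<le>\<^sub>0" if "j \<in> {1..n}" "r \<in> {1..4}" for j r
    using G that by blast
  \<comment> \<open>\<open>rho\<close> and \<open>rhohat\<close> have the same differences, so a
    condition on \<open>rhohat\<close> supplies what \<open>N_raw_eq_N0\<close> needs for the
    factors in \<open>u - v\<close>.\<close>
  have g5: "1 - R.rh n g (gs a) j + R.rh n g (gs a) k \<notin> \<int>\<^sub>\<le>\<^sub>0" if "j \<in> {1..n}" "k \<in> {j<..n}" for j k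
  proof -
    have eq: "1 - R.hh n g \<sigma> j + R.hh n g \<sigma> k = 1 - R.rh n g (gs a) j + R.rh n g (gs a) k"
      using \<rho>hd[of j k] by (simp add: algebra_simps)
    show ?thesis using g3(3)[OF that] unfolding eq .
  qed
  have cv: "R.converges n g \<sigma>"
    unfolding R.converges_def using conv unfolding \<sigma>_def sum_permutation4[OF perm]
    by (simp add: algebra_simps)
  have sp: "R.sp x m = pochhammer x m" for x m
    by (simp add: R.sp_def pochhammer_prod lessThan_atLeast0)
  have pf: "R.pair_factor g x m = (1 + of_nat m / x) * (pochhammer (g + x) m / pochhammer (1 - g + x) m)" if "x \<noteq> 0" for x m
    unfolding R.pair_factor_def sp add_divide_distrib divide_self[OF that] ..
  have D: "Delta_1 n g gs a l = R.weight n g (gs a) (gs b) (gs c) (gs d) l" for l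
  proof -
    have e1: "(1 + of_nat (l j + l k) / (R.rh n g (gs a) j + R.rh n g (gs a) k)) *
          (1 + of_nat (l j - l k) / (R.rh n g (gs a) j - R.rh n g (gs a) k)) *
          ((pochhammer (g + R.rh n g (gs a) j + R.rh n g (gs a) k) (l j + l k) *
            pochhammer (g + R.rh n g (gs a) j - R.rh n g (gs a) k) (l j - l k)) /
           (pochhammer (1 - g + R.rh n g (gs a) j + R.rh n g (gs a) k) (l j + l k) *
            pochhammer (1 - g + R.rh n g (gs a) j - R.rh n g (gs a) k) (l j - l k)))
      = R.pair_factor g (R.rh n g (gs a) j + R.rh n g (gs a) k) (l j + l k) *
        R.pair_factor g (R.rh n g (gs a) j - R.rh n g (gs a) k) (l j - l k)"
      if "j \<in> {1..n}" "k \<in> {j<..n}" for j k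
      unfolding pf[OF g1(1)[OF that]] pf[OF g1(2)[OF that]] by (simp only: add.assoc add_diff_eq times_divide_times_eq mult_ac)
    have e2: "(1 + of_nat (l j) / R.rh n g (gs a) j) *
          ((\<Prod>r=1..4. pochhammer (gs r + R.rh n g (gs a) j) (l j)) /
           (\<Prod>r=1..4. pochhammer (1 - gs r + R.rh n g (gs a) j) (l j)))
      = (2 * R.rh n g (gs a) j + 2 * of_nat (l j)) / (2 * R.rh n g (gs a) j) *
        (R.single_factor (gs a) (R.rh n g (gs a) j) (l j) * R.single_factor (gs b) (R.rh n g (gs a) j) (l j) *
         R.single_factor (gs c) (R.rh n g (gs a) j) (l j) * R.single_factor (gs d) (R.rh n g (gs a) j) (l j))"
      if "j \<in> {1..n}" for j
    proof -
      have "1 + of_nat (l j) / R.rh n g (gs a) j = (2 * R.rh n g (gs a) j + 2 * of_nat (l j)) / (2 * R.rh n g (gs a) j)"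
        using g2[OF that] by (simp add: field_simps)
      thus ?thesis unfolding prod_permutation4[OF perm] R.single_factor_def sp by (simp only: times_divide_times_eq)
    qed
    show ?thesis unfolding Delta_1_def Let_def \<rho> R.weight_def
      by (rule arg_cong2[where f = "(*)"]; (rule prod.cong[OF refl])+; (rule e1 e2; assumption))
  qed
  \<comment> \<open>\<open>Gamma\<close> is by definition the inverse of \<open>rGamma\<close>, so
    the identity is formal and holds at poles as well.\<close>
  have N: "N_1 n g gs a b c d = R.N_raw n g (gs a) (gs b) (gs c) (gs d)"
    unfolding N_1_def R.N_raw_def Let_def \<rho> \<rho>h \<sigma>_def[symmetric] prod_permutation4[OF perm] ghat_values[OF perm] Gamma_def
    by (simp only: divide_inverse inverse_mult_distrib inverse_inverse_eq mult_ac)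
  have rG: "rGamma x \<noteq> 0" if "x \<notin> \<int>\<^sub>\<le>\<^sub>0" for x :: complex using that by (simp add: rGamma_eq_zero_iff)
  have single: "rGamma (1 - v + R.rh n g (gs a) j) \<noteq> 0" if "v \<in> {gs a, gs b, gs c, gs d}" and j: "j \<in> {1..n}" for v j
  proof -
    from that obtain r where "r \<in> {a, b, c, d}" and v: "v = gs r" by blast
    hence r: "r \<in> {1..4}" unfolding permutation4(7)[OF perm] by simp
    show ?thesis unfolding v by (rule rG[OF g4[OF j r]])
  qed
  have double: "2 * R.rh n g (gs a) j \<noteq> 0" if "j \<in> {1..n}" for j
    using g2[OF that] by simp
  have pair: "R.rh n g (gs a) j + R.rh n g (gs a) k \<noteq> 0 \<and> R.rh n g (gs a) j - R.rh n g (gs a) k \<noteq> 0 \<and>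
       rGamma (1 - g + R.rh n g (gs a) j + R.rh n g (gs a) k) \<noteq> 0 \<and>
       rGamma (1 - g + R.rh n g (gs a) j - R.rh n g (gs a) k) \<noteq> 0 \<and>
       rGamma (1 - R.rh n g (gs a) j + R.rh n g (gs a) k) \<noteq> 0" if "j \<in> {1..n}" "k \<in> {j<..n}" for j k
    by (intro conjI rG g1 g3(1,2) g5 that)
  note sum = R.summation_N_raw[OF n cv[unfolded \<sigma>_def] double pair single]
  show ?thesis unfolding D[abs_def] N using sum by simp
qed

text \<open>Passing from \<open>s\<close> to \<open>1 - q^x\<close> releases powers of
  \<open>q\<close>: each pair yields \<open>q^(-2 g l_j)\<close>, the single factors
  \<open>q^((1 - \<sigma>) l_j)\<close>. As \<open>j\<close> is the first index of
  \<open>n - j\<close> pairs, the total exponent is \<open>(1 - 2 rhohat_j) l_j\<close>, the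
  prefactor of \<open>Delta_q\<close>.\<close>

lemma summation_trig:
  assumes q: "0 < q" "q < 1"
    and n: "n \<ge> 1" and perm: "{a, b, c, d} = {1, 2, 3, 4}" and gen: "generic_q n q g gs a b c d"
    and conv: "\<forall>j\<in>{1..n}. Re (1 - 2 * of_nat (n - j) * g - gs 1 - gs 2 - gs 3 - gs 4) > 0"
  shows "(\<lambda>l. norm (Delta_q n q g gs a b c d l)) summable_on Lam n \<and>
    infsum (Delta_q n q g gs a b c d) (Lam n) = N_q n q g gs a b c d"
proof -
  define L where "L = lq q"
  define t where "t = (\<lambda>x. 1 - exp (x * L))"
  define GG where "GG = (\<lambda>x. qpoch_inf (exp (x * L)) (of_real q))"
  interpret R: sfun_full "ts q" "tf q" "te q" "\<lambda>_. 1" "\<lambda>x. 1 - exp (x * lq q)" "\<lambda>x. exp (- (x * lq q / 2))"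
      "\<lambda>x. qpoch_inf (exp (x * lq q)) (of_real q)"
    by (rule sfun_full_trig[OF q])
  have powr: "complex_of_real q powr z = exp (z * L)" for z
    using q by (simp add: powr_def L_def lq_def[OF q] Ln_of_real)
  define \<sigma> where "\<sigma> = gs a + gs b + gs c + gs d"
  have \<rho>: "rho n g gs a j = R.rh n g (gs a) j" for j by (simp add: rho_def R.rh_def)
  have \<rho>h: "rhohat n g gs a b c d j = R.hh n g \<sigma> j" for j
    by (simp add: rhohat_def R.hh_def ghat_values[OF perm] \<sigma>_def)
  have \<rho>hd: "R.hh n g \<sigma> j - R.hh n g \<sigma> k = R.rh n g (gs a) j - R.rh n g (gs a) k" for j k
    by (simp add: R.hh_def R.rh_def)
  note G = gen[unfolded generic_q_def Let_def \<rho> \<rho>h powr]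
  have s_t: "ts q x = exp (- (x * L / 2)) * t x" for x
    using ts_eq[OF q] by (simp add: t_def L_def)
  have s_nz: "ts q x \<noteq> 0" if "1 - exp (x * L) \<noteq> 0" for x using that by (simp add: s_t t_def)
  have g1: "1 - exp ((R.rh n g (gs a) j + R.rh n g (gs a) k) * L) \<noteq> 0" "1 - exp ((R.rh n g (gs a) j - R.rh n g (gs a) k) * L) \<noteq> 0"
    if "j \<in> {1..n}" "k \<in> {j<..n}" for j k
    using G zero_in_Lam[of n] that by blast+
  have g2: "1 - exp (2 * R.rh n g (gs a) j * L) \<noteq> 0" if "j \<in> {1..n}" for j
    using G zero_in_Lam[of n] that by blast
  have g3: "GG (1 - g + R.rh n g (gs a) j + R.rh n g (gs a) k) \<noteq> 0"
    "GG (1 - g + R.rh n g (gs a) j - R.rh n g (gs a) k) \<noteq> 0"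
    "GG (1 - R.hh n g \<sigma> j + R.hh n g \<sigma> k) \<noteq> 0"
    if "j \<in> {1..n}" "k \<in> {j<..n}" for j k
    unfolding GG_def using G that by blast+
  have g4: "GG (1 - gs r + R.rh n g (gs a) j) \<noteq> 0" if "j \<in> {1..n}" "r \<in> {1..4}" for j r
    unfolding GG_def using G that by blast
  have g5: "GG (1 - R.rh n g (gs a) j + R.rh n g (gs a) k) \<noteq> 0" if "j \<in> {1..n}" "k \<in> {j<..n}" for j k
  proof -
    have eq: "1 - R.hh n g \<sigma> j + R.hh n g \<sigma> k = 1 - R.rh n g (gs a) j + R.rh n g (gs a) k"
      using \<rho>hd[of j k] by (simp add: algebra_simps)
    show ?thesis using g3(3)[OF that] unfolding eq .
  qed
  have cv: "R.converges n g \<sigma>"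
    unfolding R.converges_def using conv unfolding \<sigma>_def sum_permutation4[OF perm]
    by (simp add: algebra_simps)
  define tp where "tp = (\<lambda>x m. \<Prod>i<m. t (x + of_nat i))"
  have qp: "qpoch (exp (x * L)) (of_real q) m = tp x m" for x m
    unfolding qpoch_def tp_def t_def
    by (intro prod.cong refl) (simp add: distrib_right exp_add exp_nat_lq[OF q] L_def)
  have shift: "exp (- ((x + of_nat m) * L / 2)) = exp (- (x * L / 2)) * exp (- (of_nat m * L / 2))" for x and m :: nat
    unfolding exp_add[symmetric] by (simp add: distrib_right add_divide_distrib)
  have sp_ratio: "R.sp (v + x) m / R.sp (w + x) m = tp (v + x) m / tp (w + x) m * exp (of_nat m * ((w - v) * L / 2))" for v w x m
  proof (induction m)
    case (Suc m)
    have "exp (- ((v + x + of_nat m) * L / 2)) / exp (- ((w + x + of_nat m) * L / 2)) = exp ((w - v) * L / 2)"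
      unfolding exp_diff[symmetric] by (rule arg_cong[where f = exp]) (simp add: field_simps)
    moreover have "exp (of_nat (Suc m) * ((w - v) * L / 2)) = exp (of_nat m * ((w - v) * L / 2)) * exp ((w - v) * L / 2)"
      unfolding exp_add[symmetric] by (rule arg_cong[where f = exp]) (simp add: field_simps)
    moreover have "R.sp (v + x) (Suc m) / R.sp (w + x) (Suc m) = (R.sp (v + x) m / R.sp (w + x) m) *
        ((t (v + x + of_nat m) / t (w + x + of_nat m)) * (exp (- ((v + x + of_nat m) * L / 2)) / exp (- ((w + x + of_nat m) * L / 2))))"
      unfolding R.sp_Suc s_t by (simp add: mult_ac)
    ultimately show ?case unfolding Suc by (simp add: tp_def mult_ac)
  qed (simp add: tp_def)
  have pf: "R.pair_factor g x m = t (x + of_nat m) / t x * (tp (g + x) m / tp (1 - g + x) m) * exp (- (of_nat m * g * L))" for x m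
  proof -
    have A: "ts q (x + of_nat m) / ts q x = t (x + of_nat m) / t x * exp (- (of_nat m * L / 2))"
      unfolding s_t shift by simp
    have B: "exp (- (of_nat m * L / 2)) * exp (of_nat m * ((1 - g - g) * L / 2)) = exp (- (of_nat m * g * L))"
      unfolding exp_add[symmetric] by (simp add: algebra_simps diff_divide_distrib)
    show ?thesis unfolding R.pair_factor_def sp_ratio[of g x m "1 - g"] A B[symmetric] by (simp only: mult_ac)
  qed
  define pp where "pp = (\<lambda>x m. t (x + of_nat m) / t x * (tp (g + x) m / tp (1 - g + x) m))"
  have D: "Delta_q n q g gs a b c d l = R.weight n g (gs a) (gs b) (gs c) (gs d) l" if l: "l \<in> Lam n" for l
  proof -
    define r where "r = R.rh n g (gs a)"
    have pairs: "R.pair_factor g (r j + r k) (l j + l k) * R.pair_factor g (r j - r k) (l j - l k)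
       = pp (r j + r k) (l j + l k) * pp (r j - r k) (l j - l k) * exp (- (2 * of_nat (l j) * g * L))"
      if "j \<in> {1..n}" "k \<in> {j<..n}" for j k
    proof -
      \<comment> \<open>The subtraction in \<open>nat\<close> is thus exact, and \<open>l k\<close>
        drops out of the exponent.\<close>
      have "l k \<le> l j" using LamD[OF l, of j k] that by auto
      hence E: "exp (- (of_nat (l j + l k) * g * L)) * exp (- (of_nat (l j - l k) * g * L)) = exp (- (2 * of_nat (l j) * g * L))"
        unfolding exp_add[symmetric] by (simp add: of_nat_diff algebra_simps)
      show ?thesis unfolding pf pp_def E[symmetric] by (simp only: mult_ac)
    qed
    have singles: "ts q (2 * r j + 2 * of_nat (l j)) / ts q (2 * r j) *
        (R.single_factor (gs a) (r j) (l j) * R.single_factor (gs b) (r j) (l j) *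
         R.single_factor (gs c) (r j) (l j) * R.single_factor (gs d) (r j) (l j))
      = t (2 * r j + 2 * of_nat (l j)) / t (2 * r j) *
         ((tp (gs a + r j) (l j) * tp (gs b + r j) (l j) * tp (gs c + r j) (l j) * tp (gs d + r j) (l j)) /
          (tp (1 - gs a + r j) (l j) * tp (1 - gs b + r j) (l j) * tp (1 - gs c + r j) (l j) * tp (1 - gs d + r j) (l j))) *
         exp ((1 - \<sigma>) * of_nat (l j) * L)" for j
    proof -
      have 1: "ts q (2 * r j + 2 * of_nat (l j)) / ts q (2 * r j) = t (2 * r j + 2 * of_nat (l j)) / t (2 * r j) * exp (- (of_nat (l j) * L))"
        using shift[of "2 * r j" "2 * l j"] unfolding s_t by simp
      have 2: "exp (- (of_nat (l j) * L)) * (exp (of_nat (l j) * ((1 - gs a - gs a) * L / 2)) * exp (of_nat (l j) * ((1 - gs b - gs b) * L / 2)) *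
         exp (of_nat (l j) * ((1 - gs c - gs c) * L / 2)) * exp (of_nat (l j) * ((1 - gs d - gs d) * L / 2))) = exp ((1 - \<sigma>) * of_nat (l j) * L)"
        unfolding exp_add[symmetric] \<sigma>_def by (rule arg_cong[where f = exp]) (simp add: field_simps)
      show ?thesis unfolding 1 2[symmetric] R.single_factor_def sp_ratio
        by (simp only: times_divide_times_eq[symmetric] mult_ac)
    qed
    have expo: "(\<Prod>j=1..n. \<Prod>k\<in>{j<..n}. exp (- (2 * of_nat (l j) * g * L))) * (\<Prod>j=1..n. exp ((1 - \<sigma>) * of_nat (l j) * L))
       = exp ((\<Sum>j=1..n. (1 - 2 * R.hh n g \<sigma> j) * of_nat (l j)) * L)"
    proof -
      have "(\<Prod>k\<in>{j<..n}. exp (- (2 * of_nat (l j) * g * L))) * exp ((1 - \<sigma>) * of_nat (l j) * L)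
         = exp ((1 - 2 * R.hh n g \<sigma> j) * of_nat (l j) * L)" for j
        unfolding prod_constant card_greaterThanAtMost exp_of_nat_mult[symmetric] exp_add[symmetric]
        by (rule arg_cong[where f = exp]) (simp add: R.hh_def algebra_simps)
      thus ?thesis unfolding prod.distrib[symmetric] sum_distrib_right by (simp add: exp_sum)
    qed
    have "R.weight n g (gs a) (gs b) (gs c) (gs d) l =
      (\<Prod>j=1..n. \<Prod>k\<in>{j<..n}. pp (r j + r k) (l j + l k) * pp (r j - r k) (l j - l k) * exp (- (2 * of_nat (l j) * g * L))) *
      (\<Prod>j=1..n. t (2 * r j + 2 * of_nat (l j)) / t (2 * r j) *
         ((tp (gs a + r j) (l j) * tp (gs b + r j) (l j) * tp (gs c + r j) (l j) * tp (gs d + r j) (l j)) /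
          (tp (1 - gs a + r j) (l j) * tp (1 - gs b + r j) (l j) * tp (1 - gs c + r j) (l j) * tp (1 - gs d + r j) (l j))) *
         exp ((1 - \<sigma>) * of_nat (l j) * L))"
      unfolding R.weight_def r_def[symmetric] singles
      by (intro arg_cong2[where f = "(*)"] prod.cong refl pairs)
    also have "\<dots> = exp ((\<Sum>j=1..n. (1 - 2 * R.hh n g \<sigma> j) * of_nat (l j)) * L) *
      (\<Prod>j=1..n. \<Prod>k\<in>{j<..n}. pp (r j + r k) (l j + l k) * pp (r j - r k) (l j - l k)) *
      (\<Prod>j=1..n. t (2 * r j + 2 * of_nat (l j)) / t (2 * r j) *
         ((tp (gs a + r j) (l j) * tp (gs b + r j) (l j) * tp (gs c + r j) (l j) * tp (gs d + r j) (l j)) /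
          (tp (1 - gs a + r j) (l j) * tp (1 - gs b + r j) (l j) * tp (1 - gs c + r j) (l j) * tp (1 - gs d + r j) (l j))))"
      unfolding expo[symmetric] prod.distrib by (simp only: mult_ac)
    also have "\<dots> = Delta_q n q g gs a b c d l"
    proof -
      have "pp (r j + r k) (l j + l k) * pp (r j - r k) (l j - l k) =
          t (r j + r k + of_nat (l j + l k)) / t (r j + r k) *
          (t (r j - r k + of_nat (l j - l k)) / t (r j - r k)) *
          ((tp (g + r j + r k) (l j + l k) * tp (g + r j - r k) (l j - l k)) /
           (tp (1 - g + r j + r k) (l j + l k) * tp (1 - g + r j - r k) (l j - l k)))" for j k
        unfolding pp_def by (simp only: add.assoc add_diff_eq times_divide_times_eq mult_ac)
      thus ?thesis
        unfolding Delta_q_def Let_def \<rho> \<rho>h powr qp prod_permutation4[OF perm] r_def[symmetric] by (simp only: t_def)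
    qed
    finally show ?thesis by simp
  qed
  have N: "N_q n q g gs a b c d = R.N_raw n g (gs a) (gs b) (gs c) (gs d)"
    unfolding N_q_def R.N_raw_def Let_def \<rho> \<rho>h \<sigma>_def[symmetric] prod_permutation4[OF perm] ghat_values[OF perm] powr L_def ..
  have single: "qpoch_inf (exp ((1 - v + R.rh n g (gs a) j) * lq q)) (of_real q) \<noteq> 0"
    if "v \<in> {gs a, gs b, gs c, gs d}" and j: "j \<in> {1..n}" for v j
  proof -
    from that obtain r where "r \<in> {a, b, c, d}" and v: "v = gs r" by blast
    hence r: "r \<in> {1..4}" unfolding permutation4(7)[OF perm] by simp
    show ?thesis unfolding v by (rule g4[OF j r, unfolded GG_def L_def])
  qed
  have pair: "ts q (R.rh n g (gs a) j + R.rh n g (gs a) k) \<noteq> 0 \<and> ts q (R.rh n g (gs a) j - R.rh n g (gs a) k) \<noteq> 0 \<and>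
       qpoch_inf (exp ((1 - g + R.rh n g (gs a) j + R.rh n g (gs a) k) * lq q)) (of_real q) \<noteq> 0 \<and>
       qpoch_inf (exp ((1 - g + R.rh n g (gs a) j - R.rh n g (gs a) k) * lq q)) (of_real q) \<noteq> 0 \<and>
       qpoch_inf (exp ((1 - R.rh n g (gs a) j + R.rh n g (gs a) k) * lq q)) (of_real q) \<noteq> 0" if "j \<in> {1..n}" "k \<in> {j<..n}" for j k
    by (intro conjI s_nz g1 g3(1,2)[unfolded GG_def L_def] g5[unfolded GG_def L_def] that)
  note sum = R.summation_N_raw[OF n cv[unfolded \<sigma>_def] s_nz[OF g2] pair single]
  have "infsum (Delta_q n q g gs a b c d) (Lam n) = infsum (R.weight n g (gs a) (gs b) (gs c) (gs d)) (Lam n)"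
    by (rule infsum_cong[OF D])
  moreover have "(\<lambda>l. norm (Delta_q n q g gs a b c d l)) summable_on Lam n \<longleftrightarrow>
      (\<lambda>l. norm (R.weight n g (gs a) (gs b) (gs c) (gs d) l)) summable_on Lam n"
    by (intro summable_on_cong) (simp add: D)
  ultimately show ?thesis using N sum by simp
qed

theorem theorem3p1:
  fixes n :: nat and q :: real and g :: complex and gs :: "nat \<Rightarrow> complex"
    and a b c d :: nat
  assumes "n \<ge> 1"
    and "0 < q" and "q \<le> 1"
    and "{a, b, c, d} = {1, 2, 3, 4}"
    and "generic_params n q g gs a b c d"
    and "\<forall>j\<in>{1..n}. Re (1 - 2 * of_nat (n - j) * g - gs 1 - gs 2 - gs 3 - gs 4) > 0"
  shows "(\<lambda>l. norm (Delta n q g gs a b c d l)) summable_on Lam n \<and>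
    (\<Sum>\<^sub>\<infinity>l\<in>Lam n. Delta n q g gs a b c d l) = N_const n q g gs a b c d"
proof (cases "q = 1")
  case True
  with assms show ?thesis
    using summation_rational[of n a b c d g gs]
    by (simp add: generic_params_def Delta_def N_const_def)
next
  case False
  with assms show ?thesis
    using summation_trig[of q n a b c d g gs]
    by (simp add: generic_params_def Delta_def N_const_def)
qed

end
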